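(* Let $G=(V,E)$ be a ribbon graph, let $a$ and $b$ be distinct edges of $G$ with neighbouring ends, and let $G_{ab}$ be the ribbon graph obtained from $G$ by handle sliding $a$ over $b$. Then $D(G_{ab})=D(G)_{ab}$.
   Context: A ribbon graph $G=(V,E)$ consists of a set $V$ of discs (vertices) and a set $E$ of discs (edges) such that vertices and edges intersect in disjoint line segments, each such segment lies on the boundary of exactly one vertex and exactly one edge, and every edge contains exactly two such segments (its ends). A spanning ribbon subgraph is obtained by deleting some edges (keeping all vertices). A quasi-tree is a ribbon graph with exactly one boundary component; a spanning quasi-tree of $G$ is a spanning ribbon subgraph restricting to a quasi-tree on each connected component of $G$. $D(G)$ is the set system $(E,\mathcal{F}(G))$ where $\mathcal{F}(G)$ is the set of edge sets of spanning quasi-trees of $G$. Edges $a,b$ have neighbouring ends if an end of $a$ and an end of $b$ are consecutive on the boundary of a vertex (no other edge end between them). The handle slide of $a$ over $b$ moves that end of $a$ by sliding it along the edge $b$ (following the boundary of $b$), so that it becomes attached to the vertex next to the other end of $b$; all else unchanged. For a set system $D=(E,\mathcal{F})$ and distinct $a,b\in E$, $D_{ab}=(E,\mathcal{F}_{ab})$ with $\mathcal{F}_{ab}=\mathcal{F}\triangle\{X\cup\{a\}: X\cup\{b\}\in\mathcal{F},\ X\subseteq E\setminus\{a,b\}\}$, $\triangle$ denoting symmetric difference. *)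

theory Defs
  imports "HOL-Analysis.Analysis"
begin

definition disc :: "'p::t2_space set \<Rightarrow> bool" where
  "disc D \<longleftrightarrow> D homeomorphic cball (0::complex) 1"

(* By invariance of domain every parametrisation of D gives the same set. *)
definition disc_boundary :: "'p::t2_space set \<Rightarrow> 'p set" where
  "disc_boundary D =
     {x. \<exists>h k. homeomorphism (cball (0::complex) 1) D h k \<and> x \<in> h ` sphere 0 1}"

definition line_segment :: "'p::t2_space set \<Rightarrow> bool" where
  "line_segment S \<longleftrightarrow> (\<exists>c. arc c \<and> path_image c = S)"

(* Reversing c shows that both endpoints are included. *)
definition endpoints :: "'p::t2_space set \<Rightarrow> 'p set" where
  "endpoints S = {x. \<exists>c. arc c \<and> path_image c = S \<and> pathstart c = x}"

(* Vertices are point sets in an ambient space.  Edges carry labels, so that an edge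
   keeps its name when its disc is moved by a handle slide. *)
record ('e, 'p) ribbon =
  Verts :: "'p set set"
  Edges :: "'e set"
  edge_disc :: "'e \<Rightarrow> 'p set"

definition ends :: "('e, 'p::t2_space) ribbon \<Rightarrow> 'e \<Rightarrow> 'p set set" where
  "ends G e = components (\<Union>(Verts G) \<inter> edge_disc G e)"

definition ribbon_graph :: "('e, 'p::t2_space) ribbon \<Rightarrow> bool" where
  "ribbon_graph G \<longleftrightarrow>
     finite (Verts G) \<and> finite (Edges G) \<and>
     (\<forall>v\<in>Verts G. disc v) \<and> (\<forall>e\<in>Edges G. disc (edge_disc G e)) \<and>
     pairwise disjnt (Verts G) \<and> disjoint_family_on (edge_disc G) (Edges G) \<and>
     (\<forall>e\<in>Edges G. card (ends G e) = 2 \<and>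
        (\<forall>S\<in>ends G e. line_segment S \<and>
           (\<exists>!v. v \<in> Verts G \<and> S \<subseteq> disc_boundary v) \<and>
           (\<exists>!e'. e' \<in> Edges G \<and> S \<subseteq> disc_boundary (edge_disc G e'))))"

definition space_of :: "('e, 'p::t2_space) ribbon \<Rightarrow> 'p set" where
  "space_of G = \<Union>(Verts G) \<union> (\<Union>e\<in>Edges G. edge_disc G e)"

definition spanning_subgraph :: "('e, 'p::t2_space) ribbon \<Rightarrow> 'e set \<Rightarrow> ('e, 'p) ribbon" where
  "spanning_subgraph G A = G\<lparr>Edges := A\<rparr>"

definition restrict_to :: "('e, 'p::t2_space) ribbon \<Rightarrow> 'p set \<Rightarrow> ('e, 'p) ribbon" where
  "restrict_to G K =
     G\<lparr>Verts := {v \<in> Verts G. v \<subseteq> K}, Edges := {e \<in> Edges G. edge_disc G e \<subseteq> K}\<rparr>"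

definition open_ends :: "('e, 'p::t2_space) ribbon \<Rightarrow> 'e \<Rightarrow> 'p set" where
  "open_ends G e = (\<Union>S\<in>ends G e. S - endpoints S)"

(* The boundary of the surface: the discs are glued along the ends, so exactly the points
   in the relative interiors of the ends become interior points of the surface. *)
definition boundary :: "('e, 'p::t2_space) ribbon \<Rightarrow> 'p set" where
  "boundary G =
     ((\<Union>v\<in>Verts G. disc_boundary v) \<union> (\<Union>e\<in>Edges G. disc_boundary (edge_disc G e)))
       - (\<Union>e\<in>Edges G. open_ends G e)"

definition quasi_tree :: "('e, 'p::t2_space) ribbon \<Rightarrow> bool" where
  "quasi_tree G \<longleftrightarrow> ribbon_graph G \<and> card (components (boundary G)) = 1"

definition spanning_quasi_tree :: "('e, 'p::t2_space) ribbon \<Rightarrow> 'e set \<Rightarrow> bool" where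
  "spanning_quasi_tree G A \<longleftrightarrow> A \<subseteq> Edges G \<and>
     (\<forall>K\<in>components (space_of G). quasi_tree (restrict_to (spanning_subgraph G A) K))"

type_synonym 'e set_system = "'e set \<times> 'e set set"

definition delta_matroid :: "('e, 'p::t2_space) ribbon \<Rightarrow> 'e set_system" where
  "delta_matroid G = (Edges G, {A. spanning_quasi_tree G A})"

definition slide_system :: "'e set_system \<Rightarrow> 'e \<Rightarrow> 'e \<Rightarrow> 'e set_system" where
  "slide_system D a b =
     (let (E, F) = D in
        (E, sym_diff F {X \<union> {a} | X. X \<union> {b} \<in> F \<and> X \<subseteq> E - {a, b}}))"

(* x and y lie on the same arc of a vertex boundary that contains no edge end.  For
   endpoints x, y of two different ends this says that the ends are consecutive there,
   with x and y facing each other. *)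
definition joined_at_vertex :: "('e, 'p::t2_space) ribbon \<Rightarrow> 'p \<Rightarrow> 'p \<Rightarrow> bool" where
  "joined_at_vertex G x y \<longleftrightarrow>
     (\<exists>v\<in>Verts G. \<exists>C\<in>components (disc_boundary v - (\<Union>e\<in>Edges G. open_ends G e)).
        x \<in> C \<and> y \<in> C)"

(* x and y lie on the same one of the two free sides of the edge e. *)
definition joined_along_edge :: "('e, 'p::t2_space) ribbon \<Rightarrow> 'e \<Rightarrow> 'p \<Rightarrow> 'p \<Rightarrow> bool" where
  "joined_along_edge G e x y \<longleftrightarrow>
     (\<exists>C\<in>components (disc_boundary (edge_disc G e) - open_ends G e). x \<in> C \<and> y \<in> C)"

definition neighbouring_ends :: "('e, 'p::t2_space) ribbon \<Rightarrow> 'e \<Rightarrow> 'e \<Rightarrow> bool" where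
  "neighbouring_ends G a b \<longleftrightarrow>
     (\<exists>S\<in>ends G a. \<exists>T\<in>ends G b. \<exists>q\<in>endpoints S. \<exists>p\<in>endpoints T. joined_at_vertex G q p)"

(* H is a result of sliding a over b in G.  The homeomorphism f says that everything but
   the slid end of a is unchanged.  The end S of a, with endpoints q and r, is next to the
   end T of b, where q faces the endpoint p of T.  The slide moves S past p, along the side
   of b from p to the endpoint p' of the other end T', and on to the vertex boundary beyond
   p'.  So in the new position S2 the endpoint r2 that corresponds to r is the one facing p'
   (it trails q along the way), and r2 is joined to the fixed end S' of a along the side of
   a that previously ended at r; this records that a is carried along without twisting.
   Where a has neighbouring ends with b in several places, each of them gives a slide. *)
definition handle_slide ::
  "('e, 'p::t2_space) ribbon \<Rightarrow> 'e \<Rightarrow> 'e \<Rightarrow> ('e, 'q::t2_space) ribbon \<Rightarrow> bool" where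
  "handle_slide G a b H \<longleftrightarrow>
     ribbon_graph H \<and> Edges H = Edges G \<and>
     (\<exists>f g. homeomorphism (space_of (spanning_subgraph G (Edges G - {a})))
                          (space_of (spanning_subgraph H (Edges H - {a}))) f g \<and>
        (`) f ` Verts G = Verts H \<and>
        (\<forall>e\<in>Edges G - {a}. f ` edge_disc G e = edge_disc H e) \<and>
        (\<exists>S S' T T' S2 q r p p' r2 x.
           ends G a = {S, S'} \<and> ends G b = {T, T'} \<and> ends H a = {S2, f ` S'} \<and>
           endpoints S = {q, r} \<and> p \<in> endpoints T \<and> joined_at_vertex G q p \<and>
           p' \<in> endpoints T' \<and> joined_along_edge G b p p' \<and>
           r2 \<in> endpoints S2 \<and> joined_at_vertex H (f p') r2 \<and>
           x \<in> endpoints S' \<and> joined_along_edge G a r x \<and> joined_along_edge H a r2 (f x)))"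

end

theory Submission
  imports Defs "HOL-Complex_Analysis.Contour_Integration"
begin

text \<open>Fix the endpoints of all edge ends as nodes (flags).  The boundary of the spanning subgraph
  on A is obtained from the vertex arcs between flags by adding the two sides of every edge in A
  and the two ends of every other edge, so its components are the cycles of a union of two perfect
  matchings on the flags, plus the circles of isolated vertices.  A is a spanning quasi-tree iff
  this number of components equals its lower bound, the number k of components of G.

  For the slide, fix X avoiding a and b and contract everything else.  What remains is a pairing of
  six terminals: the two flags at either end of b and those at the fixed end of a.  The sliding end
  of a can be moved onto an end of b, which turns X + a, X + b and X + a (after the slide) into three
  ways of closing up the same strands.  These form a triangle, and of its sides an even number
  reduces the component count to k.  For X + a + b the slide changes nothing.\<close>

section \<open>Closed arcs, circles, and the removal of open subarcs\<close>

section \<open>Arcs and loops\<close>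

text \<open>The two graphs may lie in different spaces, and the homeomorphism between them ignores
  \<open>a\<close>. Every count is therefore moved to data that forget the sliding end and agree for
  both graphs up to homeomorphism; the end is then put back beside \<open>p\<close> or beside
  \<open>p'\<close>. After the slide it again lies beside an end of \<open>b\<close>, so one lemma
  yields the counts of both graphs, with \<open>T\<close> and \<open>T'\<close> exchanged. Twisted
  and untwisted edges need no case distinction: which flags share a side is recorded in the names of
  the flags alone. The parity statement is false for an arbitrary number k. It needs k as a lower
  bound of all five counts, those of X and X + a + b included, and the same k for both graphs; hence
  the number of connected components has to be shown invariant under the slide. Orientations and
  genus never enter: all that is compared are numbers of components, in the end for finitely many
  pairings of six points.\<close>

lemma line_segment_iff_homeomorphic: "line_segment S \<longleftrightarrow> S homeomorphic {0..1::real}"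
proof
  assume "line_segment S"
  then show "S homeomorphic {0..1::real}"
    unfolding line_segment_def by (metis homeomorphic_def homeomorphic_sym homeomorphism_arc)
next
  assume "S homeomorphic {0..1::real}"
  then have "{0..1::real} homeomorphic S"
    by (simp add: homeomorphic_sym[of S])
  then obtain g h where "homeomorphism {0..1::real} S g h"
    unfolding homeomorphic_def by blast
  then have "arc g \<and> path_image g = S"
    unfolding arc_def path_def path_image_def homeomorphism_def by (metis inj_on_inverseI)
  then show "line_segment S"
    unfolding line_segment_def by blast
qed

lemma connected_remove_iff_endpoint:
  fixes t :: real
  assumes "t \<in> {0..1}"
  shows "connected ({0..1} - {t}) \<longleftrightarrow> t = 0 \<or> t = 1"
proof
  assume "connected ({0..1} - {t})"
  then have "0 \<notin> {0..1} - {t} \<or> 1 \<notin> {0..1} - {t}"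
    using assms connected_contains_Icc[of "{0..1} - {t}" 0 1] by blast
  then show "t = 0 \<or> t = 1"
    by auto
next
  have "{0..1} - {0} = {0<..1::real}" "{0..1} - {1} = {0..<1::real}"
    by auto
  moreover assume "t = 0 \<or> t = 1"
  ultimately show "connected ({0..1} - {t})"
    using connected_Ioc[of 0 "1::real"] connected_Ico[of 0 "1::real"] by metis
qed

lemma homeomorphism_remove:
  assumes "homeomorphism S T f g" "x \<in> S"
  shows "homeomorphism (S - {x}) (T - {f x}) f g"
proof (rule homeomorphism_of_subsets[OF assms(1)])
  show "f ` (S - {x}) = T - {f x}"
    using assms unfolding homeomorphism_def by (auto simp: image_iff) metis
qed auto

text \<open>Removing a point of [0, 1] other than 0 and 1 disconnects the interval, and every
  parametrisation carries this over to the arc. The criterion makes endpoints intrinsic, so that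
  homeomorphisms preserve them.\<close>

lemma endpoints_iff:
  assumes "line_segment S"
  shows "x \<in> endpoints S \<longleftrightarrow> x \<in> S \<and> connected (S - {x})"
proof -
  have eq: "connected (S - {c t}) \<longleftrightarrow> t = 0 \<or> t = 1"
    if c: "arc c" "path_image c = S" and t: "t \<in> {0..1}" for c and t :: real
  proof -
    obtain h where "homeomorphism {0..1} S c h"
      using homeomorphism_arc c by metis
    then have "({0..1} - {t}) homeomorphic (S - {c t})"
      using homeomorphism_remove t unfolding homeomorphic_def by blast
    then show ?thesis
      using connected_remove_iff_endpoint[OF t] homeomorphic_connectedness by blast
  qed
  obtain c where c: "arc c" "path_image c = S"
    using assms unfolding line_segment_def by blast
  show ?thesis
  proof
    assume "x \<in> endpoints S"
    then obtain d where "arc d" "path_image d = S" "d 0 = x"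
      unfolding endpoints_def pathstart_def by blast
    then show "x \<in> S \<and> connected (S - {x})"
      using eq[of d 0] by (auto simp: path_image_def)
  next
    assume x: "x \<in> S \<and> connected (S - {x})"
    then obtain t where t: "t \<in> {0..1}" "c t = x"
      using c unfolding path_image_def by blast
    then have "t = 0 \<or> t = 1"
      using eq c x by blast
    then have "pathstart c = x \<or> pathstart (reversepath c) = x"
      using t by (auto simp: pathstart_def reversepath_def)
    moreover have "arc (reversepath c)" "path_image (reversepath c) = S"
      using c by (auto simp: arc_reversepath)
    ultimately show "x \<in> endpoints S"
      using c unfolding endpoints_def by blast
  qed
qed

lemma endpoints_homeomorphism_image:
  assumes hom: "homeomorphism S T f g" and S: "line_segment S"
  shows "line_segment T" "endpoints T = f ` endpoints S"
proof -
  show T: "line_segment T"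
    using assms unfolding line_segment_iff_homeomorphic
    by (meson homeomorphic_def homeomorphic_sym homeomorphic_trans)
  have "connected (S - {x}) \<longleftrightarrow> connected (T - {f x})" if "x \<in> S" for x
    using homeomorphism_remove[OF hom that] homeomorphic_connectedness homeomorphic_def by blast
  moreover have "f ` S = T"
    using hom homeomorphism_image1 by blast
  ultimately have "f x \<in> endpoints T \<longleftrightarrow> x \<in> endpoints S" if "x \<in> S" for x
    using endpoints_iff[OF S, of x] endpoints_iff[OF T, of "f x"] that by blast
  moreover have "endpoints S \<subseteq> S" "endpoints T \<subseteq> f ` S"
    using endpoints_iff[OF S] endpoints_iff[OF T] \<open>f ` S = T\<close> by blast+
  ultimately show "endpoints T = f ` endpoints S"
    by blast
qed

lemma endpoints_interval:
  fixes u v :: real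
  assumes "u < v"
  shows "line_segment {u..v}" "endpoints {u..v} = {u, v}"
proof -
  show *: "line_segment {u..v}"
    unfolding line_segment_iff_homeomorphic
    by (rule homeomorphic_closed_intervals_real) (use assms in auto)
  have "connected ({u..v} - {x}) \<longleftrightarrow> x = u \<or> x = v" if "x \<in> {u..v}" for x
  proof
    assume "connected ({u..v} - {x})"
    then have "u \<notin> {u..v} - {x} \<or> v \<notin> {u..v} - {x}"
      using that connected_contains_Icc[of "{u..v} - {x}" u v] by blast
    then show "x = u \<or> x = v" using assms by auto
  next
    have "{u..v} - {u} = {u<..v}" "{u..v} - {v} = {u..<v}"
      by auto
    moreover assume "x = u \<or> x = v"
    ultimately show "connected ({u..v} - {x})"
      using connected_Ioc[of u v] connected_Ico[of u v] by metis
  qed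
  then show "endpoints {u..v} = {u, v}"
    using endpoints_iff[OF *] assms by auto
qed

lemma line_segment_homeomorphism:
  assumes "line_segment S"
  obtains g h where "homeomorphism {0..1::real} S g h" "endpoints S = {g 0, g 1}" "g 0 \<noteq> g 1"
proof -
  have "{0..1::real} homeomorphic S"
    using assms by (simp add: line_segment_iff_homeomorphic homeomorphic_sym[of S])
  then obtain g h where gh: "homeomorphism {0..1::real} S g h"
    unfolding homeomorphic_def by blast
  moreover have "endpoints S = {g 0, g 1}"
    using endpoints_homeomorphism_image[OF gh] endpoints_interval[of 0 1] by auto
  moreover have "g 0 \<noteq> g 1"
    using homeomorphism_apply1[OF gh, of 0] homeomorphism_apply1[OF gh, of 1] by auto
  ultimately show ?thesis
    using that by blast
qed

lemma line_segment_topology: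
  assumes "line_segment S"
  shows "compact S" "connected S" "closed S" "S \<noteq> {}" "endpoints S \<subseteq> S"
    "finite (endpoints S)" "card (endpoints S) = 2"
proof -
  obtain g h where gh: "homeomorphism {0..1::real} S g h" "endpoints S = {g 0, g 1}" "g 0 \<noteq> g 1"
    using line_segment_homeomorphism[OF assms] .
  have "S homeomorphic {0..1::real}"
    using assms line_segment_iff_homeomorphic by blast
  then show "compact S" "connected S"
    using homeomorphic_compactness[of S "{0..1::real}"] homeomorphic_connectedness[of S "{0..1::real}"]
    by auto
  then show "closed S" by (simp add: compact_imp_closed)
  show "S \<noteq> {}" "endpoints S \<subseteq> S"
    using gh homeomorphism_image1[OF gh(1)] by auto
  show "finite (endpoints S)" "card (endpoints S) = 2"
    using gh by auto
qed

lemma connected_line_segment_interior: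
  assumes "line_segment S"
  shows "connected (S - endpoints S)"
proof -
  obtain g h where gh: "homeomorphism {0..1::real} S g h" "endpoints S = {g 0, g 1}" "g 0 \<noteq> g 1"
    using line_segment_homeomorphism[OF assms] .
  have inj: "inj_on g {0..1}" and img: "g ` {0..1} = S" and cont: "continuous_on {0..1} g"
    using gh(1) unfolding homeomorphism_def by (auto intro: inj_on_inverseI)
  have "S - endpoints S = g ` ({0..1} - {0,1})"
    using inj img gh(2) by (simp add: inj_on_image_set_diff)
  also have "{0..1} - {0,1} = {0<..<1::real}" by auto
  finally have eq: "S - endpoints S = g ` {0<..<1}" .
  have "continuous_on {0<..<1} g" using cont by (rule continuous_on_subset) auto
  then show "connected (S - endpoints S)"
    unfolding eq by (rule connected_continuous_image) auto
qed

text \<open>Under a parametrisation of \<open>Q\<close> the subarc becomes a compact interval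
  strictly inside [0, 1]. The names list the four endpoints in the order u, q, r, w along
  \<open>Q\<close>, which later tells which flags face each other.\<close>

lemma line_segment_cut:
  assumes Q: "line_segment Q" and S: "line_segment S" and SQ: "S \<subseteq> Q - endpoints Q"
  obtains u w q r Q1 Q2 where
    "endpoints Q = {u, w}" "u \<noteq> w" "endpoints S = {q, r}" "q \<noteq> r"
    "line_segment Q1" "line_segment Q2" "disjnt Q1 Q2" "Q1 \<union> Q2 = Q - (S - endpoints S)"
    "endpoints Q1 = {u, q}" "endpoints Q2 = {r, w}"
proof -
  obtain g h where gh: "homeomorphism {0..1::real} Q g h" and e: "endpoints Q = {g 0, g 1}" "g 0 \<noteq> g 1"
    using line_segment_homeomorphism[OF Q] .
  have inj: "inj_on g {0..1}" and img: "g ` {0..1} = Q"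
    using gh unfolding homeomorphism_def by (auto intro: inj_on_inverseI)
  have sub: "homeomorphism I (g ` I) g h" if "I \<subseteq> {0..1}" for I
    using homeomorphism_of_subsets[OF gh that _ refl] img that by blast
  define I where "I = h ` S"
  have "homeomorphism S I h g"
    unfolding I_def using SQ homeomorphism_image2[OF gh]
    by (intro homeomorphism_of_subsets[OF homeomorphism_symD[OF gh] _ _ refl]) auto
  then have I: "line_segment I"
    using endpoints_homeomorphism_image(1) S by blast
  have gI: "g ` I = S"
    using \<open>homeomorphism S I h g\<close> homeomorphism_image2 by blast
  have I01: "I \<subseteq> {0..1}"
    unfolding I_def using SQ gh homeomorphism_image2 by blast
  obtain \<alpha> \<beta> where ab: "I = {\<alpha>..\<beta>}"
    using line_segment_topology(1,2)[OF I] connected_compact_interval_1 by blast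
  \<comment> \<open>A degenerate interval has at most one point, but an arc has two
    endpoints.\<close>
  have "\<alpha> < \<beta>"
  proof (rule ccontr)
    assume "\<not> \<alpha> < \<beta>"
    then have "I \<subseteq> {\<alpha>}" using ab by auto
    then have "finite I" using finite_subset by blast
    then have "card (endpoints I) \<le> card {\<alpha>}"
      using line_segment_topology[OF I] \<open>I \<subseteq> {\<alpha>}\<close> by (intro card_mono) auto
    then show False using line_segment_topology(7)[OF I] by simp
  qed
  have "g 0 \<notin> S" "g 1 \<notin> S" using SQ e by auto
  then have "0 \<notin> I" "1 \<notin> I" using gI by auto
  moreover have "0 \<le> \<alpha>" "\<beta> \<le> 1"
    using I01 ab \<open>\<alpha> < \<beta>\<close> by auto
  ultimately have "0 < \<alpha>" "\<beta> < 1"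
    using ab \<open>\<alpha> < \<beta>\<close> by (cases "\<alpha> = 0"; cases "\<beta> = 1"; auto)+
  have img_sub: "line_segment (g ` {s..t}) \<and> endpoints (g ` {s..t}) = {g s, g t}"
    if "0 \<le> s" "s < t" "t \<le> 1" for s t
    using endpoints_homeomorphism_image[OF sub endpoints_interval(1), of s t] endpoints_interval(2)[of s t] that
    by auto
  show ?thesis
  proof
    show "endpoints Q = {g 0, g 1}" "g 0 \<noteq> g 1" by (fact e)+
    show eS: "endpoints S = {g \<alpha>, g \<beta>}"
      using img_sub[of \<alpha> \<beta>] gI ab \<open>0 < \<alpha>\<close> \<open>\<alpha> < \<beta>\<close> \<open>\<beta> < 1\<close> by auto
    show "g \<alpha> \<noteq> g \<beta>"
      using line_segment_topology(7)[OF S] eS by auto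
    show "line_segment (g ` {0..\<alpha>})" "endpoints (g ` {0..\<alpha>}) = {g 0, g \<alpha>}"
      "line_segment (g ` {\<beta>..1})" "endpoints (g ` {\<beta>..1}) = {g \<beta>, g 1}"
      using img_sub[of 0 \<alpha>] img_sub[of \<beta> 1] \<open>0 < \<alpha>\<close> \<open>\<alpha> < \<beta>\<close> \<open>\<beta> < 1\<close> by auto
    show "disjnt (g ` {0..\<alpha>}) (g ` {\<beta>..1})"
      unfolding disjnt_def using inj \<open>0 < \<alpha>\<close> \<open>\<alpha> < \<beta>\<close> \<open>\<beta> < 1\<close>
      by (subst inj_on_image_Int[symmetric, where C = "{0..1}"]) auto
    have "S - endpoints S = g ` ({\<alpha>..\<beta>} - {\<alpha>, \<beta>})"
      unfolding eS unfolding gI[symmetric] ab using inj I01 ab \<open>\<alpha> < \<beta>\<close>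
      by (subst inj_on_image_set_diff[where C = "{0..1}"]) auto
    then have "Q - (S - endpoints S) = g ` ({0..1} - ({\<alpha>..\<beta>} - {\<alpha>, \<beta>}))"
      unfolding img[symmetric] using inj I01 ab
      by (subst inj_on_image_set_diff[where C = "{0..1}"]) auto
    also have "{0..1} - ({\<alpha>..\<beta>} - {\<alpha>, \<beta>}) = {0..\<alpha>} \<union> {\<beta>..1}"
      using \<open>0 < \<alpha>\<close> \<open>\<alpha> < \<beta>\<close> \<open>\<beta> < 1\<close> by auto
    finally show "g ` {0..\<alpha>} \<union> g ` {\<beta>..1} = Q - (S - endpoints S)"
      by (simp add: image_Un)
  qed
qed

definition loop :: "'p::t2_space set \<Rightarrow> bool" where
  "loop C \<longleftrightarrow> C homeomorphic sphere (0::complex) 1"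

lemma loop_topology:
  assumes "loop C"
  shows "compact C" "connected C" "closed C" "C \<noteq> {}"
proof -
  have "connected (sphere (0::complex) 1)"
    by (rule connected_sphere) simp
  then show "compact C" "connected C" "C \<noteq> {}"
    using assms homeomorphic_compactness[of C "sphere (0::complex) 1"]
      homeomorphic_connectedness[of C "sphere (0::complex) 1"] unfolding loop_def by auto
  then show "closed C" by (simp add: compact_imp_closed)
qed

text \<open>A parametrisation of \<open>D\<close> turns \<open>S\<close> into a connected subset of
  [0, 1] that contains 0 and 1.\<close>

lemma line_segment_eqI:
  assumes d: "line_segment D" and S: "line_segment S" "S \<subseteq> D" "endpoints D \<subseteq> S"
  shows "S = D"
proof -
  obtain g h where gh: "homeomorphism {0..1::real} D g h" and e: "endpoints D = {g 0, g 1}"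
    using line_segment_homeomorphism[OF d] by metis
  have "homeomorphism S (h ` S) h g"
    using homeomorphism_of_subsets[OF homeomorphism_symD[OF gh] S(2) _ refl]
      homeomorphism_image2[OF gh] S(2) by blast
  then have "connected (h ` S)"
    using line_segment_topology(2)[OF S(1)] connected_continuous_image homeomorphism_cont1 by blast
  moreover have "h (g 0) \<in> h ` S" "h (g 1) \<in> h ` S"
    using e S(3) by auto
  then have "0 \<in> h ` S" "1 \<in> h ` S"
    using homeomorphism_apply1[OF gh, of 0] homeomorphism_apply1[OF gh, of 1] by auto
  ultimately have "{0..1} \<subseteq> h ` S"
    by (intro connected_contains_Icc)
  then have "g ` {0..1} \<subseteq> S"
    using \<open>homeomorphism S (h ` S) h g\<close> homeomorphism_image2 by blast
  then show ?thesis
    using S(2) homeomorphism_image1[OF gh] by blast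
qed

text \<open>The endpoints of \<open>S\<close> split the circle into two arcs that meet only there.
  The interior of \<open>S\<close> is connected and avoids both points, hence lies in one of these
  arcs; \<open>S\<close> then equals that arc, and what remains is the other one.\<close>

lemma sphere_cut:
  fixes S :: "complex set"
  assumes S: "line_segment S" and SC: "S \<subseteq> sphere 0 1"
  shows "line_segment (sphere 0 1 - (S - endpoints S))"
    and "endpoints (sphere 0 1 - (S - endpoints S)) = endpoints S"
proof -
  obtain q r where qr: "endpoints S = {q, r}" "q \<noteq> r"
    using line_segment_topology(7)[OF S] by (auto simp: card_2_iff)
  have "{q, r} \<subseteq> sphere 0 1"
    using line_segment_topology(5)[OF S] SC qr by auto
  moreover have "simple_path (circlepath (0::complex) 1)" "pathfinish (circlepath (0::complex) 1) = pathstart (circlepath (0::complex) 1)"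
    "path_image (circlepath (0::complex) 1) = sphere 0 1"
    by (simp_all add: simple_path_circlepath)
  ultimately obtain u d where ud: "arc u" "arc d" "pathstart u = q" "pathfinish u = r"
      "pathstart d = r" "pathfinish d = q" "path_image u \<inter> path_image d = {q, r}"
      "path_image u \<union> path_image d = sphere 0 1"
    using exists_double_arc[of "circlepath (0::complex) 1" q r] qr(2) by (metis insert_subset)
  have ends: "line_segment (path_image c) \<and> endpoints (path_image c) = {pathstart c, pathfinish c}"
    if c: "arc c" for c :: "real \<Rightarrow> complex"
  proof -
    obtain h where "homeomorphism {0..1} (path_image c) c h"
      using homeomorphism_arc[OF c] .
    then show ?thesis
      using endpoints_homeomorphism_image[of "{0..1}" "path_image c" c h] endpoints_interval[of 0 1]
      by (auto simp: pathstart_def pathfinish_def)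
  qed
  have cl: "closed (path_image u)" "closed (path_image d)"
    using ends ud line_segment_topology(3) by blast+
  have int: "connected (S - endpoints S)"
    using connected_line_segment_interior[OF S] by blast
  have "S - endpoints S \<subseteq> path_image u \<union> path_image d"
    using SC ud by blast
  moreover have "path_image u \<inter> path_image d \<inter> (S - endpoints S) = {}"
    using ud qr by blast
  ultimately have "path_image u \<inter> (S - endpoints S) = {} \<or> path_image d \<inter> (S - endpoints S) = {}"
    using int cl unfolding connected_closed by blast
  then have *: "\<exists>c d. arc c \<and> arc d \<and> S \<subseteq> path_image c \<and> endpoints (path_image c) = {q,r} \<and>
      endpoints (path_image d) = {q,r} \<and> path_image c \<inter> path_image d = {q, r} \<and>
      path_image c \<union> path_image d = sphere 0 1"
  proof
    assume "path_image u \<inter> (S - endpoints S) = {}"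
    then have "S \<subseteq> path_image d"
      using SC ud qr by blast
    then show ?thesis
      using ud ends by (intro exI[of _ d] exI[of _ u]) auto
  next
    assume "path_image d \<inter> (S - endpoints S) = {}"
    then have "S \<subseteq> path_image u"
      using SC ud qr by blast
    then show ?thesis
      using ud ends by (intro exI[of _ u] exI[of _ d]) auto
  qed
  then obtain c d where cd: "arc c" "arc d" "S \<subseteq> path_image c" "endpoints (path_image c) = {q,r}"
      "endpoints (path_image d) = {q,r}" "path_image c \<inter> path_image d = {q, r}"
      "path_image c \<union> path_image d = sphere 0 1"
    by blast
  have "S = path_image c"
    using line_segment_eqI[of "path_image c" S] ends cd S qr line_segment_topology(5)[OF S] by auto
  moreover have "sphere 0 1 - (path_image c - {q, r}) = path_image d"
    unfolding cd(7)[symmetric] using cd(6) by blast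
  ultimately have "sphere 0 1 - (S - endpoints S) = path_image d"
    using qr(1) by simp
  then show "line_segment (sphere 0 1 - (S - endpoints S))"
    "endpoints (sphere 0 1 - (S - endpoints S)) = endpoints S"
    using ends[OF cd(2)] cd(5) qr(1) by simp_all
qed

lemma loop_cut:
  assumes C: "loop C" and S: "line_segment S" and SC: "S \<subseteq> C"
  shows "line_segment (C - (S - endpoints S))" "endpoints (C - (S - endpoints S)) = endpoints S"
proof -
  obtain h k where hk: "homeomorphism C (sphere (0::complex) 1) h k"
    using C unfolding loop_def homeomorphic_def by blast
  have hS: "homeomorphism S (h ` S) h k"
    using homeomorphism_of_subsets[OF hk SC] SC homeomorphism_image1[OF hk] by blast
  note seg = endpoints_homeomorphism_image[OF hS S]
  have sub: "h ` S \<subseteq> sphere 0 1"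
    using SC homeomorphism_image1[OF hk] by blast
  let ?D = "sphere 0 1 - (h ` S - endpoints (h ` S))"
  have inj: "inj_on h C" "inj_on k (sphere 0 1)"
    using hk unfolding homeomorphism_def by (auto intro: inj_on_inverseI)
  have kh: "k ` (h ` X) = X" if "X \<subseteq> C" for X
    using homeomorphism_apply1[OF hk] that by (force simp: image_iff)
  have "endpoints S \<subseteq> S" using line_segment_topology(5)[OF S] .
  then have "h ` (C - (S - endpoints S)) = ?D"
    unfolding seg homeomorphism_image1[OF hk, symmetric] using inj(1) SC
    by (simp add: inj_on_image_set_diff[where C = C] subset_iff)
  then have "k ` ?D = C - (S - endpoints S)"
    using kh[of "C - (S - endpoints S)"] by (metis Diff_subset)
  then have hD: "homeomorphism ?D (C - (S - endpoints S)) k h"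
    by (intro homeomorphism_of_subsets[OF homeomorphism_symD[OF hk]]) auto
  show "line_segment (C - (S - endpoints S))"
    using endpoints_homeomorphism_image(1)[OF hD] sphere_cut[OF seg(1) sub] by blast
  have "endpoints (C - (S - endpoints S)) = k ` h ` endpoints S"
    using endpoints_homeomorphism_image(2)[OF hD] sphere_cut[OF seg(1) sub] seg by metis
  then show "endpoints (C - (S - endpoints S)) = endpoints S"
    using kh[of "endpoints S"] \<open>endpoints S \<subseteq> S\<close> SC by simp
qed

section \<open>Components of finite graphs and their behaviour under contraction\<close>

section \<open>Counting classes of a graph\<close>

text \<open>Symmetrising inside the definition lets a relation list an edge in one direction only,
  as the lists of the finite check do.\<close>

definition conn :: "('a \<times> 'a) set \<Rightarrow> ('a \<times> 'a) set" where
  "conn E = (E \<union> E\<inverse>)\<^sup>*"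

definition nclasses :: "'a set \<Rightarrow> ('a \<times> 'a) set \<Rightarrow> nat" where
  "nclasses V E = card ((\<lambda>v. conn E `` {v}) ` V)"

lemma conn_refl [simp]: "(u, u) \<in> conn E"
  by (simp add: conn_def)

lemma conn_edge: "(u, w) \<in> E \<Longrightarrow> (u, w) \<in> conn E"
  by (simp add: conn_def r_into_rtrancl)

lemma conn_sym: "(u, w) \<in> conn E \<Longrightarrow> (w, u) \<in> conn E"
  unfolding conn_def by (metis converse_Un converse_converse rtrancl_converseI sup_commute)

lemma conn_trans: "(u, v) \<in> conn E \<Longrightarrow> (v, w) \<in> conn E \<Longrightarrow> (u, w) \<in> conn E"
  unfolding conn_def by (rule rtrancl_trans)

lemma conn_join: "(u, v) \<in> conn E \<Longrightarrow> (w, v) \<in> conn E \<Longrightarrow> (u, w) \<in> conn E"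
  by (rule conn_trans[OF _ conn_sym])

lemma conn_induct [consumes 1, case_names refl step]:
  assumes "(u, w) \<in> conn E" "Q u"
    and "\<And>v w. Q v \<Longrightarrow> (v, w) \<in> E \<or> (w, v) \<in> E \<Longrightarrow> Q w"
  shows "Q w"
  using assms(1) unfolding conn_def by (induction rule: rtrancl_induct) (use assms in auto)

lemma conn_class_eq: "conn E `` {u} = conn E `` {w} \<longleftrightarrow> (u, w) \<in> conn E"
  by (auto intro: conn_trans conn_sym)

lemma card_image_cong_kernel:
  assumes "\<And>u w. u \<in> V \<Longrightarrow> w \<in> V \<Longrightarrow> f u = f w \<longleftrightarrow> g u = g w"
  shows "card (f ` V) = card (g ` V)"
proof (rule bij_betw_same_card)
  show "bij_betw (\<lambda>y. g (inv_into V f y)) (f ` V) (g ` V)"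
    unfolding bij_betw_def
  proof
    show "inj_on (\<lambda>y. g (inv_into V f y)) (f ` V)"
      by (rule inj_onI) (metis assms f_inv_into_f inv_into_into)
    have "g (inv_into V f (f v)) = g v" if "v \<in> V" for v
      using that assms by (metis f_inv_into_f image_eqI inv_into_into)
    then show "(\<lambda>y. g (inv_into V f y)) ` f ` V = g ` V"
      by (auto simp: image_image)
  qed
qed

lemma nclasses_eq_card_image:
  assumes "\<And>u w. u \<in> V \<Longrightarrow> w \<in> V \<Longrightarrow> (u, w) \<in> conn E \<longleftrightarrow> \<phi> u = \<phi> w"
  shows "nclasses V E = card (\<phi> ` V)"
  unfolding nclasses_def by (rule card_image_cong_kernel) (simp add: conn_class_eq assms)

lemma nclasses_cong: "conn E = conn F \<Longrightarrow> nclasses V E = nclasses V F"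
  by (simp add: nclasses_def)

text \<open>Contracting connected pieces keeps the number of components: the fibres of
  \<open>h\<close> are connected, \<open>h\<close> maps paths to paths, and each edge of
  \<open>F\<close> lifts to a path between points of its two fibres. Almost every later graph
  reduction is an instance for a suitable \<open>h\<close>.\<close>

lemma nclasses_contract:
  assumes im: "h ` V = W"
    and EF: "\<And>u w. (u, w) \<in> E \<Longrightarrow> h u = h w \<or> (h u, h w) \<in> F \<or> (h w, h u) \<in> F"
    and FE: "\<And>a b. (a, b) \<in> F \<Longrightarrow> \<exists>u\<in>V. \<exists>w\<in>V. h u = a \<and> h w = b \<and> (u, w) \<in> conn E"
    and fib: "\<And>u w. u \<in> V \<Longrightarrow> w \<in> V \<Longrightarrow> h u = h w \<Longrightarrow> (u, w) \<in> conn E"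
  shows "nclasses V E = nclasses W F"
proof -
  have fwd: "(h u, h w) \<in> conn F" if "(u, w) \<in> conn E" for u w
    using that
  proof (induction rule: conn_induct)
    case (step v w)
    then have "(h v, h w) \<in> conn F"
      using EF conn_edge conn_sym conn_refl by metis
    then show ?case using step conn_trans by metis
  qed simp
  have "\<forall>w\<in>V. h w = b \<longrightarrow> (u, w) \<in> conn E" if "(h u, b) \<in> conn F" "u \<in> V" for u b
    using that(1)
  proof (induction rule: conn_induct)
    case refl
    then show ?case using fib that(2) by simp
  next
    case (step a b)
    then obtain u1 w1 where "u1 \<in> V" "w1 \<in> V" "h u1 = a" "h w1 = b" "(u1, w1) \<in> conn E"
      using FE conn_sym by metis
    then show ?case
      using step(1) fib conn_trans by metis
  qed
  with fwd have "(u, w) \<in> conn E \<longleftrightarrow> conn F `` {h u} = conn F `` {h w}" if "u \<in> V" "w \<in> V" for u w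
    using that unfolding conn_class_eq by blast
  then have "nclasses V E = card ((\<lambda>v. conn F `` {h v}) ` V)"
    by (rule nclasses_eq_card_image)
  then show ?thesis
    unfolding nclasses_def im[symmetric] by (simp add: image_image)
qed

lemma nclasses_inj_image:
  assumes "inj_on h V" "E \<subseteq> V \<times> V"
  shows "nclasses (h ` V) (map_prod h h ` E) = nclasses V E"
proof (rule nclasses_contract[where h = h, symmetric])
  show "\<exists>u\<in>V. \<exists>w\<in>V. h u = a \<and> h w = b \<and> (u, w) \<in> conn E" if "(a, b) \<in> map_prod h h ` E" for a b
    using that assms(2) conn_edge by fastforce
  show "(u, w) \<in> conn E" if "u \<in> V" "w \<in> V" "h u = h w" for u w
    using that assms(1) by (simp add: inj_on_eq_iff)
qed (auto simp: map_prod_def)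

text \<open>Paths are insensitive to loops and to the direction of edges; the relations to be
  compared later differ only in these.\<close>

lemma nclasses_cong_modulo_loops:
  assumes "\<And>u w. u \<noteq> w \<Longrightarrow> (u, w) \<in> E \<or> (w, u) \<in> E \<longleftrightarrow> (u, w) \<in> F \<or> (w, u) \<in> F"
  shows "nclasses V E = nclasses V F"
proof -
  have *: "conn E \<subseteq> conn F" if "\<And>u w. u \<noteq> w \<Longrightarrow> (u, w) \<in> E \<Longrightarrow> (u, w) \<in> F \<or> (w, u) \<in> F" for E F :: "('a \<times> 'a) set"
  proof
    fix uw assume "uw \<in> conn E"
    moreover obtain u w where uw: "uw = (u, w)" by fastforce
    ultimately have "(u, w) \<in> conn E" by simp
    then have "(u, w) \<in> conn F"
      by (induction rule: conn_induct) (simp, metis that conn_edge conn_sym conn_trans)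
    then show "uw \<in> conn F" using uw by simp
  qed
  show ?thesis
    by (rule nclasses_cong, rule equalityI; rule *) (use assms in blast)+
qed

lemma conn_closed:
  assumes "E \<subseteq> V \<times> V \<union> W \<times> W" "V \<inter> W = {}" "(u, w) \<in> conn E" "u \<in> V"
  shows "w \<in> V \<and> (u, w) \<in> conn (E \<inter> V \<times> V)"
  using assms(3)
proof (induction rule: conn_induct)
  case (step v w)
  then have "w \<in> V" "(v, w) \<in> conn (E \<inter> V \<times> V)"
    using assms(1,2) by (auto intro: conn_edge conn_sym)
  then show ?case using step conn_trans by metis
qed (use assms in simp)

lemma conn_mono: "E \<subseteq> F \<Longrightarrow> conn E \<subseteq> conn F"
  unfolding conn_def by (intro rtrancl_mono) auto

lemma nclasses_Un_disjoint:
  assumes fin: "finite V" "finite W" and disj: "V \<inter> W = {}" and sub: "E \<subseteq> V \<times> V" "F \<subseteq> W \<times> W"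
  shows "nclasses (V \<union> W) (E \<union> F) = nclasses V E + nclasses W F"
proof -
  have cls: "conn (E \<union> F) `` {u} = conn E `` {u} \<and> conn E `` {u} \<subseteq> V"
    if "V \<inter> W = {}" "E \<subseteq> V \<times> V" "F \<subseteq> W \<times> W" "u \<in> V" for V W :: "'a set" and E F u
  proof -
    have eq: "(E \<union> F) \<inter> V \<times> V = E"
      using that by blast
    have "E \<union> F \<subseteq> V \<times> V \<union> W \<times> W"
      using that by blast
    then have "w \<in> V \<and> (u, w) \<in> conn E" if "(u, w) \<in> conn (E \<union> F)" for w
      using conn_closed[of "E \<union> F" V W u w] eq that \<open>V \<inter> W = {}\<close> \<open>u \<in> V\<close> by simp
    moreover have "conn E \<subseteq> conn (E \<union> F)"
      by (rule conn_mono) blast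
    ultimately show ?thesis by blast
  qed
  let ?c = "\<lambda>v. conn (E \<union> F) `` {v}"
  have V: "?c v = conn E `` {v} \<and> ?c v \<subseteq> V" if "v \<in> V" for v
    using cls[OF disj sub that] by simp
  have W: "?c v = conn F `` {v} \<and> ?c v \<subseteq> W" if "v \<in> W" for v
    using cls[of W V F E v] disj sub that by (simp add: Un_commute Int_commute)
  have "?c ` V \<inter> ?c ` W = {}"
  proof (rule ccontr)
    assume "?c ` V \<inter> ?c ` W \<noteq> {}"
    then obtain v w where "v \<in> V" "w \<in> W" "?c v = ?c w" by auto
    moreover have "v \<in> ?c v" by simp
    ultimately show False using V W disj by blast
  qed
  then have "card (?c ` (V \<union> W)) = card (?c ` V) + card (?c ` W)"
    unfolding image_Un using fin by (intro card_Un_disjoint) auto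
  moreover have "?c ` V = (\<lambda>v. conn E `` {v}) ` V" "?c ` W = (\<lambda>v. conn F `` {v}) ` W"
    using V W by auto
  ultimately show ?thesis
    by (simp add: nclasses_def)
qed

section \<open>Perfect matchings and the elimination of all nodes but the terminals\<close>

definition upair :: "'a \<Rightarrow> 'a \<Rightarrow> ('a \<times> 'a) set" where
  "upair u w = {(u, w), (w, u)}"

text \<open>Encoded as a symmetric relation, so that the union of two matchings is directly the edge
  relation of a graph made of disjoint cycles.\<close>

definition matching :: "'a set \<Rightarrow> ('a \<times> 'a) set \<Rightarrow> bool" where
  "matching V M \<longleftrightarrow> M \<subseteq> V \<times> V \<and> sym M \<and> irrefl M \<and> (\<forall>u\<in>V. \<exists>!w. (u, w) \<in> M)"

lemma matchingD:
  assumes "matching V M"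
  shows "(u, w) \<in> M \<Longrightarrow> u \<in> V \<and> w \<in> V \<and> u \<noteq> w \<and> (w, u) \<in> M"
    and "u \<in> V \<Longrightarrow> \<exists>w. (u, w) \<in> M"
    and "(u, w) \<in> M \<Longrightarrow> (u, w') \<in> M \<Longrightarrow> w = w'"
    and "(u, w) \<in> M \<Longrightarrow> (u', w) \<in> M \<Longrightarrow> u = u'"
  using assms unfolding matching_def sym_def irrefl_def by blast+

lemma matchingI:
  assumes "\<And>u w. (u, w) \<in> M \<Longrightarrow> u \<in> V \<and> u \<noteq> w \<and> (w, u) \<in> M"
    and "\<And>u. u \<in> V \<Longrightarrow> \<exists>w. (u, w) \<in> M"
    and "\<And>u w w'. (u, w) \<in> M \<Longrightarrow> (u, w') \<in> M \<Longrightarrow> w = w'"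
  shows "matching V M"
proof -
  have "M \<subseteq> V \<times> V" "sym M" "irrefl M"
    using assms(1) by (auto simp: sym_def irrefl_def)
  moreover have "\<forall>u\<in>V. \<exists>!w. (u, w) \<in> M"
    using assms(2,3) by metis
  ultimately show ?thesis
    unfolding matching_def by blast
qed

lemma matching_Un:
  assumes "matching V M" "matching W N" "V \<inter> W = {}"
  shows "matching (V \<union> W) (M \<union> N)"
proof (rule matchingI)
  fix u w w' assume "(u, w) \<in> M \<union> N" "(u, w') \<in> M \<union> N"
  then show "w = w'"
    using matchingD[OF assms(1)] matchingD[OF assms(2)] assms(3) by blast
next
  fix u assume "u \<in> V \<union> W" then show "\<exists>w. (u, w) \<in> M \<union> N"
    using matchingD(2)[OF assms(1)] matchingD(2)[OF assms(2)] by blast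
next
  fix u w assume "(u, w) \<in> M \<union> N" then show "u \<in> V \<union> W \<and> u \<noteq> w \<and> (w, u) \<in> M \<union> N"
    using matchingD(1)[OF assms(1)] matchingD(1)[OF assms(2)] by blast
qed

lemma matching_upair: "u \<noteq> w \<Longrightarrow> matching {u, w} (upair u w)"
  by (rule matchingI) (auto simp: upair_def)

lemma matching_remove:
  assumes M: "matching V M" and uw: "(u, w) \<in> M"
  shows "matching (V - {u, w}) (M - upair u w)"
proof (rule matchingI)
  fix a b assume "(a, b) \<in> M - upair u w"
  then show "a \<in> V - {u, w} \<and> a \<noteq> b \<and> (b, a) \<in> M - upair u w"
    using matchingD[OF M] uw unfolding upair_def by blast
next
  fix a assume "a \<in> V - {u, w}"
  then show "\<exists>b. (a, b) \<in> M - upair u w"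
    using matchingD(2)[OF M, of a] unfolding upair_def by blast
next
  fix a b b' assume "(a, b) \<in> M - upair u w" "(a, b') \<in> M - upair u w"
  then show "b = b'" using matchingD(3)[OF M] by blast
qed

lemma matching_subset: "matching V M \<Longrightarrow> M \<subseteq> V \<times> V"
  unfolding matching_def by blast

lemma nclasses_upair: "nclasses {u, w} (upair u w) = 1"
proof -
  have "(u, w) \<in> conn (upair u w)"
    by (simp add: conn_edge upair_def)
  then have "conn (upair u w) `` {u} = conn (upair u w) `` {w}"
    by (simp add: conn_class_eq)
  then show ?thesis
    unfolding nclasses_def by simp
qed

text \<open>R pairs up the ends of the strands that M and B form between terminals, and n counts the
  closed cycles.\<close>

lemma matching_reduce:
  assumes "finite P" "T \<subseteq> P" "matching P M" "matching (P - T) B"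
  shows "\<exists>R n. matching T R \<and> (\<forall>N. N \<subseteq> T \<times> T \<longrightarrow> nclasses P (M \<union> B \<union> N) = n + nclasses T (R \<union> N))"
  using assms
proof (induction "card P" arbitrary: P M B rule: less_induct)
  case less
  show ?case
  proof (cases "P = T")
    case True
    then have "B = {}"
      using matching_subset[OF less.prems(4)] by auto
    then show ?thesis
      using less.prems(3) True by (intro exI[of _ M] exI[of _ 0]) auto
  next
    case False
    then obtain u where u: "u \<in> P - T" using less.prems(2) by blast
    then obtain w where uw: "(u, w) \<in> B"
      using matchingD(2)[OF less.prems(4)] by blast
    note B = matchingD(1)[OF less.prems(4)] and M = matchingD(1)[OF less.prems(3)]
    have w: "w \<in> P - T" "u \<noteq> w" using B[OF uw] by auto
    have fin: "finite (P - {u, w})" and card: "card (P - {u, w}) < card P"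
      using less.prems(1) u by (auto intro!: psubset_card_mono)
    have T: "T \<subseteq> P - {u, w}" using less.prems(2) u w by blast
    have "P - {u, w} - T = P - T - {u, w}" by blast
    then have B': "matching (P - {u, w} - T) (B - upair u w)"
      using matching_remove[OF less.prems(4) uw] by simp
    show ?thesis
    \<comment> \<open>An edge shared by \<open>M\<close> and \<open>B\<close> is a closed cycle on
      two nodes and adds 1 to the constant; otherwise \<open>u\<close> and \<open>w\<close> are
      inner nodes of a longer path, which can be shortened.\<close>
    proof (cases "(u, w) \<in> M")
      case True
      have M': "matching (P - {u, w}) (M - upair u w)"
        using matching_remove[OF less.prems(3) True] .
      obtain R n where Rn: "matching T R"
        "\<And>N. N \<subseteq> T \<times> T \<Longrightarrow> nclasses (P - {u, w}) (M - upair u w \<union> (B - upair u w) \<union> N) = n + nclasses T (R \<union> N)"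
        using less.hyps[OF card fin T M' B'] by blast
      have "nclasses P (M \<union> B \<union> N) = Suc n + nclasses T (R \<union> N)" if N: "N \<subseteq> T \<times> T" for N
      proof -
        have "{u, w} \<union> (P - {u, w}) = P" using u w by blast
        moreover have "upair u w \<union> (M - upair u w \<union> (B - upair u w) \<union> N) = M \<union> B \<union> N"
          using True uw M B unfolding upair_def by blast
        moreover have "nclasses ({u, w} \<union> (P - {u, w})) (upair u w \<union> (M - upair u w \<union> (B - upair u w) \<union> N))
          = nclasses {u, w} (upair u w) + nclasses (P - {u, w}) (M - upair u w \<union> (B - upair u w) \<union> N)"
          using fin N T matching_subset[OF M'] matching_subset[OF B']
          by (intro nclasses_Un_disjoint) (auto simp: upair_def)
        ultimately show ?thesis
          using Rn(2)[OF N] nclasses_upair by simp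
      qed
      then show ?thesis using Rn(1) by blast
    next
      case False
      obtain u' w' where u': "(u, u') \<in> M" and w': "(w, w') \<in> M"
        using matchingD(2)[OF less.prems(3)] u w by blast
      have ne: "u' \<noteq> w'" "u' \<noteq> u" "u' \<noteq> w" "w' \<noteq> u" "w' \<noteq> w" "u' \<in> P" "w' \<in> P"
        using False M u' w' w(2) matchingD(4)[OF less.prems(3)] by blast+
      \<comment> \<open>The path u' - u - w - w' is replaced by a single edge from u' to w', which
        together with \<open>M1\<close> is a matching of the remaining nodes.\<close>
      define M1 where "M1 = M - upair u u' - upair w w'"
      have M1: "matching (P - {u, u'} - {w, w'}) M1"
        unfolding M1_def using w' ne w(2)
        by (intro matching_remove[OF matching_remove[OF less.prems(3) u']]) (auto simp: upair_def)
      have M_eq: "M = M1 \<union> upair u u' \<union> upair w w'"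
        unfolding M1_def using u' w' M unfolding upair_def by blast
      have "matching (P - {u, u'} - {w, w'} \<union> {u', w'}) (M1 \<union> upair u' w')"
        by (rule matching_Un[OF M1 matching_upair]) (use ne in auto)
      moreover have "P - {u, u'} - {w, w'} \<union> {u', w'} = P - {u, w}"
        using ne by blast
      ultimately have M': "matching (P - {u, w}) (M1 \<union> upair u' w')" by simp
      obtain R n where Rn: "matching T R"
        "\<And>N. N \<subseteq> T \<times> T \<Longrightarrow> nclasses (P - {u, w}) (M1 \<union> upair u' w' \<union> (B - upair u w) \<union> N) = n + nclasses T (R \<union> N)"
        using less.hyps[OF card fin T M' B'] by blast
      have "nclasses P (M \<union> B \<union> N) = n + nclasses T (R \<union> N)" if N: "N \<subseteq> T \<times> T" for N
      proof -
        \<comment> \<open>Collapsing u onto u' and w onto w' realises the shortcut: the edge u - w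
          is sent to u' - w'.\<close>
        define h where "h = id(u := u', w := w')"
        have h: "h u = u'" "h w = w'" "\<And>v. v \<noteq> u \<Longrightarrow> v \<noteq> w \<Longrightarrow> h v = v"
          using w(2) by (auto simp: h_def)
        let ?E = "M \<union> B \<union> N" and ?F = "M1 \<union> upair u' w' \<union> (B - upair u w) \<union> N"
        have c: "(u, u') \<in> conn ?E" "(w, w') \<in> conn ?E" "(u, w) \<in> conn ?E"
          using u' w' uw by (auto intro: conn_edge)
        then have hc: "(v, h v) \<in> conn ?E" for v
          using h by (metis conn_refl)
        have fixd: "h a = a \<and> h b = b \<and> a \<in> P - {u, w} \<and> b \<in> P - {u, w}"
          if "(a, b) \<in> M1 \<union> (B - upair u w) \<union> N" for a b
        proof -
          have "a \<in> P - {u, w}" "b \<in> P - {u, w}"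
            using that matching_subset[OF M1] matching_subset[OF B'] N T by auto
          then show ?thesis using h by auto
        qed
        have "nclasses P ?E = nclasses (P - {u, w}) ?F"
        proof (rule nclasses_contract[where h = h])
          show "h ` P = P - {u, w}"
            using h ne u w by (auto simp: h_def image_iff)
          show "h a = h b \<or> (h a, h b) \<in> ?F \<or> (h b, h a) \<in> ?F" if "(a, b) \<in> ?E" for a b
          proof -
            consider "(a, b) \<in> M1 \<union> (B - upair u w) \<union> N" | "(a, b) \<in> upair u u' \<union> upair w w'" | "(a, b) \<in> upair u w"
              using \<open>(a, b) \<in> ?E\<close> M_eq by blast
            then show ?thesis
            proof cases
              case 1
              then show ?thesis using fixd[OF 1] by auto
            next
              case 2
              then have "h a = h b" using h ne by (auto simp: upair_def)
              then show ?thesis by blast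
            next
              case 3
              then show ?thesis using h by (auto simp: upair_def)
            qed
          qed
          show "\<exists>v\<in>P. \<exists>v'\<in>P. h v = a \<and> h v' = b \<and> (v, v') \<in> conn ?E" if "(a, b) \<in> ?F" for a b
          proof (cases "(a, b) \<in> upair u' w'")
            case True
            then show ?thesis using h u w c(3) conn_sym[OF c(3)] by (auto simp: upair_def)
          next
            case False
            then have ab: "(a, b) \<in> M1 \<union> (B - upair u w) \<union> N" using that by blast
            then have "(a, b) \<in> conn ?E"
              using M_eq by (auto intro: conn_edge)
            then show ?thesis using fixd[OF ab] by blast
          qed
          show "(v, v') \<in> conn ?E" if "h v = h v'" for v v'
            using hc[of v] hc[of v'] that conn_sym conn_trans by metis
        qed
        then show ?thesis using Rn(2)[OF N] by simp
      qed
      then show ?thesis using Rn(1) by blast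
    qed
  qed
qed


section \<open>Enumeration of pairings and the check on six terminals\<close>

text \<open>The number bounds the pairs still to be formed and makes the recursion structural,
  although \<open>remove1\<close> does not return a tail of the list. At 0 the default clause yields
  the empty pairing, so the number must be at least half the length of the list. Each pair is listed
  in one direction only.\<close>

fun pairings :: "nat \<Rightarrow> 'a list \<Rightarrow> ('a \<times> 'a) list list" where
  "pairings (Suc n) (x # xs) = concat (map (\<lambda>y. map ((#) (x, y)) (pairings n (remove1 y xs))) xs)"
| "pairings n xs = [[]]"

text \<open>The first node has a partner y; taking both away leaves a matching of a list that is
  shorter by two, for which one unit less suffices.\<close>

lemma matching_pairings:
  assumes "matching (set xs) R" "distinct xs" "length xs \<le> 2 * n"
  shows "\<exists>l\<in>set (pairings n xs). R = set l \<union> (set l)\<inverse>"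
  using assms
proof (induction n xs arbitrary: R rule: pairings.induct)
  case (1 n x xs)
  obtain y where xy: "(x, y) \<in> R"
    using matchingD(2)[OF 1(2), of x] by auto
  then have y: "y \<in> set xs" "x \<noteq> y"
    using matchingD(1)[OF 1(2) xy] by auto
  have "set (remove1 y xs) = set (x # xs) - {x, y}"
    using 1(3) by (auto simp: set_remove1_eq)
  then have "matching (set (remove1 y xs)) (R - upair x y)"
    using matching_remove[OF 1(2) xy] by simp
  moreover have "length (remove1 y xs) \<le> 2 * n"
    using 1(4) y(1) by (simp add: length_remove1)
  ultimately obtain l where l: "l \<in> set (pairings n (remove1 y xs))" "R - upair x y = set l \<union> (set l)\<inverse>"
    using 1(1)[OF y(1)] 1(3) by fastforce
  have "R = set ((x, y) # l) \<union> (set ((x, y) # l))\<inverse>"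
    using l(2) xy matchingD(1)[OF 1(2) xy] unfolding upair_def by auto
  moreover have "(x, y) # l \<in> set (pairings (Suc n) (x # xs))"
    using l(1) y(1) by auto
  ultimately show ?case by blast
next
  case ("2_1" xs)
  then show ?case using matching_subset by fastforce
next
  case ("2_2" v)
  then show ?case using matching_subset by fastforce
qed

text \<open>Counts components by successive edge contraction, in a form that simplification can
  evaluate on numerals.\<close>

fun count_classes :: "'a list \<Rightarrow> ('a \<times> 'a) list \<Rightarrow> nat" where
  "count_classes vs [] = length vs"
| "count_classes vs ((u, w) # es) =
    (if u = w then count_classes vs es
     else count_classes (removeAll u vs)
       (map (\<lambda>(a, b). (if a = u then w else a, if b = u then w else b)) es))"

lemma nclasses_empty: "nclasses V {} = card V"
proof -
  have "nclasses V {} = card (id ` V)"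
    by (rule nclasses_eq_card_image) (simp add: conn_def)
  then show ?thesis by simp
qed

text \<open>A recursive step is \<open>nclasses_contract\<close> for the map that sends u to w and
  fixes all other nodes; the contracted edge itself connects the fibre over w.\<close>

lemma nclasses_count_classes:
  assumes "distinct vs" "set es \<subseteq> set vs \<times> set vs"
  shows "nclasses (set vs) (set es) = count_classes vs es"
  using assms
proof (induction vs es rule: count_classes.induct)
  case (1 vs)
  then show ?case by (simp add: nclasses_empty distinct_card)
next
  case (2 vs u w es)
  show ?case
  proof (cases "u = w")
    case True
    have "nclasses (set vs) (set ((u, w) # es)) = nclasses (set vs) (set es)"
      by (rule nclasses_cong_modulo_loops) (use True in auto)
    then show ?thesis using 2 True by simp
  next
    case False
    let ?h = "\<lambda>a. if a = u then w else a"
    let ?es = "map (\<lambda>(a, b). (?h a, ?h b)) es"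
    have uw: "(u, w) \<in> conn (set ((u, w) # es))" by (simp add: conn_edge)
    then have hc: "(v, ?h v) \<in> conn (set ((u, w) # es))" for v
      by simp
    have "nclasses (set vs) (set ((u, w) # es)) = nclasses (set (removeAll u vs)) (set ?es)"
    proof (rule nclasses_contract[where h = ?h])
      show "?h ` set vs = set (removeAll u vs)"
        using False 2(4) by (auto simp: image_iff)
      show "?h a = ?h b \<or> (?h a, ?h b) \<in> set ?es \<or> (?h b, ?h a) \<in> set ?es"
        if "(a, b) \<in> set ((u, w) # es)" for a b
        using that by (force simp: image_iff)
      show "\<exists>v\<in>set vs. \<exists>v'\<in>set vs. ?h v = a \<and> ?h v' = b \<and> (v, v') \<in> conn (set ((u, w) # es))"
        if ab: "(a, b) \<in> set ?es" for a b
      proof -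
        obtain v v' where v: "(v, v') \<in> set es" "?h v = a" "?h v' = b"
          using ab by auto
        then have "(v, v') \<in> conn (set ((u, w) # es))" "v \<in> set vs" "v' \<in> set vs"
          using 2(4) by (auto intro: conn_edge)
        then show ?thesis using v by blast
      qed
      show "(v, v') \<in> conn (set ((u, w) # es))" if "?h v = ?h v'" for v v'
        by (rule conn_join[OF hc]) (simp only: that hc)
    qed
    moreover have "nclasses (set (removeAll u vs)) (set ?es) = count_classes (removeAll u vs) ?es"
    proof (rule 2(2)[OF False])
      show "distinct (removeAll u vs)" using 2(3) by (rule distinct_removeAll)
      have "w \<in> set vs" "\<And>a b. (a, b) \<in> set es \<Longrightarrow> a \<in> set vs \<and> b \<in> set vs"
        using 2(4) by auto
      then show "set ?es \<subseteq> set (removeAll u vs) \<times> set (removeAll u vs)"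
        using False by (auto split: if_splits)
    qed
    ultimately show ?thesis using False by simp
  qed
qed

text \<open>The bounds by \<open>c0\<close> and \<open>cab\<close> are essential. If the strands
  pair the terminals as in X, the three middle counts are all 2, and only \<open>cab\<close>, which
  is 1, rules out k = 2; if they run as in X + a + b, it is \<open>c0\<close> that is 1. The number
  6 is that of the terminals and bounds the range of k.\<close>

definition parity_check :: "nat \<Rightarrow> nat \<Rightarrow> nat \<Rightarrow> nat \<Rightarrow> nat \<Rightarrow> bool" where
  "parity_check c0 cb ca ca' cab \<longleftrightarrow> c0 \<le> 6 \<and>
    (\<forall>k\<le>6. k \<le> c0 \<and> k \<le> cb \<and> k \<le> ca \<and> k \<le> ca' \<and> k \<le> cab \<longrightarrow>
      (ca' = k) = ((ca = k) \<noteq> (cb = k)))"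

text \<open>The six terminals p, t, p', t', x, x' of a slide are numbered 0 to 5 in this order; the
  fifteen pairings l of them are all the ways in which the strands can run.  The graphs in the five
  lines are those of X, X + b, X + a, X + a after the slide, and X + a + b.\<close>

lemma six_terminals_check:
  "\<forall>l\<in>set (pairings 3 [0, 1, 2, 3, 4, 5::nat]).
    parity_check
      (count_classes [0, 1, 2, 3, 4, 5] (l @ [(4, 5), (0, 1), (2, 3)]))
      (count_classes [0, 1, 2, 3, 4, 5] (l @ [(4, 5), (0, 2), (1, 3)]))
      (count_classes [0, 1, 2, 3, 4, 5] (l @ [(0, 4), (1, 5), (2, 3)]))
      (count_classes [0, 1, 2, 3, 4, 5] (l @ [(2, 5), (3, 4), (0, 1)]))
      (count_classes [0, 1, 2, 3, 4, 5] (l @ [(0, 4), (2, 5), (1, 3)]))"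
  by (simp add: numeral_3_eq_3 parity_check_def)

text \<open>The terminals are replaced by their positions in a list, which turns \<open>R\<close>
  into one of the enumerated pairings. The closed cycles away from the terminals shift all five
  counts by the same n.\<close>

lemma six_terminals:
  assumes dist: "distinct [p, t, p', t', x, x']" and T: "T = {p, t, p', t', x, x'}"
    and R: "matching T R"
    and c: "c = (\<lambda>N. n + nclasses T (R \<union> N))"
    and le: "k \<le> c (upair x x' \<union> upair p t \<union> upair p' t')" "k \<le> c (upair x x' \<union> upair p p' \<union> upair t t')"
      "k \<le> c (upair p x \<union> upair t x' \<union> upair p' t')" "k \<le> c (upair p' x' \<union> upair t' x \<union> upair p t)"
      "k \<le> c (upair p x \<union> upair p' x' \<union> upair t t')"
  shows "c (upair p' x' \<union> upair t' x \<union> upair p t) = k \<longleftrightarrow>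
    (c (upair p x \<union> upair t x' \<union> upair p' t') = k) \<noteq> (c (upair x x' \<union> upair p p' \<union> upair t t') = k)"
proof -
  let ?L = "[p, t, p', t', x, x']" and ?I = "[0, 1, 2, 3, 4, 5::nat]"
  define R' where "R' = {(i, j). i \<in> set ?I \<and> j \<in> set ?I \<and> (?L ! i, ?L ! j) \<in> R}"
  have inj: "inj_on (\<lambda>i. ?L ! i) (set ?I)"
    by (rule inj_on_nth[OF dist]) auto
  have im: "(\<lambda>i. ?L ! i) ` set ?I = T"
    unfolding T by auto
  have R': "matching (set ?I) R'"
  proof (rule matchingI)
    fix i j assume "(i, j) \<in> R'"
    then show "i \<in> set ?I \<and> i \<noteq> j \<and> (j, i) \<in> R'"
      using matchingD(1)[OF R] unfolding R'_def by blast
  next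
    fix i assume i: "i \<in> set ?I"
    then obtain w where w: "(?L ! i, w) \<in> R"
      using matchingD(2)[OF R] im by blast
    then have "w \<in> T" using matchingD(1)[OF R] by blast
    then show "\<exists>j. (i, j) \<in> R'"
      using w i im unfolding R'_def by blast
  next
    fix i j j' assume "(i, j) \<in> R'" "(i, j') \<in> R'"
    then show "j = j'"
      using matchingD(3)[OF R] inj unfolding R'_def by (auto dest: inj_onD)
  qed
  have R_eq: "R = map_prod (\<lambda>i. ?L ! i) (\<lambda>i. ?L ! i) ` R'"
  proof (intro set_eqI iffI)
    fix e assume "e \<in> R"
    moreover obtain a b where "e = (a, b)" by fastforce
    ultimately have "(a, b) \<in> R" "a \<in> T" "b \<in> T"
      using matchingD(1)[OF R] by blast+
    then obtain i j where "i \<in> set ?I" "j \<in> set ?I" "a = ?L ! i" "b = ?L ! j"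
      using im by blast
    then show "e \<in> map_prod (\<lambda>i. ?L ! i) (\<lambda>i. ?L ! i) ` R'"
      using \<open>(a, b) \<in> R\<close> \<open>e = (a, b)\<close> unfolding R'_def by (intro image_eqI[of _ _ "(i, j)"]) auto
  qed (auto simp: R'_def)
  obtain l where l: "l \<in> set (pairings 3 ?I)" "R' = set l \<union> (set l)\<inverse>"
    using matching_pairings[OF R', of 3] by auto
  have lI: "set l \<subseteq> set ?I \<times> set ?I"
    using matching_subset[OF R'] l(2) by blast
  have c_eq: "c N = n + count_classes ?I (l @ N')"
    if N: "N = (\<Union>(i, j)\<in>set N'. upair (?L ! i) (?L ! j))" "set N' \<subseteq> set ?I \<times> set ?I" for N N'
  proof -
    have "(\<Union>(i, j)\<in>E. upair (f i) (f j)) = map_prod f f ` (E \<union> E\<inverse>)" for f :: "nat \<Rightarrow> 'a" and E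
      by (auto simp: upair_def image_iff)
    then have "N = map_prod (\<lambda>i. ?L ! i) (\<lambda>i. ?L ! i) ` (set N' \<union> (set N')\<inverse>)"
      using N(1) by blast
    then have "R \<union> N = map_prod (\<lambda>i. ?L ! i) (\<lambda>i. ?L ! i) ` (R' \<union> (set N' \<union> (set N')\<inverse>))"
      unfolding R_eq by (simp only: image_Un)
    moreover have "R' \<union> (set N' \<union> (set N')\<inverse>) \<subseteq> set ?I \<times> set ?I"
      using matching_subset[OF R'] that(2) by blast
    ultimately have "nclasses T (R \<union> N) = nclasses (set ?I) (R' \<union> (set N' \<union> (set N')\<inverse>))"
      using nclasses_inj_image[OF inj] im by metis
    also have "\<dots> = nclasses (set ?I) (set (l @ N'))"
      by (rule nclasses_cong_modulo_loops) (use l(2) in auto)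
    also have "\<dots> = count_classes ?I (l @ N')"
      by (rule nclasses_count_classes) (use lI that(2) in auto)
    finally show ?thesis using c by simp
  qed
  have c1: "c (upair x x' \<union> upair p t \<union> upair p' t') = n + count_classes ?I (l @ [(4, 5), (0, 1), (2, 3)])"
    by (rule c_eq) (simp_all add: Un_assoc)
  have c2: "c (upair x x' \<union> upair p p' \<union> upair t t') = n + count_classes ?I (l @ [(4, 5), (0, 2), (1, 3)])"
    by (rule c_eq) (simp_all add: Un_assoc)
  have c3: "c (upair p x \<union> upair t x' \<union> upair p' t') = n + count_classes ?I (l @ [(0, 4), (1, 5), (2, 3)])"
    by (rule c_eq) (simp_all add: Un_assoc)
  have c4: "c (upair p' x' \<union> upair t' x \<union> upair p t) = n + count_classes ?I (l @ [(2, 5), (3, 4), (0, 1)])"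
    by (rule c_eq) (simp_all add: Un_assoc)
  have c5: "c (upair p x \<union> upair p' x' \<union> upair t t') = n + count_classes ?I (l @ [(0, 4), (2, 5), (1, 3)])"
    by (rule c_eq) (simp_all add: Un_assoc)
  let ?c0 = "count_classes ?I (l @ [(4, 5), (0, 1), (2, 3)])"
  let ?cb = "count_classes ?I (l @ [(4, 5), (0, 2), (1, 3)])"
  let ?ca = "count_classes ?I (l @ [(0, 4), (1, 5), (2, 3)])"
  let ?ca' = "count_classes ?I (l @ [(2, 5), (3, 4), (0, 1)])"
  let ?cab = "count_classes ?I (l @ [(0, 4), (2, 5), (1, 3)])"
  note chk = six_terminals_check[THEN bspec, OF l(1), unfolded parity_check_def]
  show ?thesis
  \<comment> \<open>If n exceeds k, none of the three counts in the claim can equal k. Otherwise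
    subtracting n from k leaves a number that is at most 6, within the range of the check.\<close>
  proof (cases "n \<le> k")
    case True
    define j where "j = k - n"
    have k: "k = n + j" using True j_def by simp
    have "j \<le> 6" using le(1) chk unfolding c1 k by simp
    then have "(?ca' = j) = ((?ca = j) \<noteq> (?cb = j))"
      using conjunct2[OF chk] le unfolding c1 c2 c3 c4 c5 k by simp
    then show ?thesis
      unfolding c2 c3 c4 k by simp
  next
    case False
    then show ?thesis unfolding c2 c3 c4 by linarith
  qed
qed

text \<open>Eliminating the other nodes turns \<open>M\<close> and \<open>B\<close> into strands
  between the terminals plus a constant. The further constant \<open>l\<close> stands for circles
  that carry no flag.\<close>

lemma slide_parity:
  assumes "finite P" "matching P M" "T \<subseteq> P" "matching (P - T) B"
    and "distinct [p, t, p', t', x, x']" "T = {p, t, p', t', x, x'}"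
    and c: "c = (\<lambda>N. l + nclasses P (M \<union> B \<union> N))"
    and "k \<le> c (upair x x' \<union> upair p t \<union> upair p' t')" "k \<le> c (upair x x' \<union> upair p p' \<union> upair t t')"
      "k \<le> c (upair p x \<union> upair t x' \<union> upair p' t')" "k \<le> c (upair p' x' \<union> upair t' x \<union> upair p t)"
      "k \<le> c (upair p x \<union> upair p' x' \<union> upair t t')"
  shows "c (upair p' x' \<union> upair t' x \<union> upair p t) = k \<longleftrightarrow>
    (c (upair p x \<union> upair t x' \<union> upair p' t') = k) \<noteq> (c (upair x x' \<union> upair p p' \<union> upair t t') = k)"
proof -
  obtain R n where R: "matching T R"
    and n: "\<And>N. N \<subseteq> T \<times> T \<Longrightarrow> nclasses P (M \<union> B \<union> N) = n + nclasses T (R \<union> N)"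
    using matching_reduce[OF assms(1,3,2,4)] by blast
  define c' where "c' = (\<lambda>N. (l + n) + nclasses T (R \<union> N))"
  have eq: "c N = c' N" if "N \<subseteq> T \<times> T" for N
    using n[OF that] by (simp add: c c'_def)
  have upair: "upair u w \<subseteq> T \<times> T" if "u \<in> T" "w \<in> T" for u w
    using that by (auto simp: upair_def)
  have "c (upair u w \<union> upair u' w' \<union> upair u'' w'') = c' (upair u w \<union> upair u' w' \<union> upair u'' w'')"
    if "{u, w, u', w', u'', w''} \<subseteq> T" for u w u' w' u'' w''
    by (rule eq) (use that upair in \<open>simp add: upair_def\<close>)
  then show ?thesis
    using six_terminals[OF assms(5,6) R c'_def, of k] assms(8-12) assms(6) by simp
qed

text \<open>\<open>M'\<close> is \<open>M\<close> after the sliding end with flags q and r has been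
  put on the strand from p to y, with q facing p. If \<open>a\<close> is absent, q and r are joined
  and the strand is whole again. If \<open>a\<close> is present, p and q only continue the path that
  \<open>b\<close> starts at p, towards t when \<open>b\<close> is absent and towards p' when it is
  present; they are contracted, and r takes the place of p. So the end beside p acts as if attached
  at the end of \<open>b\<close> itself.\<close>

lemma
  assumes M: "matching P M" and py: "(p, y) \<in> M"
    and qr: "q \<notin> P" "r \<notin> P" "q \<noteq> r"
    and M': "M' = M - upair p y \<union> upair p q \<union> upair r y"
  shows slide_contract_same: "F \<subseteq> P \<times> P \<Longrightarrow>
      nclasses (P \<union> {q, r}) (M' \<union> F \<union> upair q r) = nclasses P (M \<union> F)"
    and slide_contract_a: "B \<subseteq> (P - {p, t, p', t'}) \<times> (P - {p, t, p', t'}) \<Longrightarrow> distinct [p, t, p', t', z, z'] \<Longrightarrow>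
      {t, p', t', z, z'} \<subseteq> P \<Longrightarrow>
      nclasses (P \<union> {q, r}) (M' \<union> B \<union> (upair q z \<union> upair r z' \<union> upair p t \<union> upair p' t'))
        = nclasses P (M \<union> B \<union> (upair p z' \<union> upair t z \<union> upair p' t'))"
    and slide_contract_ab: "B \<subseteq> (P - {p, t, p', t'}) \<times> (P - {p, t, p', t'}) \<Longrightarrow> distinct [p, t, p', t', z, z'] \<Longrightarrow>
      {t, p', t', z, z'} \<subseteq> P \<Longrightarrow>
      nclasses (P \<union> {q, r}) (M' \<union> B \<union> (upair q z \<union> upair r z' \<union> upair p p' \<union> upair t t'))
        = nclasses P (M \<union> B \<union> (upair p z' \<union> upair p' z \<union> upair t t'))"
proof -
  have y: "p \<in> P" "y \<in> P" "p \<noteq> y" "(y, p) \<in> M"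
    using matchingD(1)[OF M py] by auto
  have sub: "M \<subseteq> P \<times> P"
    using matching_subset[OF M] .
  \<comment> \<open>\<open>M\<close> is a matching, so its other pairs avoid both p and y.\<close>
  have mate: "a \<noteq> p \<and> b \<noteq> p \<and> a \<noteq> y \<and> b \<noteq> y" if "(a, b) \<in> M - upair p y" for a b
  proof -
    have "(b, a) \<in> M" "(a, b) \<in> M" using that matchingD(1)[OF M] by auto
    then show ?thesis
      using that matchingD(3)[OF M py] matchingD(3)[OF M y(4)] unfolding upair_def by blast
  qed
  show "nclasses (P \<union> {q, r}) (M' \<union> F \<union> upair q r) = nclasses P (M \<union> F)" if F: "F \<subseteq> P \<times> P"
  \<comment> \<open>With q and r joined, the path p - q - r - y contracts back to the strand p -
    y.\<close>
  proof (rule nclasses_contract[where h = "id(q := p, r := p)"])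
    let ?h = "id(q := p, r := p)" and ?E = "M' \<union> F \<union> upair q r"
    have hP: "?h v = v" if "v \<in> P" for v using that qr by auto
    show "?h ` (P \<union> {q, r}) = P" using y hP qr by (auto simp: image_iff)
    show "?h a = ?h b \<or> (?h a, ?h b) \<in> M \<union> F \<or> (?h b, ?h a) \<in> M \<union> F" if "(a, b) \<in> ?E" for a b
    proof (cases "(a, b) \<in> (M - upair p y) \<union> F")
      case True
      then have "?h a = a" "?h b = b" using F sub hP by blast+
      then show ?thesis using True by auto
    next
      case False
      then have "(a, b) \<in> upair p q \<union> upair r y \<union> upair q r" using that M' by blast
      then show ?thesis using py y qr by (auto simp: upair_def)
    qed
    have hc: "(v, ?h v) \<in> conn ?E" for v
    proof -
      have 1: "(q, p) \<in> conn ?E" "(r, q) \<in> conn ?E"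
        unfolding M' upair_def by (auto intro: conn_edge)
      then show ?thesis using conn_trans[OF 1(2,1)] by auto
    qed
    show "(v, v') \<in> conn ?E" if "?h v = ?h v'" for v v'
      using hc[of v] hc[of v'] that conn_sym conn_trans by metis
    show "\<exists>v\<in>P \<union> {q, r}. \<exists>v'\<in>P \<union> {q, r}. ?h v = a \<and> ?h v' = b \<and> (v, v') \<in> conn ?E"
      if "(a, b) \<in> M \<union> F" for a b
    proof (cases "(a, b) \<in> upair p y")
      case True
      have e: "(r, y) \<in> conn ?E" unfolding M' upair_def by (auto intro: conn_edge)
      have h: "?h r = p" "?h y = y" "y \<in> P \<union> {q, r}" "r \<in> P \<union> {q, r}" using hP y qr by auto
      consider "a = p" "b = y" | "a = y" "b = p" using True unfolding upair_def by blast
      then show ?thesis using e conn_sym[OF e] h by cases blast+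
    next
      case False
      then have "(a, b) \<in> ?E" using that M' by blast
      moreover have "a \<in> P" "b \<in> P" using that F sub by auto
      ultimately show ?thesis using hP by (meson UnI1 conn_edge)
    qed
  qed
  assume B: "B \<subseteq> (P - {p, t, p', t'}) \<times> (P - {p, t, p', t'})"
    and dist: "distinct [p, t, p', t', z, z']" and inP: "{t, p', t', z, z'} \<subseteq> P"
  have BP: "B \<subseteq> P \<times> P" using B by blast
  have ne: "p \<noteq> t" "p \<noteq> p'" "p \<noteq> t'" "p \<noteq> z" "p \<noteq> z'" "t \<noteq> p'" "t \<noteq> t'" "t \<noteq> z" "t \<noteq> z'"
    "p' \<noteq> t'" "p' \<noteq> z" "p' \<noteq> z'" "t' \<noteq> z" "t' \<noteq> z'" "z \<noteq> z'" "q \<noteq> p" "q \<noteq> t" "q \<noteq> p'"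
    "q \<noteq> t'" "q \<noteq> z" "q \<noteq> z'" "r \<noteq> p" "r \<noteq> t" "r \<noteq> p'" "r \<noteq> t'" "r \<noteq> z" "r \<noteq> z'" "q \<noteq> r" "q \<noteq> y" "r \<noteq> y"
    using dist inP qr y by auto
  have gen: "nclasses (P \<union> {q, r}) (M' \<union> B \<union> N) = nclasses P (M \<union> B \<union> N')"
    if u: "u = t \<and> N = upair q z \<union> upair r z' \<union> upair p t \<union> upair p' t' \<and> N' = upair p z' \<union> upair t z \<union> upair p' t'
      \<or> u = p' \<and> N = upair q z \<union> upair r z' \<union> upair p p' \<union> upair t t' \<and> N' = upair p z' \<union> upair p' z \<union> upair t t'"
    for u N N'
  proof -
    \<comment> \<open>\<open>u\<close> is the flag that the link of \<open>b\<close> joins to p. The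
      path u - p - q - z contracts to u - z, and r, which is joined to y and z', moves into the
      vacated place of p.\<close>
    define h where "h = id(q := u, p := u, r := p)"
    let ?E = "M' \<union> B \<union> N" and ?F = "M \<union> B \<union> N'"
    have uP: "u \<in> P" "u \<noteq> p" using u inP ne by auto
    have hP: "h v = v" if "v \<in> P" "v \<noteq> p" for v using that qr by (auto simp: h_def)
    have h: "h q = u" "h p = u" "h r = p" "h y = y" "h t = t" "h p' = p'" "h t' = t'" "h z = z" "h z' = z'"
      using ne y by (auto simp: h_def)
    show ?thesis
    proof (rule nclasses_contract[where h = h])
      show "h ` (P \<union> {q, r}) = P"
        using uP hP h qr y by (auto simp: h_def image_iff)
      have pu: "upair p u \<subseteq> N" "upair p z' \<subseteq> N'" "upair r z' \<subseteq> N" "upair q z \<subseteq> N" "upair u z \<subseteq> N'" using u by blast+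
      have fx: "h a = a \<and> h b = b \<and> a \<in> P \<and> b \<in> P" if "(a, b) \<in> (M - upair p y) \<union> B" for a b
        using that mate[of a b] sub BP B hP by blast
      show "h a = h b \<or> (h a, h b) \<in> ?F \<or> (h b, h a) \<in> ?F" if "(a, b) \<in> ?E" for a b
      proof (cases "(a, b) \<in> (M - upair p y) \<union> B")
        case True
        then show ?thesis using fx[OF True] by auto
      next
        case False
        then have "(a, b) \<in> upair p q \<union> upair r y \<union> N" using that M' by blast
        then consider "(a, b) \<in> upair p q \<union> upair p u" | "(a, b) \<in> upair r y" | "(a, b) \<in> upair q z" | "(a, b) \<in> upair r z'"
          | "(a, b) \<in> N \<inter> N'" "(a, b) \<in> upair p' t' \<union> upair t t'"
          using u by blast
        then show ?thesis
        proof cases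
          case 1
          then have "h a = h b" using h uP hP unfolding upair_def by auto
          then show ?thesis by blast
        next
          case 2
          then have "(h a, h b) \<in> M" using h py y(4) unfolding upair_def by auto
          then show ?thesis by blast
        next
          case 3
          then have "(h a, h b) \<in> upair u z" using h unfolding upair_def by auto
          then show ?thesis using pu by blast
        next
          case 4
          then have "(h a, h b) \<in> upair p z'" using h unfolding upair_def by auto
          then show ?thesis using pu by blast
        next
          case 5
          then have "h a = a" "h b = b" using h unfolding upair_def by auto
          then show ?thesis using 5 by simp
        qed
      qed
      \<comment> \<open>Only r is sent to a node that it need not be connected with. No other node
        is sent to p, so the fibre over p is the single node r and is connected all the
        same.\<close>
      have hc: "(v, h v) \<in> conn ?E \<or> v = r" for v
      proof -
        have 1: "(q, p) \<in> conn ?E" "(p, u) \<in> conn ?E"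
          using pu(1) unfolding M' upair_def by (auto intro: conn_edge)
        then show ?thesis using conn_trans[OF 1] by (auto simp: h_def)
      qed
      have "h v \<noteq> p" if "v \<noteq> r" for v using uP that by (auto simp: h_def)
      then show "(v, v') \<in> conn ?E" if "h v = h v'" for v v'
        using hc[of v] hc[of v'] that conn_sym conn_trans conn_refl h(3) by metis
      show "\<exists>v\<in>P \<union> {q, r}. \<exists>v'\<in>P \<union> {q, r}. h v = a \<and> h v' = b \<and> (v, v') \<in> conn ?E"
        if "(a, b) \<in> ?F" for a b
      proof -
        have lift: ?thesis if "(v, v') \<in> ?E" "(a, b) \<in> upair (h v) (h v')" "v \<in> P \<union> {q, r}" "v' \<in> P \<union> {q, r}" for v v'
          using that conn_edge[OF that(1)] conn_sym[OF conn_edge[OF that(1)]] unfolding upair_def by blast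
        consider "(a, b) \<in> (M - upair p y) \<union> B" | "(a, b) \<in> upair p y" | "(a, b) \<in> upair p z'" | "(a, b) \<in> upair u z"
          | "(a, b) \<in> N \<inter> N'" "(a, b) \<in> upair p' t' \<union> upair t t'"
          using \<open>(a, b) \<in> ?F\<close> u by blast
        then show ?thesis
        proof cases
          case 1
          show ?thesis
            by (rule lift[of a b]) (use fx[OF 1] 1 M' in \<open>auto simp: upair_def\<close>)
        next
          case 2
          show ?thesis
            by (rule lift[of r y]) (use 2 h M' y in \<open>simp_all add: upair_def\<close>)
        next
          case 3
          show ?thesis
            by (rule lift[of r z']) (use 3 h pu inP in \<open>simp_all add: upair_def\<close>)
        next
          case 4
          show ?thesis
            by (rule lift[of q z]) (use 4 h pu inP in \<open>simp_all add: upair_def\<close>)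
        next
          case 5
          then have "h a = a" "h b = b" "a \<in> P" "b \<in> P" using h inP unfolding upair_def by auto
          then show ?thesis
            by (intro lift[of a b]) (use 5 in \<open>simp_all add: upair_def\<close>)
        qed
      qed

    qed
  qed
  show "nclasses (P \<union> {q, r}) (M' \<union> B \<union> (upair q z \<union> upair r z' \<union> upair p t \<union> upair p' t'))
        = nclasses P (M \<union> B \<union> (upair p z' \<union> upair t z \<union> upair p' t'))"
    by (rule gen[of t]) simp
  show "nclasses (P \<union> {q, r}) (M' \<union> B \<union> (upair q z \<union> upair r z' \<union> upair p p' \<union> upair t t'))
        = nclasses P (M \<union> B \<union> (upair p z' \<union> upair p' z \<union> upair t t'))"
    by (rule gen[of p']) simp
qed

section \<open>Compact one-dimensional manifolds with marked points, and their cutting and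
  gluing\<close>

section \<open>Strands\<close>

text \<open>The subfamily and its complement have closed unions without a common point, and a
  connected set covered by the two cannot meet both.\<close>

lemma connected_meets_disjoint_closed:
  assumes "finite \<F>" "\<And>F. F \<in> \<F> \<Longrightarrow> closed F" "connected T" "T \<subseteq> \<Union>\<F>"
    and "\<And>F F'. F \<in> \<A> \<Longrightarrow> F' \<in> \<F> - \<A> \<Longrightarrow> F \<inter> F' = {}" "\<A> \<subseteq> \<F>" "T \<inter> \<Union>\<A> \<noteq> {}"
  shows "T \<subseteq> \<Union>\<A>"
proof -
  have "closed (\<Union>\<A>)" "closed (\<Union>(\<F> - \<A>))"
    using assms(1,2,6) by (auto intro!: closed_Union dest: finite_subset)
  moreover have "T \<subseteq> \<Union>\<A> \<union> \<Union>(\<F> - \<A>)" "\<Union>\<A> \<inter> \<Union>(\<F> - \<A>) \<inter> T = {}"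
    using assms(4,5) by blast+
  ultimately have "\<Union>(\<F> - \<A>) \<inter> T = {}"
    using assms(3,7) unfolding connected_closed by blast
  then show ?thesis
    using assms(4) by blast
qed

lemma components_Union_disjoint:
  assumes "finite \<Q>" "pairwise disjnt \<Q>"
    and "\<And>Q. Q \<in> \<Q> \<Longrightarrow> closed Q" "\<And>Q. Q \<in> \<Q> \<Longrightarrow> connected Q" "{} \<notin> \<Q>"
  shows "components (\<Union>\<Q>) = \<Q>"
proof -
  have eq: "connected_component_set (\<Union>\<Q>) x = Q" if x: "x \<in> Q" "Q \<in> \<Q>" for x Q
  proof
    show "Q \<subseteq> connected_component_set (\<Union>\<Q>) x"
      using that assms(4) by (intro connected_component_maximal) auto
    have "connected_component_set (\<Union>\<Q>) x \<subseteq> \<Union>{Q}"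
    proof (rule connected_meets_disjoint_closed[of \<Q>])
      show "F \<inter> F' = {}" if "F \<in> {Q}" "F' \<in> \<Q> - {Q}" for F F'
        using that assms(2) x(2) unfolding pairwise_def disjnt_def by blast
      show "connected_component_set (\<Union>\<Q>) x \<inter> \<Union> {Q} \<noteq> {}"
      proof -
        have "connected_component (\<Union>\<Q>) x x" using x by (intro connected_component_refl) blast
        then show ?thesis using x(1) by blast
      qed
      show "connected_component_set (\<Union>\<Q>) x \<subseteq> \<Union>\<Q>"
        by (rule connected_component_subset)
    qed (use assms x in auto)
    then show "connected_component_set (\<Union>\<Q>) x \<subseteq> Q" by simp
  qed
  show ?thesis
  proof (intro set_eqI iffI)
    fix C assume "C \<in> components (\<Union>\<Q>)"
    then show "C \<in> \<Q>" using eq unfolding components_iff by auto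
  next
    fix C assume C: "C \<in> \<Q>"
    then have "C \<noteq> {}" using assms(5) by metis
    then obtain x where "x \<in> C" by blast
    then show "C \<in> components (\<Union>\<Q>)" using eq C unfolding components_iff by blast
  qed
qed

text \<open>Pieces meet only in marked points and each piece has one, so a chain of pieces amounts
  to a path of marked points. Conversely, the pieces that contain a point reachable from
  \<open>u\<close> are disjoint from all other pieces, and both families have closed unions; a
  component therefore cannot leave the first.\<close>

lemma card_components_pieces:
  assumes fin: "finite \<F>" "finite P" and P: "P \<subseteq> \<Union>\<F>"
    and cl: "\<And>F. F \<in> \<F> \<Longrightarrow> closed F" and con: "\<And>F. F \<in> \<F> \<Longrightarrow> connected F"
    and meets: "\<And>F. F \<in> \<F> \<Longrightarrow> F \<inter> P \<noteq> {}"
    and int: "\<And>F F'. F \<in> \<F> \<Longrightarrow> F' \<in> \<F> \<Longrightarrow> F \<noteq> F' \<Longrightarrow> F \<inter> F' \<subseteq> P"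
  shows "finite (components (\<Union>\<F>))"
    and "card (components (\<Union>\<F>)) = nclasses P {(u, w). u \<in> P \<and> w \<in> P \<and> (\<exists>F\<in>\<F>. u \<in> F \<and> w \<in> F)}"
proof -
  let ?Z = "\<Union>\<F>" and ?E = "{(u, w). u \<in> P \<and> w \<in> P \<and> (\<exists>F\<in>\<F>. u \<in> F \<and> w \<in> F)}"
  have comp: "components ?Z = connected_component_set ?Z ` P"
  proof (intro set_eqI iffI)
    fix C assume "C \<in> components ?Z"
    then obtain x F where x: "x \<in> F" "F \<in> \<F>" "C = connected_component_set ?Z x"
      unfolding components_iff by auto
    obtain v where v: "v \<in> F" "v \<in> P" using meets[OF x(2)] by auto
    have "connected_component ?Z x v"
      unfolding connected_component_def using x v con by (intro exI[of _ F]) auto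
    then have "C = connected_component_set ?Z v"
      using x(3) connected_component_eq[of v ?Z x] by simp
    then show "C \<in> connected_component_set ?Z ` P" using v by blast
  next
    fix C assume "C \<in> connected_component_set ?Z ` P"
    then show "C \<in> components ?Z" using P unfolding components_iff by blast
  qed
  show "finite (components ?Z)"
    unfolding comp using fin by simp
  have "(u, w) \<in> conn ?E \<longleftrightarrow> connected_component_set ?Z u = connected_component_set ?Z w"
    if u: "u \<in> P" and w: "w \<in> P" for u w
  proof
    assume "(u, w) \<in> conn ?E"
    then show "connected_component_set ?Z u = connected_component_set ?Z w"
    proof (induction rule: conn_induct)
      case (step v w)
      then obtain F where "F \<in> \<F>" "v \<in> F" "w \<in> F" by blast
      then have "connected_component ?Z v w"
        unfolding connected_component_def using con by (intro exI[of _ F]) auto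
      then have "connected_component_set ?Z v = connected_component_set ?Z w"
        using connected_component_eq[of w ?Z v] by simp
      with step show ?case by simp
    qed simp
  next
    assume eq: "connected_component_set ?Z u = connected_component_set ?Z w"
    define K where "K = {v \<in> P. (u, v) \<in> conn ?E}"
    define \<A> where "\<A> = {F \<in> \<F>. F \<inter> K \<noteq> {}}"
    have inK: "v \<in> K" if "F \<in> \<A>" "v \<in> F" "v \<in> P" for F v
    proof -
      obtain k where k: "k \<in> F" "k \<in> K" "F \<in> \<F>" using \<open>F \<in> \<A>\<close> unfolding \<A>_def by blast
      then have "(k, v) \<in> ?E" using that K_def by blast
      then have "(k, v) \<in> conn ?E" by (rule conn_edge)
      then show ?thesis using k(2) that(3) conn_trans[of u k ?E v] unfolding K_def by simp
    qed
    have "connected_component_set ?Z u \<subseteq> \<Union>\<A>"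
    proof (rule connected_meets_disjoint_closed[of \<F>])
      show "F \<inter> F' = {}" if F: "F \<in> \<A>" "F' \<in> \<F> - \<A>" for F F'
      proof (rule ccontr)
        assume "F \<inter> F' \<noteq> {}"
        then obtain v where v: "v \<in> F" "v \<in> F'" by blast
        then have "v \<in> P" using int[of F F'] F unfolding \<A>_def by blast
        then have "v \<in> K" using inK F v by blast
        then show False using F v unfolding \<A>_def by blast
      qed
      obtain F where "u \<in> F" "F \<in> \<F>" using u P by blast
      moreover have "u \<in> K" using u K_def by simp
      ultimately have "u \<in> \<Union>\<A>" unfolding \<A>_def by blast
      moreover have "u \<in> connected_component_set ?Z u" using u P by auto
      ultimately show "connected_component_set ?Z u \<inter> \<Union> \<A> \<noteq> {}" by blast
    qed (use fin cl connected_component_subset[of ?Z u] in \<open>auto simp: \<A>_def\<close>)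
    moreover have "w \<in> connected_component_set ?Z u"
      unfolding eq using w P by auto
    ultimately show "(u, w) \<in> conn ?E"
      using inK w unfolding K_def by blast
  qed
  then show "card (components ?Z) = nclasses P ?E"
    unfolding comp by (rule nclasses_eq_card_image[symmetric])
qed

text \<open>A compact one-dimensional manifold, given by its components: arcs with exactly their
  endpoints marked, and circles without marks. The circles are boundaries of vertices at which
  nothing has been cut.\<close>

definition strands :: "'p::t2_space set set \<Rightarrow> 'p set \<Rightarrow> bool" where
  "strands \<Q> P \<longleftrightarrow> finite \<Q> \<and> pairwise disjnt \<Q> \<and> P \<subseteq> \<Union>\<Q> \<and>
     (\<forall>Q\<in>\<Q>. line_segment Q \<and> endpoints Q = Q \<inter> P \<or> loop Q \<and> Q \<inter> P = {})"

definition pairs_in :: "'a set \<Rightarrow> ('a \<times> 'a) set" where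
  "pairs_in X = {(u, w). u \<in> X \<and> w \<in> X \<and> u \<noteq> w}"

text \<open>Defined through the components of the point set and not through a family of strands, so
  that homeomorphisms carry it over and \<open>joined_at_vertex\<close> can be compared with
  it.\<close>

definition facing :: "'p::topological_space set \<Rightarrow> 'p set \<Rightarrow> ('p \<times> 'p) set" where
  "facing U P = {(u, w). u \<in> P \<and> w \<in> P \<and> u \<noteq> w \<and> (\<exists>C\<in>components U. u \<in> C \<and> w \<in> C)}"

text \<open>These circles contribute boundary components that a graph on the flags cannot
  see.\<close>

definition closed_strands :: "'p::topological_space set \<Rightarrow> 'p set \<Rightarrow> nat" where
  "closed_strands U P = card {C \<in> components U. C \<inter> P = {}}"

lemma pairs_in_pair: "u \<noteq> w \<Longrightarrow> pairs_in {u, w} = upair u w"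
  by (auto simp: pairs_in_def upair_def)

lemma strandsD:
  assumes "strands \<Q> P"
  shows "finite \<Q>" "pairwise disjnt \<Q>" "P \<subseteq> \<Union>\<Q>" "finite P"
    and "Q \<in> \<Q> \<Longrightarrow> closed Q" "Q \<in> \<Q> \<Longrightarrow> connected Q" "Q \<in> \<Q> \<Longrightarrow> Q \<noteq> {}"
    and "Q \<in> \<Q> \<Longrightarrow> line_segment Q \<and> endpoints Q = Q \<inter> P \<or> loop Q \<and> Q \<inter> P = {}"
    and "components (\<Union>\<Q>) = \<Q>"
    and "Q \<in> \<Q> \<Longrightarrow> Q' \<in> \<Q> \<Longrightarrow> x \<in> Q \<Longrightarrow> x \<in> Q' \<Longrightarrow> Q = Q'"
proof -
  show *: "finite \<Q>" "pairwise disjnt \<Q>" "P \<subseteq> \<Union>\<Q>"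
    "Q \<in> \<Q> \<Longrightarrow> line_segment Q \<and> endpoints Q = Q \<inter> P \<or> loop Q \<and> Q \<inter> P = {}" for Q
    using assms unfolding strands_def by auto
  show **: "closed Q" "connected Q" "Q \<noteq> {}" if "Q \<in> \<Q>" for Q
    using *(4)[OF that] line_segment_topology loop_topology by metis+
  show "components (\<Union>\<Q>) = \<Q>"
    by (rule components_Union_disjoint) (use * ** **(3)[of "{}"] in auto)
  show "Q \<in> \<Q> \<Longrightarrow> Q' \<in> \<Q> \<Longrightarrow> x \<in> Q \<Longrightarrow> x \<in> Q' \<Longrightarrow> Q = Q'" for Q Q' x
    using *(2) unfolding pairwise_def disjnt_def by blast
  have "finite (Q \<inter> P)" if "Q \<in> \<Q>" for Q
    using *(4)[OF that] line_segment_topology(6) by (metis finite.emptyI)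
  moreover have "P = (\<Union>Q\<in>\<Q>. Q \<inter> P)" using *(3) by blast
  ultimately show "finite P"
    using *(1) by (metis finite_UN_I)
qed

lemma facing_strands:
  assumes "strands \<Q> P"
  shows "facing (\<Union>\<Q>) P = (\<Union>Q\<in>\<Q>. pairs_in (Q \<inter> P))"
  unfolding facing_def strandsD(9)[OF assms] pairs_in_def by blast

text \<open>The strand through a marked point is an arc, and an arc has exactly one further marked
  point.\<close>

lemma matching_facing:
  assumes "strands \<Q> P"
  shows "matching P (facing (\<Union>\<Q>) P)"
proof (rule matchingI)
  note st = strandsD[OF assms]
  have seg: "\<exists>w. Q \<inter> P = {u, w} \<and> u \<noteq> w" if Q: "Q \<in> \<Q>" "u \<in> Q" "u \<in> P" for Q u
  proof -
    have "line_segment Q" "endpoints Q = Q \<inter> P" using st(8)[OF Q(1)] Q by blast+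
    then have "card (Q \<inter> P) = 2" using line_segment_topology(7) by metis
    then obtain a b where "Q \<inter> P = {a, b}" "a \<noteq> b" by (auto simp: card_2_iff)
    then show ?thesis using Q by (cases "u = a") (auto simp: insert_commute)
  qed
  show "\<exists>w. (u, w) \<in> facing (\<Union>\<Q>) P" if "u \<in> P" for u
  proof -
    obtain Q where Q: "Q \<in> \<Q>" "u \<in> Q" using st(3) \<open>u \<in> P\<close> by blast
    then obtain w where w: "Q \<inter> P = {u, w}" "u \<noteq> w" using seg \<open>u \<in> P\<close> by blast
    then have "(u, w) \<in> pairs_in (Q \<inter> P)" by (simp add: pairs_in_def)
    then show ?thesis unfolding facing_strands[OF assms] using Q by blast
  qed
  show "w = w'" if uw: "(u, w) \<in> facing (\<Union>\<Q>) P" "(u, w') \<in> facing (\<Union>\<Q>) P" for u w w'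
  proof -
    obtain Q Q' where QQ: "Q \<in> \<Q>" "Q' \<in> \<Q>" "u \<in> Q" "u \<in> Q'" "u \<in> P" "w \<in> Q \<inter> P" "w' \<in> Q' \<inter> P" "u \<noteq> w" "u \<noteq> w'"
      using uw unfolding facing_strands[OF assms] pairs_in_def by blast
    then have "Q = Q'" using st(10) by blast
    obtain v where v: "Q \<inter> P = {u, v}" using seg QQ by blast
    have "w \<in> {u, v}" "w' \<in> {u, v}" unfolding v[symmetric] using QQ(6,7) \<open>Q = Q'\<close> by simp_all
    then show ?thesis using QQ(8,9) by simp
  qed
qed (auto simp: facing_def)

text \<open>Being connected, \<open>S\<close> lies in one strand. Removing its interior opens a
  circle into one arc and divides an arc into two; the new endpoints become marked points.\<close>

lemma strands_cut:
  assumes "strands \<Q> P" and S: "line_segment S" "S \<subseteq> \<Union>\<Q>" "S \<inter> P = {}"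
  obtains (loop) Q where "Q \<in> \<Q>" "Q \<inter> P = {}" "S \<subseteq> Q"
      "strands (\<Q> - {Q} \<union> {Q - (S - endpoints S)}) (P \<union> endpoints S)"
      "\<Union>(\<Q> - {Q} \<union> {Q - (S - endpoints S)}) = \<Union>\<Q> - (S - endpoints S)"
    | (arc) Q u w q r Q1 Q2 where "Q \<in> \<Q>" "S \<subseteq> Q" "Q \<inter> P = {u, w}" "u \<noteq> w"
      "endpoints S = {q, r}" "q \<noteq> r" "Q1 \<inter> (P \<union> endpoints S) = {u, q}" "Q2 \<inter> (P \<union> endpoints S) = {r, w}"
      "strands (\<Q> - {Q} \<union> {Q1, Q2}) (P \<union> endpoints S)"
      "\<Union>(\<Q> - {Q} \<union> {Q1, Q2}) = \<Union>\<Q> - (S - endpoints S)"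
proof -
  note st = strandsD[OF assms(1)]
  note sg = line_segment_topology[OF S(1)]
  have "\<Union>\<Q> \<noteq> {}" using S(2) sg(4) by blast
  then obtain Q where Q: "Q \<in> \<Q>" "S \<subseteq> Q"
    using exists_component_superset[OF S(2) _ sg(2)] st(9) by blast
  have other: "Q' \<inter> (P \<union> endpoints S) = Q' \<inter> P \<and> Q' \<inter> Q = {}" if "Q' \<in> \<Q> - {Q}" for Q'
    using st(10) that Q sg(5) by blast
  have un: "\<Union>\<Q> - (S - endpoints S) = \<Union>(\<Q> - {Q}) \<union> (Q - (S - endpoints S))"
    using Q other by blast
  have rest: "line_segment Q' \<and> endpoints Q' = Q' \<inter> (P \<union> endpoints S) \<or> loop Q' \<and> Q' \<inter> (P \<union> endpoints S) = {}"
    if "Q' \<in> \<Q> - {Q}" for Q'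
    using st(8) other[OF that] that by auto
  have PU: "P \<union> endpoints S \<subseteq> \<Union>\<Q> - (S - endpoints S)"
    using st(3) S sg(5) by blast
  have pw: "pairwise disjnt (\<Q> - {Q})"
    using st(2) by (rule pairwise_subset) auto
  consider "loop Q" "Q \<inter> P = {}" | "line_segment Q" "endpoints Q = Q \<inter> P"
    using st(8)[OF Q(1)] by blast
  then show ?thesis
  proof cases
    case 1
    let ?D = "Q - (S - endpoints S)"
    note cut = loop_cut[OF 1(1) S(1) Q(2)]
    have U: "\<Union>(\<Q> - {Q} \<union> {?D}) = \<Union>\<Q> - (S - endpoints S)"
      unfolding un by blast
    have "?D \<inter> (P \<union> endpoints S) = endpoints S"
      using 1(2) Q(2) sg(5) by blast
    moreover have "pairwise disjnt (\<Q> - {Q} \<union> {?D})"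
    proof -
      have "disjnt ?D Q' \<and> disjnt Q' ?D" if "Q' \<in> \<Q> - {Q}" for Q'
        using other[OF that] unfolding disjnt_def by blast
      then show ?thesis using pw by (simp add: pairwise_insert)
    qed
    ultimately have "strands (\<Q> - {Q} \<union> {?D}) (P \<union> endpoints S)"
      using st(1) PU rest cut unfolding strands_def U by auto
    then show ?thesis using loop Q 1(2) U by blast
  next
    case 2
    have "S \<subseteq> Q - endpoints Q" using 2(2) Q(2) S(3) by blast
    then obtain u w q r Q1 Q2 where c: "endpoints Q = {u, w}" "u \<noteq> w" "endpoints S = {q, r}" "q \<noteq> r"
      "line_segment Q1" "line_segment Q2" "disjnt Q1 Q2" "Q1 \<union> Q2 = Q - (S - endpoints S)"
      "endpoints Q1 = {u, q}" "endpoints Q2 = {r, w}"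
      using line_segment_cut[OF 2(1) S(1)] by metis
    have U: "\<Union>(\<Q> - {Q} \<union> {Q1, Q2}) = \<Union>\<Q> - (S - endpoints S)"
      unfolding un c(8)[symmetric] by blast
    have in12: "u \<in> Q1" "q \<in> Q1" "r \<in> Q2" "w \<in> Q2"
      using line_segment_topology(5)[OF c(5)] line_segment_topology(5)[OF c(6)] c(9,10) by auto
    have d12: "Q1 \<inter> Q2 = {}" using c(7) unfolding disjnt_def .
    have QP: "Q \<inter> P = {u, w}" using 2(2) c(1) by simp
    have sub: "Q1 \<subseteq> Q" "Q2 \<subseteq> Q" using c(8) by blast+
    have QPi: "x \<in> P \<longleftrightarrow> x = u \<or> x = w" if "x \<in> Q" for x
      using QP that by blast
    have Q1: "Q1 \<inter> (P \<union> endpoints S) = {u, q}"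
    proof (rule set_eqI)
      show "x \<in> Q1 \<inter> (P \<union> endpoints S) \<longleftrightarrow> x \<in> {u, q}" for x
        using in12 d12 QPi[of x] QPi[of u] sub unfolding c(3) by auto
    qed
    have Q2: "Q2 \<inter> (P \<union> endpoints S) = {r, w}"
    proof (rule set_eqI)
      show "x \<in> Q2 \<inter> (P \<union> endpoints S) \<longleftrightarrow> x \<in> {r, w}" for x
        using in12 d12 QPi[of x] QPi[of w] sub unfolding c(3) by auto
    qed
    have "pairwise disjnt (\<Q> - {Q} \<union> {Q1, Q2})"
    proof -
      have "disjnt Q1 Q' \<and> disjnt Q' Q1 \<and> disjnt Q2 Q' \<and> disjnt Q' Q2" if "Q' \<in> \<Q> - {Q}" for Q'
        using other[OF that] c(8) unfolding disjnt_def by blast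
      then show ?thesis using pw c(7) disjnt_sym[OF c(7)] by (auto simp: pairwise_insert)
    qed
    then have "strands (\<Q> - {Q} \<union> {Q1, Q2}) (P \<union> endpoints S)"
      using st(1) PU rest Q1 Q2 c(5,6,9,10) unfolding strands_def U by auto
    then show ?thesis using arc[OF Q, of u w q r Q1 Q2] c(1-4) 2(2) Q1 Q2 U by simp
  qed
qed

text \<open>The arcs are cut out one after the other; since they are disjoint, the next one is still
  whole and free of marked points.\<close>

lemma strands_remove_arcs:
  assumes "strands \<Q> P" "finite \<S>" "pairwise disjnt \<S>"
    and "\<And>S. S \<in> \<S> \<Longrightarrow> line_segment S" "\<Union>\<S> \<subseteq> \<Union>\<Q> - P"
  shows "\<exists>\<Q>'. strands \<Q>' (P \<union> (\<Union>S\<in>\<S>. endpoints S)) \<and>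
    \<Union>\<Q>' = \<Union>\<Q> - (\<Union>S\<in>\<S>. S - endpoints S)"
  using assms(2-)
proof (induction \<S> rule: finite_induct)
  case empty
  then show ?case using assms(1) by auto
next
  case (insert S \<S>)
  let ?P = "P \<union> (\<Union>S\<in>\<S>. endpoints S)"
  have "pairwise disjnt \<S>"
    using insert.prems(1) by (auto simp: pairwise_insert)
  then obtain \<Q>1 where Q1: "strands \<Q>1 ?P" "\<Union>\<Q>1 = \<Union>\<Q> - (\<Union>S\<in>\<S>. S - endpoints S)"
    using insert.IH insert.prems by auto
  have disj: "S \<inter> T = {}" if "T \<in> \<S>" for T
    using pairwiseD[OF insert.prems(1), of S T] insert.hyps(2) that by (auto simp: disjnt_def)
  have S: "line_segment S" using insert.prems(2) by simp
  have "S \<subseteq> \<Union>\<Q>1" using disj insert.prems(3) unfolding Q1(2) by blast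
  moreover have "S \<inter> ?P = {}"
    using disj insert.prems(2,3) line_segment_topology(5) by blast
  ultimately obtain \<Q>2 where "strands \<Q>2 (?P \<union> endpoints S)" "\<Union>\<Q>2 = \<Union>\<Q>1 - (S - endpoints S)"
    by (rule strands_cut[OF Q1(1) S]) blast+
  moreover have "?P \<union> endpoints S = P \<union> (\<Union>S\<in>insert S \<S>. endpoints S)" by blast
  moreover have "\<Union>\<Q>1 - (S - endpoints S) = \<Union>\<Q> - (\<Union>S\<in>insert S \<S>. S - endpoints S)"
    unfolding Q1(2) by blast
  ultimately show ?case by metis
qed

text \<open>\<open>C\<close> leads from p to q without crossing the interior of \<open>S\<close>, so
  p and q stay on one strand after the cut. This decides which endpoint of \<open>S\<close> faces p,
  and hence that the strand p - y is replaced by p - q and r - y. As the strand that is cut carries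
  a mark, no circle is opened and \<open>closed_strands\<close> stays the same.\<close>

lemma facing_cut:
  assumes "strands \<Q> P" and S: "line_segment S" "S \<subseteq> \<Union>\<Q>" "S \<inter> P = {}"
    and e: "endpoints S = {q, r}" and p: "p \<in> P"
    and C: "connected C" "C \<subseteq> \<Union>\<Q> - (S - endpoints S)" "p \<in> C" "q \<in> C"
  obtains \<Q>' y where "strands \<Q>' (P \<union> {q, r})" "\<Union>\<Q>' = \<Union>\<Q> - (S - endpoints S)"
    "(p, y) \<in> facing (\<Union>\<Q>) P"
    "facing (\<Union>\<Q>') (P \<union> {q, r}) = facing (\<Union>\<Q>) P - upair p y \<union> upair p q \<union> upair r y"
    "closed_strands (\<Union>\<Q>') (P \<union> {q, r}) = closed_strands (\<Union>\<Q>) P"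
proof -
  note st = strandsD[OF assms(1)]
  have qS: "q \<in> S" using line_segment_topology(5)[OF S(1)] e by blast
  have same: "\<exists>Q\<in>\<R>. p \<in> Q \<and> q \<in> Q" if R: "strands \<R> P'" "C \<subseteq> \<Union>\<R>" for \<R> P'
  proof -
    have "\<Union>\<R> \<noteq> {}" using C(3) R(2) by blast
    then obtain Q where "Q \<in> \<R>" "C \<subseteq> Q"
      using exists_component_superset[OF R(2) _ C(1)] strandsD(9)[OF R(1)] by blast
    then show ?thesis using C by blast
  qed
  obtain Q0 where Q0: "Q0 \<in> \<Q>" "p \<in> Q0" "q \<in> Q0"
  proof -
    have "C \<subseteq> \<Union>\<Q>" using C(2) by blast
    then show ?thesis using same[OF assms(1)] that by blast
  qed
  show ?thesis
  proof (rule strands_cut[OF assms(1) S], goal_cases)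
    case loop: (1 Q)
    then have "Q = Q0" using st(10) Q0 qS by blast
    \<comment> \<open>Impossible: the circle would contain the marked point p.\<close>
    then show ?thesis using loop(2) p Q0 by blast
  next
    case arc: (2 Q u w q' r' Q1 Q2)
    let ?\<Q>' = "\<Q> - {Q} \<union> {Q1, Q2}"
    note st' = strandsD[OF arc(9)]
    have "Q = Q0" using arc(1,2) st(10) Q0 qS by blast
    then have pQ: "p \<in> {u, w}" using Q0(2) p arc(3) by blast
    have P': "P \<union> endpoints S = P \<union> {q, r}" using e by simp
    have es: "{q', r'} = {q, r}" using e arc(5) by simp
    obtain Q3 where Q3: "Q3 \<in> ?\<Q>'" "p \<in> Q3" "q \<in> Q3"
      using same[OF arc(9)] C(2) arc(10) by auto
    have uwP: "u \<in> P" "w \<in> P" using arc(3) by blast+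
    have notP: "q \<notin> P" "r \<notin> P" using S(3) e line_segment_topology(5)[OF S(1)] by blast+
    have mem: "u \<in> Q1" "q' \<in> Q1" "r' \<in> Q2" "w \<in> Q2"
      using arc(7,8) by blast+
    have rest: "Q' \<inter> (P \<union> endpoints S) = Q' \<inter> P" if "Q' \<in> \<Q> - {Q}" for Q'
      using st(10) that arc(1,2) line_segment_topology(5)[OF S(1)] by blast
    have "q' \<in> {q, r}" "r' \<in> {q, r}" unfolding es[symmetric] by simp_all
    then have neq: "u \<noteq> q'" "r' \<noteq> w" using uwP notP by auto
    \<comment> \<open>\<open>strands_cut\<close> does not fix the direction of the arc, so p may be
      its first or its last endpoint; in both cases q is the cut point on the side of p.\<close>
    have or: "p = u \<and> q = q' \<and> r = r' \<or> p = w \<and> q = r' \<and> r = q'"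
    proof -
      have qe: "q \<in> P \<union> endpoints S" using e by simp
      have ne: "q \<noteq> u" "q \<noteq> w" using uwP notP by blast+
      have or2: "q' = q \<and> r' = r \<or> q' = r \<and> r' = q"
        using es by (simp add: doubleton_eq_iff)
      from pQ consider "p = u" | "p = w" by blast
      then show ?thesis
      proof cases
        case 1
        then have "Q3 = Q1" using st'(10)[of Q3 Q1 p] Q3 mem by blast
        then have "q \<in> {u, q'}" using qe Q3(3) unfolding arc(7)[symmetric] by simp
        then show ?thesis using 1 ne or2 arc(6) by auto
      next
        case 2
        then have "Q3 = Q2" using st'(10)[of Q3 Q2 p] Q3 mem by blast
        then have "q \<in> {r', w}" using qe Q3(3) unfolding arc(8)[symmetric] by simp
        then show ?thesis using 2 ne or2 arc(6) by auto
      qed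
    qed
    define y where "y = (if p = u then w else u)"
    define M0 where "M0 = (\<Union>Q\<in>\<Q> - {Q}. pairs_in (Q \<inter> P))"
    have fac: "facing (\<Union>\<Q>) P = M0 \<union> upair p y"
    proof -
      have "facing (\<Union>\<Q>) P = M0 \<union> pairs_in (Q \<inter> P)"
        unfolding facing_strands[OF assms(1)] M0_def using arc(1) by blast
      also have "pairs_in (Q \<inter> P) = upair u w"
        unfolding arc(3) using arc(4) by (rule pairs_in_pair)
      also have "\<dots> = upair p y"
        using pQ unfolding y_def upair_def by auto
      finally show ?thesis .
    qed
    have "M0 \<inter> upair p y = {}"
    proof -
      have "p \<in> Q" "y \<in> Q" using arc(3) pQ unfolding y_def by auto
      then show ?thesis using st(10) arc(1) unfolding M0_def upair_def pairs_in_def by blast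
    qed
    have "facing (\<Union>?\<Q>') (P \<union> {q, r}) = (\<Union>Q\<in>?\<Q>'. pairs_in (Q \<inter> (P \<union> endpoints S)))"
      using facing_strands[OF arc(9)] P' by simp
    also have "\<dots> = (\<Union>Q\<in>\<Q> - {Q}. pairs_in (Q \<inter> (P \<union> endpoints S))) \<union> pairs_in (Q1 \<inter> (P \<union> endpoints S)) \<union> pairs_in (Q2 \<inter> (P \<union> endpoints S))"
      by blast
    also have "(\<Union>Q\<in>\<Q> - {Q}. pairs_in (Q \<inter> (P \<union> endpoints S))) = M0"
      unfolding M0_def using rest by simp
    also have "pairs_in (Q1 \<inter> (P \<union> endpoints S)) = upair u q'"
      unfolding arc(7) by (rule pairs_in_pair) (fact neq)
    also have "pairs_in (Q2 \<inter> (P \<union> endpoints S)) = upair r' w"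
      unfolding arc(8) by (rule pairs_in_pair) (fact neq)
    also have "M0 \<union> upair u q' \<union> upair r' w = M0 \<union> upair p q \<union> upair r y"
      using or arc(4) unfolding y_def upair_def by auto
    also have "\<dots> = facing (\<Union>\<Q>) P - upair p y \<union> upair p q \<union> upair r y"
      using fac \<open>M0 \<inter> upair p y = {}\<close> by blast
    finally have fac': "facing (\<Union>?\<Q>') (P \<union> {q, r}) = \<dots>" .
    have "{C \<in> ?\<Q>'. C \<inter> (P \<union> {q, r}) = {}} = {C \<in> \<Q>. C \<inter> P = {}}"
      using rest arc(1,3,7,8) e mem uwP unfolding P'[symmetric] by blast
    then have "closed_strands (\<Union>?\<Q>') (P \<union> {q, r}) = closed_strands (\<Union>\<Q>) P"
      unfolding closed_strands_def st(9) st'(9) by simp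
    moreover have "(p, y) \<in> facing (\<Union>\<Q>) P"
      unfolding fac by (simp add: upair_def)
    ultimately show ?thesis
      using that[of ?\<Q>' y] arc(9,10) fac' unfolding P' by blast
  qed
qed

text \<open>\<open>\<M>\<close> is meant for the arcs that close up the strands: the sides of edges
  that are present and the ends of edges that are absent.\<close>

lemma card_components_strands:
  assumes "strands \<Q> P" "finite \<M>"
    and M: "\<And>M. M \<in> \<M> \<Longrightarrow> line_segment M \<and> M \<inter> \<Union>\<Q> = endpoints M \<and> endpoints M \<subseteq> P"
    and MM: "\<And>M M'. M \<in> \<M> \<Longrightarrow> M' \<in> \<M> \<Longrightarrow> M \<noteq> M' \<Longrightarrow> M \<inter> M' \<subseteq> P"
  shows "finite (components (\<Union>\<Q> \<union> \<Union>\<M>))"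
    and "card (components (\<Union>\<Q> \<union> \<Union>\<M>)) =
      closed_strands (\<Union>\<Q>) P + nclasses P (facing (\<Union>\<Q>) P \<union> (\<Union>M\<in>\<M>. pairs_in (endpoints M)))"
proof -
  note st = strandsD[OF assms(1)]
  define \<L> where "\<L> = {C \<in> \<Q>. C \<inter> P = {}}"
  \<comment> \<open>One artificial marked point on each circle, since the count by pieces needs a
    marked point everywhere. These points are isolated in the graph and make up the summand
    \<open>closed_strands\<close>.\<close>
  define b where "b = (\<lambda>C::'a set. SOME x. x \<in> C)"
  have b: "b C \<in> C" if "C \<in> \<L>" for C
    using st(7) that unfolding b_def \<L>_def by (simp add: some_in_eq)
  define W where "W = b ` \<L>"
  have fin: "finite \<L>" "finite W" using st(1) by (auto simp: \<L>_def W_def)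
  have "inj_on b \<L>"
  proof (rule inj_onI)
    fix C D assume "C \<in> \<L>" "D \<in> \<L>" "b C = b D"
    then show "C = D" using b[of C] b[of D] st(10)[of C D "b C"] unfolding \<L>_def by simp
  qed
  then have cardW: "card W = closed_strands (\<Union>\<Q>) P"
    unfolding W_def closed_strands_def st(9) \<L>_def[symmetric] by (rule card_image)
  have disj: "P \<inter> W = {}" using b unfolding W_def \<L>_def by blast
  let ?F = "\<Q> \<union> \<M>" and ?V = "P \<union> W"
  have un: "\<Union>?F = \<Union>\<Q> \<union> \<Union>\<M>" by blast
  have int: "F \<inter> F' \<subseteq> P" if "F \<in> ?F" "F' \<in> ?F" "F \<noteq> F'" for F F'
  proof -
    have 1: "Q \<inter> M' \<subseteq> P" if "Q \<in> \<Q>" "M' \<in> \<M>" for Q M'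
      using M[OF that(2)] that by blast
    have 2: "Q \<inter> Q' \<subseteq> P" if "Q \<in> \<Q>" "Q' \<in> \<Q>" "Q \<noteq> Q'" for Q Q'
      using st(10) that by blast
    show ?thesis
      using that 1[of F F'] 1[of F' F] 2[of F F'] MM[of F F'] by (auto simp: Int_commute)
  qed
  have meets: "F \<inter> ?V \<noteq> {}" if "F \<in> ?F" for F
  proof (cases "F \<in> \<L>")
    case True
    then show ?thesis using b[OF True] unfolding W_def by blast
  next
    case False
    have "endpoints F \<noteq> {}" "endpoints F \<subseteq> F" if "F \<in> \<M>"
      using M[OF that] line_segment_topology(5,7)[of F] by auto
    then show ?thesis using False that M unfolding \<L>_def by blast
  qed
  have WU: "W \<subseteq> \<Union>\<Q>" using b unfolding W_def \<L>_def by blast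
  let ?E = "{(u, w). u \<in> ?V \<and> w \<in> ?V \<and> (\<exists>F\<in>?F. u \<in> F \<and> w \<in> F)}"
  let ?E' = "facing (\<Union>\<Q>) P \<union> (\<Union>M\<in>\<M>. pairs_in (endpoints M))"
  have clM: "closed F \<and> connected F" if "F \<in> ?F" for F
    using that st(5,6)[of F] M[of F] line_segment_topology(2,3)[of F] by auto
  have sub: "?V \<subseteq> \<Union>?F" using st(3) WU by blast
  have finF: "finite ?F" "finite ?V" using st(1,4) assms(2) fin by auto
  have intV: "F \<inter> F' \<subseteq> ?V" if "F \<in> ?F" "F' \<in> ?F" "F \<noteq> F'" for F F'
    using int[OF that] by blast
  have cp: "finite (components (\<Union>?F))" "card (components (\<Union>?F)) = nclasses ?V ?E"
    using card_components_pieces[OF finF sub _ _ meets intV] clM by blast+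
  then show "finite (components (\<Union>\<Q> \<union> \<Union>\<M>))" unfolding un by blast
  \<comment> \<open>No connecting arc touches a circle, so an artificial point shares a piece with
    no other marked point.\<close>
  have Wonly: "w = u" if h: "u \<in> W" "w \<in> ?V" "F \<in> ?F" "u \<in> F" "w \<in> F" for u w F
  proof -
    obtain C where C: "C \<in> \<L>" "u = b C" using h(1) unfolding W_def by blast
    have uC: "u \<in> C" using b C by blast
    have "u \<notin> P" using disj h(1) by blast
    then have "F = C" using int[of F C] C(1) h(3,4) uC unfolding \<L>_def by blast
    then have "w \<in> W" using h(2,5) C(1) unfolding \<L>_def by blast
    then obtain D where D: "D \<in> \<L>" "w = b D" unfolding W_def by blast
    then have "D = C" using st(10)[of D C w] b[OF D(1)] h(5) \<open>F = C\<close> C(1) unfolding \<L>_def by blast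
    then show ?thesis using C D by simp
  qed
  have eqE: "(u, w) \<in> ?E \<longleftrightarrow> (u, w) \<in> ?E'" if "u \<noteq> w" for u w
  proof
    assume uw: "(u, w) \<in> ?E"
    then obtain F where F: "F \<in> ?F" "u \<in> F" "w \<in> F" "u \<in> ?V" "w \<in> ?V" by blast
    then have uwP: "u \<in> P" "w \<in> P" using Wonly[of u w F] Wonly[of w u F] that by blast+
    then have "(u, w) \<in> pairs_in (F \<inter> P)" using F that by (simp add: pairs_in_def)
    moreover have "F \<inter> P = endpoints F" if "F \<in> \<M>"
      using M[OF that] line_segment_topology(5) st(3) by blast
    ultimately show "(u, w) \<in> ?E'"
      using F(1) unfolding facing_strands[OF assms(1)] by (metis UN_I Un_iff)
  next
    assume "(u, w) \<in> ?E'"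
    moreover have "endpoints M' \<subseteq> M' \<and> endpoints M' \<subseteq> P" if "M' \<in> \<M>" for M'
      using M[OF that] line_segment_topology(5) by blast
    ultimately show "(u, w) \<in> ?E"
      unfolding facing_strands[OF assms(1)] pairs_in_def by blast
  qed
  have E'P: "?E' \<subseteq> P \<times> P"
    using M unfolding facing_def pairs_in_def by blast
  have "nclasses ?V ?E = nclasses ?V ?E'"
  proof (rule nclasses_cong_modulo_loops)
    fix u w :: 'a assume "u \<noteq> w"
    then show "((u, w) \<in> ?E \<or> (w, u) \<in> ?E) = ((u, w) \<in> ?E' \<or> (w, u) \<in> ?E')"
      using eqE[OF \<open>u \<noteq> w\<close>] eqE[OF not_sym[OF \<open>u \<noteq> w\<close>]] by (simp only:)
  qed
  also have "\<dots> = nclasses ?V (?E' \<union> {})" by simp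
  also have "\<dots> = nclasses P ?E' + nclasses W {}"
    by (rule nclasses_Un_disjoint) (use st(4) fin disj E'P in auto)
  finally show "card (components (\<Union>\<Q> \<union> \<Union>\<M>)) = closed_strands (\<Union>\<Q>) P + nclasses P ?E'"
    using cp(2) cardW unfolding un nclasses_empty by simp
qed

lemma components_homeomorphism_image:
  assumes "homeomorphism S T f g"
  shows "components T = (`) f ` components S"
proof -
  have "components T = connected_component_set T ` (f ` S)"
    unfolding homeomorphism_image1[OF assms] by (auto simp: components_def)
  also have "\<dots> = (`) f ` connected_component_set S ` S"
    using connected_component_set_homeomorphism[OF assms] by (simp add: image_image)
  finally show ?thesis by (simp add: components_def)
qed

lemma facing_homeomorphism_image:
  assumes "homeomorphism S T f g" "P \<subseteq> S"
  shows "facing T (f ` P) = map_prod f f ` facing S P"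
    and "closed_strands T (f ` P) = closed_strands S P"
proof -
  have inj: "inj_on f S" using assms(1) unfolding homeomorphism_def by (metis inj_on_inverseI)
  have mem: "f u \<in> f ` C \<longleftrightarrow> u \<in> C" if "u \<in> S" "C \<in> components S" for u C
    using inj that in_components_subset by (metis inj_on_image_mem_iff)
  show "facing T (f ` P) = map_prod f f ` facing S P"
  proof (intro set_eqI iffI)
    fix e assume "e \<in> facing T (f ` P)"
    then obtain u w C where e: "e = (f u, f w)" "u \<in> P" "w \<in> P" "f u \<noteq> f w" "C \<in> components S"
        "f u \<in> f ` C" "f w \<in> f ` C"
      unfolding facing_def components_homeomorphism_image[OF assms(1)] by blast
    then have "u \<in> C" "w \<in> C" using mem assms(2) by blast+
    then have "(u, w) \<in> facing S P" using e unfolding facing_def by auto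
    then show "e \<in> map_prod f f ` facing S P" using e(1) by force
  next
    fix e assume "e \<in> map_prod f f ` facing S P"
    then obtain u w C where e: "e = (f u, f w)" "u \<in> P" "w \<in> P" "u \<noteq> w" "C \<in> components S" "u \<in> C" "w \<in> C"
      unfolding facing_def by auto
    then have "f u \<noteq> f w" using inj assms(2) by (metis inj_on_def subsetD)
    then show "e \<in> facing T (f ` P)"
      using e unfolding facing_def components_homeomorphism_image[OF assms(1)] by blast
  qed
  have "{C \<in> components T. C \<inter> f ` P = {}} = (`) f ` {C \<in> components S. C \<inter> P = {}}"
    unfolding components_homeomorphism_image[OF assms(1)] using mem assms(2) by blast
  moreover have "inj_on ((`) f) {C \<in> components S. C \<inter> P = {}}"
  proof (rule inj_onI)
    fix C D assume "C \<in> {C \<in> components S. C \<inter> P = {}}" "D \<in> {C \<in> components S. C \<inter> P = {}}" "f ` C = f ` D"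
    then show "C = D"
      using inj inj_on_image_eq_iff[OF inj, of C D] in_components_subset by blast
  qed
  ultimately show "closed_strands T (f ` P) = closed_strands S P"
    unfolding closed_strands_def by (simp add: card_image)
qed

section \<open>Discs, the sides of an edge, and the boundary of a spanning subgraph\<close>

section \<open>Ribbon graphs\<close>

text \<open>The transition map between two parametrisations is a homeomorphism of the closed disc.
  By invariance of domain it maps the open disc onto an open set, hence into the open disc, so no
  inner point can correspond to a point of the circle.\<close>

lemma disc_boundary_eq:
  assumes hk: "homeomorphism (cball (0::complex) 1) D h k"
  shows "disc_boundary D = h ` sphere 0 1"
proof
  show "h ` sphere 0 1 \<subseteq> disc_boundary D"
    using hk unfolding disc_boundary_def by blast
  show "disc_boundary D \<subseteq> h ` sphere 0 1"
  proof
    fix x assume "x \<in> disc_boundary D"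
    then obtain h' k' s where hk': "homeomorphism (cball (0::complex) 1) D h' k'" and s: "s \<in> sphere 0 1" "x = h' s"
      unfolding disc_boundary_def by blast
    let ?\<psi> = "k' \<circ> h" and ?\<phi> = "k \<circ> h'"
    have hom: "homeomorphism (cball 0 1) (cball 0 1) ?\<psi> ?\<phi>"
      by (rule homeomorphism_compose[OF hk homeomorphism_symD[OF hk']])
    have "open (?\<psi> ` ball 0 1)"
    proof (rule invariance_of_domain)
      show "continuous_on (ball 0 1) ?\<psi>"
        using homeomorphism_cont1[OF hom] by (rule continuous_on_subset) auto
      show "inj_on ?\<psi> (ball 0 1)"
        using hom unfolding homeomorphism_def by (intro inj_on_inverseI[of _ ?\<phi>]) auto
    qed simp
    moreover have "?\<psi> ` ball 0 1 \<subseteq> cball 0 1"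
      using homeomorphism_image1[OF hom] ball_subset_cball by blast
    ultimately have sub: "?\<psi> ` ball 0 1 \<subseteq> ball 0 1"
      using interior_maximal interior_cball by metis
    have s1: "s \<in> cball 0 1" using s by auto
    have "?\<phi> s \<notin> ball 0 1"
    proof
      assume "?\<phi> s \<in> ball 0 1"
      then have "?\<psi> (?\<phi> s) \<in> ball 0 1" using sub by blast
      then show False using homeomorphism_apply2[OF hom s1] s by simp
    qed
    moreover have "?\<phi> s \<in> cball 0 1"
      using homeomorphism_image2[OF hom] s1 by blast
    ultimately have "?\<phi> s \<in> sphere 0 1" by auto
    moreover have "h (?\<phi> s) = x"
      using homeomorphism_apply2[OF hk, of "h' s"] homeomorphism_image1[OF hk'] s1 s by auto
    ultimately show "x \<in> h ` sphere 0 1" by (metis imageI)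
  qed
qed

lemma disc_homeomorphism:
  assumes "disc D"
  obtains h k where "homeomorphism (cball (0::complex) 1) D h k"
  using assms unfolding disc_def by (meson homeomorphic_def homeomorphic_sym)

lemma disc_topology:
  assumes "disc D"
  shows "compact D" "connected D" "closed D" "D \<noteq> {}" "loop (disc_boundary D)" "disc_boundary D \<subseteq> D"
proof -
  obtain h k where hk: "homeomorphism (cball (0::complex) 1) D h k"
    using disc_homeomorphism[OF assms] .
  show "compact D" "connected D"
    using assms homeomorphic_compactness[of D "cball (0::complex) 1"]
      homeomorphic_connectedness[of D "cball (0::complex) 1"] unfolding disc_def by auto
  then show "closed D" by (simp add: compact_imp_closed)
  show "D \<noteq> {}" "disc_boundary D \<subseteq> D"
    using homeomorphism_image1[OF hk] disc_boundary_eq[OF hk] by force+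
  have "homeomorphism (sphere 0 1) (h ` sphere 0 1) h k"
    by (rule homeomorphism_of_subsets[OF hk]) (use homeomorphism_image1[OF hk] in auto)
  then show "loop (disc_boundary D)"
    unfolding loop_def disc_boundary_eq[OF hk] homeomorphic_def using homeomorphism_symD by blast
qed

lemma disc_homeomorphism_image:
  assumes fg: "homeomorphism D D' f g" and "disc D"
  shows "disc D'" "disc_boundary D' = f ` disc_boundary D"
proof -
  obtain h k where hk: "homeomorphism (cball (0::complex) 1) D h k"
    using disc_homeomorphism[OF assms(2)] .
  have "homeomorphism (cball (0::complex) 1) D' (f \<circ> h) (k \<circ> g)"
    by (rule homeomorphism_compose[OF hk fg])
  then show "disc_boundary D' = f ` disc_boundary D" "disc D'"
    using disc_boundary_eq[OF hk] disc_boundary_eq[of D' "f \<circ> h"] homeomorphism_symD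
    unfolding disc_def homeomorphic_def by (simp add: image_comp, blast)
qed

definition flags :: "('e, 'p::t2_space) ribbon \<Rightarrow> 'e \<Rightarrow> 'p set" where
  "flags G e = (\<Union>S\<in>ends G e. endpoints S)"

definition sides :: "('e, 'p::t2_space) ribbon \<Rightarrow> 'e \<Rightarrow> 'p set set" where
  "sides G e = components (disc_boundary (edge_disc G e) - open_ends G e)"

text \<open>The pairing of flags by the boundary arcs that \<open>e\<close> contributes. An absent
  edge exposes its two ends again as parts of vertex boundaries, a present one shows its two sides;
  both pairs of arcs join the same four flags, so \<open>A\<close> changes the edges of the graph
  but not its nodes.\<close>

definition link :: "('e, 'p::t2_space) ribbon \<Rightarrow> 'e set \<Rightarrow> 'e \<Rightarrow> ('p \<times> 'p) set" where
  "link G A e = (\<Union>M\<in>(if e \<in> A then sides G e else ends G e). pairs_in (endpoints M))"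

lemma ribbonD:
  assumes "ribbon_graph G"
  shows "finite (Verts G)" "finite (Edges G)"
    and "v \<in> Verts G \<Longrightarrow> disc v" "e \<in> Edges G \<Longrightarrow> disc (edge_disc G e)"
    and "v \<in> Verts G \<Longrightarrow> w \<in> Verts G \<Longrightarrow> x \<in> v \<Longrightarrow> x \<in> w \<Longrightarrow> v = w"
    and "e \<in> Edges G \<Longrightarrow> e' \<in> Edges G \<Longrightarrow> x \<in> edge_disc G e \<Longrightarrow> x \<in> edge_disc G e' \<Longrightarrow> e = e'"
    and "e \<in> Edges G \<Longrightarrow> card (ends G e) = 2"
    and "e \<in> Edges G \<Longrightarrow> S \<in> ends G e \<Longrightarrow> line_segment S"
    and "e \<in> Edges G \<Longrightarrow> S \<in> ends G e \<Longrightarrow> \<exists>v\<in>Verts G. S \<subseteq> disc_boundary v"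
    and "e \<in> Edges G \<Longrightarrow> S \<in> ends G e \<Longrightarrow> S \<subseteq> disc_boundary (edge_disc G e)"
proof -
  have seg: "line_segment S \<and> (\<exists>!v. v \<in> Verts G \<and> S \<subseteq> disc_boundary v) \<and>
      (\<exists>!e'. e' \<in> Edges G \<and> S \<subseteq> disc_boundary (edge_disc G e'))"
    if "e \<in> Edges G" "S \<in> ends G e" for e S
    using assms that unfolding ribbon_graph_def by simp
  show *: "finite (Verts G)" "finite (Edges G)"
    "v \<in> Verts G \<Longrightarrow> disc v" "e \<in> Edges G \<Longrightarrow> disc (edge_disc G e)"
    "e \<in> Edges G \<Longrightarrow> card (ends G e) = 2" for v e
    using assms unfolding ribbon_graph_def by simp_all
  show **: "e \<in> Edges G \<Longrightarrow> S \<in> ends G e \<Longrightarrow> line_segment S"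
    "e \<in> Edges G \<Longrightarrow> S \<in> ends G e \<Longrightarrow> \<exists>v\<in>Verts G. S \<subseteq> disc_boundary v" for e S
    using seg[of e S] by auto
  have "pairwise disjnt (Verts G)" "disjoint_family_on (edge_disc G) (Edges G)"
    using assms unfolding ribbon_graph_def by auto
  then show "v \<in> Verts G \<Longrightarrow> w \<in> Verts G \<Longrightarrow> x \<in> v \<Longrightarrow> x \<in> w \<Longrightarrow> v = w"
    and uniq: "e \<in> Edges G \<Longrightarrow> e' \<in> Edges G \<Longrightarrow> x \<in> edge_disc G e \<Longrightarrow> x \<in> edge_disc G e' \<Longrightarrow> e = e'" for v w x e e'
    unfolding pairwise_def disjnt_def disjoint_family_on_def by blast+
  \<comment> \<open>The edge whose boundary contains \<open>S\<close> can only be \<open>e\<close>,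
    because \<open>S\<close> lies in the disc of \<open>e\<close> and distinct edges have disjoint
    discs.\<close>
  show "S \<subseteq> disc_boundary (edge_disc G e)" if e: "e \<in> Edges G" "S \<in> ends G e" for e S
  proof -
    obtain e' where e': "e' \<in> Edges G" "S \<subseteq> disc_boundary (edge_disc G e')"
      using seg[OF e] by auto
    obtain x where x: "x \<in> S" using line_segment_topology(4)[OF **(1)[OF e]] by blast
    then have "x \<in> edge_disc G e"
      using in_components_subset[of S "\<Union>(Verts G) \<inter> edge_disc G e"] e(2) unfolding ends_def by blast
    moreover have "x \<in> edge_disc G e'"
      using e' x disc_topology(6)[OF *(4)[OF e'(1)]] by blast
    ultimately have "e = e'" using uniq e(1) e'(1) by metis
    then show ?thesis using e'(2) by simp
  qed
qed

lemma Union_ends: "\<Union>(ends G e) = \<Union>(Verts G) \<inter> edge_disc G e"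
  by (simp add: ends_def)

lemma ends_disjoint:
  assumes "ribbon_graph G" "e \<in> Edges G" "e' \<in> Edges G" "S \<in> ends G e" "S' \<in> ends G e'" "x \<in> S" "x \<in> S'"
  shows "S = S' \<and> e = e'"
proof -
  have "x \<in> edge_disc G e" "x \<in> edge_disc G e'"
    using assms(4-7) Union_ends[of G e] Union_ends[of G e'] by blast+
  then have "e = e'" using ribbonD(6) assms(1-3) by metis
  moreover have "S = S'"
    using components_nonoverlap[of S "\<Union>(Verts G) \<inter> edge_disc G e" S'] assms(4-7) \<open>e = e'\<close>
    unfolding ends_def by blast
  ultimately show ?thesis by blast
qed

lemma finite_ends: "ribbon_graph G \<Longrightarrow> e \<in> Edges G \<Longrightarrow> finite (ends G e)"
  using ribbonD(7) by (metis card.infinite zero_neq_numeral)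

lemma ends_obtain:
  assumes "ribbon_graph G" "e \<in> Edges G"
  obtains S S' where "ends G e = {S, S'}" "S \<noteq> S'" "S \<inter> S' = {}"
proof -
  obtain S S' where S: "ends G e = {S, S'}" "S \<noteq> S'"
    using ribbonD(7)[OF assms] by (auto simp: card_2_iff)
  moreover have "S \<inter> S' = {}"
    using ends_disjoint[OF assms assms(2), of S S'] S by auto
  ultimately show ?thesis using that by blast
qed

text \<open>Cutting one end out of the boundary circle leaves an arc with the other end in its
  interior; cutting out that one leaves two arcs. Which flags share a side is left open, which
  covers twisted and untwisted edges alike.\<close>

lemma edge_sides:
  assumes "ribbon_graph G" "e \<in> Edges G"
  obtains Q1 Q2 where "sides G e = {Q1, Q2}" "line_segment Q1" "line_segment Q2" "Q1 \<inter> Q2 = {}"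
    "endpoints Q1 = Q1 \<inter> flags G e" "endpoints Q2 = Q2 \<inter> flags G e"
    "Q1 \<union> Q2 = disc_boundary (edge_disc G e) - open_ends G e" "flags G e \<subseteq> Q1 \<union> Q2"
proof -
  let ?B = "disc_boundary (edge_disc G e)"
  obtain S S' where S: "ends G e = {S, S'}" "S \<noteq> S'" "S \<inter> S' = {}"
    using ends_obtain[OF assms] .
  have seg: "line_segment S" "line_segment S'" "S \<subseteq> ?B" "S' \<subseteq> ?B"
    using ribbonD(8,10)[OF assms] S(1) by blast+
  note sub = line_segment_topology(5)[OF seg(1)] line_segment_topology(5)[OF seg(2)]
  have "loop ?B" using disc_topology(5) ribbonD(4)[OF assms] by blast
  note D = loop_cut[OF this seg(1,3)]
  let ?D = "?B - (S - endpoints S)"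
  have "S' \<subseteq> ?D - endpoints ?D" unfolding D(2) using seg(4) S(3) sub by blast
  from line_segment_cut[OF D(1) seg(2) this]
  obtain u w q r Q1 Q2 where c: "endpoints ?D = {u, w}" "endpoints S' = {q, r}"
    "line_segment Q1" "line_segment Q2" "disjnt Q1 Q2" "Q1 \<union> Q2 = ?D - (S' - endpoints S')"
    "endpoints Q1 = {u, q}" "endpoints Q2 = {r, w}"
    by metis
  have d: "Q1 \<inter> Q2 = {}" using c(5) unfolding disjnt_def .
  have fl: "flags G e = {u, w, q, r}"
    unfolding flags_def S(1) using c(1,2) D(2) by auto
  have mem: "u \<in> Q1" "q \<in> Q1" "r \<in> Q2" "w \<in> Q2"
    using line_segment_topology(5)[OF c(3)] line_segment_topology(5)[OF c(4)] c(7,8) by auto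
  have oe: "open_ends G e = (S - endpoints S) \<union> (S' - endpoints S')"
    unfolding open_ends_def S(1) by auto
  have un: "Q1 \<union> Q2 = ?B - open_ends G e"
    unfolding c(6) oe by blast
  have "components (\<Union>{Q1, Q2}) = {Q1, Q2}"
  proof (rule components_Union_disjoint)
    show "pairwise disjnt {Q1, Q2}" using c(5) disjnt_sym by (auto simp: pairwise_insert)
  qed (use line_segment_topology(2-4)[OF c(3)] line_segment_topology(2-4)[OF c(4)] in auto)
  then have "sides G e = {Q1, Q2}"
    unfolding sides_def un[symmetric] by simp
  moreover have "endpoints Q1 = Q1 \<inter> flags G e" "endpoints Q2 = Q2 \<inter> flags G e"
    unfolding c(7,8) fl using mem d by auto
  moreover have "flags G e \<subseteq> Q1 \<union> Q2"
    unfolding fl using mem by auto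
  ultimately show ?thesis
    using that[OF _ c(3,4) d _ _ un] by simp
qed

text \<open>The set of ends to be cut is a parameter because two choices are needed: all ends, and
  all but the sliding one.\<close>

lemma vertex_strands:
  assumes G: "ribbon_graph G" and \<S>: "\<S> \<subseteq> (\<Union>e\<in>Edges G. ends G e)"
  obtains \<Q> where "strands \<Q> (\<Union>S\<in>\<S>. endpoints S)"
    "\<Union>\<Q> = (\<Union>v\<in>Verts G. disc_boundary v) - (\<Union>S\<in>\<S>. S - endpoints S)"
proof -
  let ?Q0 = "disc_boundary ` Verts G"
  have "disjnt (disc_boundary v) (disc_boundary w)"
    if "v \<in> Verts G" "w \<in> Verts G" "disc_boundary v \<noteq> disc_boundary w" for v w
  proof -
    have "v \<noteq> w" using that by blast
    then show ?thesis
      using disc_topology(6)[OF ribbonD(3)[OF G that(1)]] disc_topology(6)[OF ribbonD(3)[OF G that(2)]]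
        ribbonD(5)[OF G that(1,2)] unfolding disjnt_def by blast
  qed
  then have "pairwise disjnt ?Q0" unfolding pairwise_def by blast
  moreover have "\<forall>Q\<in>?Q0. loop Q" using disc_topology(5) ribbonD(3)[OF G] by blast
  ultimately have "strands ?Q0 {}"
    unfolding strands_def using ribbonD(1)[OF G] by auto
  moreover have "finite (\<Union>e\<in>Edges G. ends G e)"
    using ribbonD(2)[OF G] finite_ends[OF G] by blast
  then have "finite \<S>" using \<S> finite_subset by blast
  moreover have "pairwise disjnt \<S>"
    unfolding pairwise_def disjnt_def using \<S> ends_disjoint[OF G] by blast
  moreover have "line_segment S" if "S \<in> \<S>" for S
    using \<S> that ribbonD(8)[OF G] by blast
  moreover have "\<Union>\<S> \<subseteq> \<Union>?Q0 - {}"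
    using \<S> ribbonD(9)[OF G] by blast
  ultimately show ?thesis
    using strands_remove_arcs[of ?Q0 "{}" \<S>] that by auto
qed

lemma open_ends_disjoint:
  assumes "ribbon_graph G" "e \<in> Edges G" "e' \<in> Edges G" "S \<in> ends G e" "x \<in> S" "x \<in> open_ends G e'"
  shows "x \<in> S - endpoints S" "e = e'"
proof -
  obtain S' where "S' \<in> ends G e'" "x \<in> S' - endpoints S'"
    using assms(6) unfolding open_ends_def by blast
  then show "x \<in> S - endpoints S" "e = e'"
    using ends_disjoint[OF assms(1-4), of S' x] assms(5) by auto
qed

lemma open_ends_subset: "open_ends G e \<subseteq> \<Union>(ends G e)"
  unfolding open_ends_def by blast

lemma spanning_subgraph_simps [simp]:
  "Verts (spanning_subgraph G A) = Verts G" "Edges (spanning_subgraph G A) = A"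
  "edge_disc (spanning_subgraph G A) = edge_disc G" "ends (spanning_subgraph G A) = ends G"
  "open_ends (spanning_subgraph G A) = open_ends G"
  by (auto simp: spanning_subgraph_def ends_def open_ends_def fun_eq_iff)

text \<open>The vertex part is cut at the ends of every edge, present or not, and so is the same for
  each \<open>A\<close>; the ends of absent edges are put back in the second part.\<close>

lemma boundary_spanning_subgraph:
  assumes G: "ribbon_graph G" and A: "A \<subseteq> Edges G"
  shows "boundary (spanning_subgraph G A) =
    ((\<Union>v\<in>Verts G. disc_boundary v) - (\<Union>e\<in>Edges G. open_ends G e)) \<union>
    (\<Union>e\<in>Edges G. \<Union>(if e \<in> A then sides G e else ends G e))" (is "?L = ?U \<union> ?R")
proof
  have Usides: "\<Union>(sides G e) = disc_boundary (edge_disc G e) - open_ends G e" for e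
    unfolding sides_def by simp
  have bsub: "disc_boundary (edge_disc G e) \<subseteq> edge_disc G e" if "e \<in> Edges G" for e
    using disc_topology(6)[OF ribbonD(4)[OF G that]] .
  have oe: "x \<in> edge_disc G e" if "x \<in> open_ends G e" for x e
    using that open_ends_subset[of G e] Union_ends[of G e] by blast
  show "?L \<subseteq> ?U \<union> ?R"
  proof
    fix x assume x: "x \<in> ?L"
    then consider v where "v \<in> Verts G" "x \<in> disc_boundary v" "x \<notin> (\<Union>e\<in>A. open_ends G e)"
      | e where "e \<in> A" "x \<in> disc_boundary (edge_disc G e)" "x \<notin> (\<Union>e\<in>A. open_ends G e)"
      unfolding boundary_def by auto
    then show "x \<in> ?U \<union> ?R"
    proof cases
      case 1
      show ?thesis
      proof (cases "x \<in> (\<Union>e\<in>Edges G. open_ends G e)")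
        case True
        then obtain e where e: "e \<in> Edges G" "x \<in> open_ends G e" by blast
        then have "e \<notin> A" using 1(3) by blast
        moreover have "x \<in> \<Union>(ends G e)" using e(2) open_ends_subset[of G e] by blast
        ultimately show ?thesis using e(1) by auto
      next
        case False
        then show ?thesis using 1 by blast
      qed
    next
      case 2
      then have "x \<in> \<Union>(sides G e)" unfolding Usides by blast
      then show ?thesis using 2(1) A by auto
    qed
  qed
  show "?U \<union> ?R \<subseteq> ?L"
  proof
    fix x assume "x \<in> ?U \<union> ?R"
    then consider "x \<in> ?U" | e where "e \<in> A" "x \<in> \<Union>(sides G e)" | e S where "e \<in> Edges G - A" "S \<in> ends G e" "x \<in> S"
      by (auto split: if_splits)
    then show "x \<in> ?L"
    proof cases
      case 1
      then show ?thesis using A unfolding boundary_def by auto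
    next
      case 2
      then have x: "x \<in> disc_boundary (edge_disc G e)" "x \<notin> open_ends G e"
        unfolding Usides by auto
      then have "x \<notin> open_ends G e'" if "e' \<in> A" for e'
        using oe[of x e'] bsub ribbonD(6)[OF G, of e e' x] 2(1) A that by blast
      then show ?thesis using x 2(1) unfolding boundary_def by auto
    next
      case 3
      then have "x \<notin> open_ends G e'" if "e' \<in> A" for e'
        using open_ends_disjoint(2)[OF G, of e e' S x] A that by blast
      moreover obtain v where "v \<in> Verts G" "S \<subseteq> disc_boundary v"
        using ribbonD(9)[OF G, of e S] 3 by blast
      ultimately show ?thesis using 3(3) unfolding boundary_def by auto
    qed
  qed
qed

lemma matching_link:
  assumes "ribbon_graph G" "e \<in> Edges G"
  shows "matching (flags G e) (link G A e)"
proof -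
  have two: "matching (endpoints M \<union> endpoints M') (\<Union>M\<in>{M, M'}. pairs_in (endpoints M))"
    if "line_segment M" "line_segment M'" "M \<inter> M' = {}" for M M' :: "'b set"
  proof -
    have "matching (endpoints N) (pairs_in (endpoints N))" if "line_segment N" for N :: "'b set"
    proof -
      obtain u w where "endpoints N = {u, w}" "u \<noteq> w"
        using line_segment_topology(7)[OF \<open>line_segment N\<close>] by (auto simp: card_2_iff)
      then show ?thesis using matching_upair pairs_in_pair by metis
    qed
    then have "matching (endpoints M \<union> endpoints M') (pairs_in (endpoints M) \<union> pairs_in (endpoints M'))"
      using that line_segment_topology(5)[OF that(1)] line_segment_topology(5)[OF that(2)]
      by (intro matching_Un) blast+
    then show ?thesis by simp
  qed
  show ?thesis
  proof (cases "e \<in> A")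
    case True
    obtain Q1 Q2 where Q: "sides G e = {Q1, Q2}" "line_segment Q1" "line_segment Q2" "Q1 \<inter> Q2 = {}"
      "endpoints Q1 = Q1 \<inter> flags G e" "endpoints Q2 = Q2 \<inter> flags G e" "flags G e \<subseteq> Q1 \<union> Q2"
      using edge_sides[OF assms] by metis
    have "flags G e = endpoints Q1 \<union> endpoints Q2" using Q(5-7) by blast
    then show ?thesis using two[OF Q(2-4)] True Q(1) unfolding link_def by simp
  next
    case False
    obtain S S' where S: "ends G e = {S, S'}" "S \<inter> S' = {}"
      using ends_obtain[OF assms] by metis
    have "line_segment S" "line_segment S'" using ribbonD(8)[OF assms] S(1) by auto
    then show ?thesis using two[of S S'] S False unfolding link_def flags_def by simp
  qed
qed

text \<open>These facts allow sides and ends to serve as connecting arcs in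
  \<open>card_components_strands\<close>. A side can meet a vertex only inside an end of its edge,
  and of that end it contains at most the endpoints.\<close>

lemma link_pieces:
  assumes G: "ribbon_graph G" and e: "e \<in> Edges G" and M: "M \<in> (if e \<in> A then sides G e else ends G e)"
  shows "line_segment M" "M \<subseteq> edge_disc G e" "endpoints M \<subseteq> flags G e"
    "M \<inter> ((\<Union>v\<in>Verts G. disc_boundary v) - (\<Union>e\<in>Edges G. open_ends G e)) = endpoints M"
    "finite (if e \<in> A then sides G e else ends G e)"
    "M' \<in> (if e \<in> A then sides G e else ends G e) \<Longrightarrow> M \<noteq> M' \<Longrightarrow> M \<inter> M' = {}"
proof -
  let ?V = "\<Union>v\<in>Verts G. disc_boundary v" and ?O = "\<Union>e\<in>Edges G. open_ends G e"
  have "disc_boundary v \<subseteq> v" if "v \<in> Verts G" for v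
    using disc_topology(6)[OF ribbonD(3)[OF G that]] .
  then have VV: "?V \<subseteq> \<Union>(Verts G)" by blast
  have epS: "endpoints S \<subseteq> S" if "S \<in> ends G e" for S
    using line_segment_topology(5)[OF ribbonD(8)[OF G e that]] .
  then have flV: "flags G e \<subseteq> ?V"
    unfolding flags_def using ribbonD(9)[OF G e] by blast
  have flO: "flags G e \<inter> ?O = {}"
  proof (rule ccontr)
    assume "flags G e \<inter> ?O \<noteq> {}"
    then obtain x e' S where x: "e' \<in> Edges G" "x \<in> open_ends G e'" "S \<in> ends G e" "x \<in> endpoints S"
      unfolding flags_def by blast
    then have "x \<in> S" using epS by blast
    then show False using open_ends_disjoint(1)[OF G e x(1,3) _ x(2)] x(4) by blast
  qed
  have bd: "disc_boundary (edge_disc G e) \<subseteq> edge_disc G e"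
    using disc_topology(6)[OF ribbonD(4)[OF G e]] .
  have "line_segment M \<and> M \<subseteq> edge_disc G e \<and> endpoints M \<subseteq> flags G e \<and> M \<inter> (?V - ?O) = endpoints M
    \<and> finite (if e \<in> A then sides G e else ends G e)
    \<and> (\<forall>M'\<in>(if e \<in> A then sides G e else ends G e). M \<noteq> M' \<longrightarrow> M \<inter> M' = {})"
  proof (cases "e \<in> A")
    case True
    obtain Q1 Q2 where Q: "sides G e = {Q1, Q2}" "line_segment Q1" "line_segment Q2" "Q1 \<inter> Q2 = {}"
      "endpoints Q1 = Q1 \<inter> flags G e" "endpoints Q2 = Q2 \<inter> flags G e"
      "Q1 \<union> Q2 = disc_boundary (edge_disc G e) - open_ends G e"
      using edge_sides[OF G e] by metis
    have M': "M = Q1 \<or> M = Q2" using M True Q(1) by simp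
    then have 1: "line_segment M" "endpoints M = M \<inter> flags G e"
      using Q(2,3,5,6) by metis+
    have 12: "M \<subseteq> disc_boundary (edge_disc G e) - open_ends G e"
      using M' Q(7) by blast
    note 1 = 1 12
    have "M \<inter> (?V - ?O) \<subseteq> flags G e"
    proof
      fix x assume x: "x \<in> M \<inter> (?V - ?O)"
      then have "x \<in> \<Union>(Verts G) \<inter> edge_disc G e" using 1(3) VV bd by blast
      then obtain S where "S \<in> ends G e" "x \<in> S" using Union_ends[of G e] by blast
      moreover have "x \<notin> open_ends G e" using x e by blast
      ultimately show "x \<in> flags G e" unfolding flags_def open_ends_def by blast
    qed
    moreover have "endpoints M \<subseteq> M \<inter> (?V - ?O)" using 1(2) flV flO by blast
    ultimately have 2: "M \<inter> (?V - ?O) = endpoints M" using 1(2) by blast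
    have 3: "\<forall>M'\<in>{Q1, Q2}. M \<noteq> M' \<longrightarrow> M \<inter> M' = {}"
      using M' Q(4) by (auto simp: Int_commute)
    have 4: "endpoints M \<subseteq> flags G e" "M \<subseteq> edge_disc G e" using 1(2,3) bd by blast+
    show ?thesis using 1(1) 2 3 4 True Q(1) by simp
  next
    case False
    then have Me: "M \<in> ends G e" using M by simp
    have 1: "line_segment M" using ribbonD(8)[OF G e Me] .
    note ep = line_segment_topology(5)[OF 1]
    have 2: "endpoints M \<subseteq> flags G e" "M \<subseteq> edge_disc G e"
      using Me Union_ends[of G e] unfolding flags_def by blast+
    have "M - endpoints M \<subseteq> ?O" using Me e unfolding open_ends_def by blast
    then have "M \<inter> (?V - ?O) = endpoints M"
      using ep 2(1) flV flO by blast
    moreover have "\<forall>M'\<in>ends G e. M \<noteq> M' \<longrightarrow> M \<inter> M' = {}"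
      using ends_disjoint[OF G e e Me] by blast
    ultimately show ?thesis using 1 2 False finite_ends[OF G e] by simp
  qed
  then show "line_segment M" "M \<subseteq> edge_disc G e" "endpoints M \<subseteq> flags G e"
    "M \<inter> (?V - ?O) = endpoints M"
    "finite (if e \<in> A then sides G e else ends G e)"
    "M' \<in> (if e \<in> A then sides G e else ends G e) \<Longrightarrow> M \<noteq> M' \<Longrightarrow> M \<inter> M' = {}"
    by blast+
qed

definition vertex_arcs :: "('e, 'p::t2_space) ribbon \<Rightarrow> 'p set" where
  "vertex_arcs G = (\<Union>v\<in>Verts G. disc_boundary v) - (\<Union>e\<in>Edges G. open_ends G e)"

definition all_flags :: "('e, 'p::t2_space) ribbon \<Rightarrow> 'p set" where
  "all_flags G = (\<Union>e\<in>Edges G. flags G e)"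

lemma vertex_arcs_strands:
  assumes "ribbon_graph G"
  obtains \<Q> where "strands \<Q> (all_flags G)" "\<Union>\<Q> = vertex_arcs G"
proof -
  let ?S = "\<Union>e\<in>Edges G. ends G e"
  have "(\<Union>S\<in>?S. endpoints S) = all_flags G" "(\<Union>S\<in>?S. S - endpoints S) = (\<Union>e\<in>Edges G. open_ends G e)"
    unfolding all_flags_def flags_def open_ends_def by blast+
  then show ?thesis
    using vertex_strands[OF assms order_refl] that unfolding vertex_arcs_def by metis
qed

text \<open>The resulting formula depends on \<open>A\<close> through the links alone, which is what
  makes different spanning subgraphs comparable.\<close>

lemma card_components_boundary:
  assumes G: "ribbon_graph G" and A: "A \<subseteq> Edges G"
  shows "finite (components (boundary (spanning_subgraph G A)))"
    and "card (components (boundary (spanning_subgraph G A))) =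
      closed_strands (vertex_arcs G) (all_flags G)
      + nclasses (all_flags G) (facing (vertex_arcs G) (all_flags G) \<union> (\<Union>e\<in>Edges G. link G A e))"
proof -
  obtain \<Q> where Q: "strands \<Q> (all_flags G)" "\<Union>\<Q> = vertex_arcs G"
    using vertex_arcs_strands[OF G] .
  let ?m = "\<lambda>e. if e \<in> A then sides G e else ends G e"
  let ?M = "\<Union>e\<in>Edges G. ?m e"
  have fin: "finite ?M"
  proof (rule finite_UN_I[OF ribbonD(2)[OF G]])
    show "finite (?m e)" if "e \<in> Edges G" for e
      using link_pieces(5)[OF G that, of _ A] by (metis finite.emptyI ex_in_conv)
  qed
  have 1: "line_segment M \<and> M \<inter> \<Union>\<Q> = endpoints M \<and> endpoints M \<subseteq> all_flags G" if "M \<in> ?M" for M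
  proof -
    obtain e where e: "e \<in> Edges G" "M \<in> ?m e" using \<open>M \<in> ?M\<close> by blast
    show ?thesis
      using link_pieces(1,3,4)[OF G e] e(1) unfolding Q(2) vertex_arcs_def all_flags_def by blast
  qed
  have 2: "M \<inter> M' \<subseteq> all_flags G" if M: "M \<in> ?M" "M' \<in> ?M" "M \<noteq> M'" for M M'
  proof -
    obtain e e' where e: "e \<in> Edges G" "M \<in> ?m e" "e' \<in> Edges G" "M' \<in> ?m e'" using M by blast
    have "M \<inter> M' = {}"
    proof (cases "e = e'")
      case True
      then show ?thesis using link_pieces(6)[OF G e(1,2)] e(4) M(3) by blast
    next
      case False
      then show ?thesis
        using link_pieces(2)[OF G e(1,2)] link_pieces(2)[OF G e(3,4)] ribbonD(6)[OF G e(1,3)] by blast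
    qed
    then show ?thesis by blast
  qed
  have eq: "boundary (spanning_subgraph G A) = \<Union>\<Q> \<union> \<Union>?M"
    unfolding boundary_spanning_subgraph[OF G A] Q(2) vertex_arcs_def by blast
  have lk: "(\<Union>M\<in>?M. pairs_in (endpoints M)) = (\<Union>e\<in>Edges G. link G A e)"
    unfolding link_def by blast
  show "finite (components (boundary (spanning_subgraph G A)))"
    unfolding eq by (rule card_components_strands(1)[OF Q(1) fin 1 2])
  show "card (components (boundary (spanning_subgraph G A))) =
      closed_strands (vertex_arcs G) (all_flags G)
      + nclasses (all_flags G) (facing (vertex_arcs G) (all_flags G) \<union> (\<Union>e\<in>Edges G. link G A e))"
    using card_components_strands(2)[OF Q(1) fin 1 2] unfolding eq lk Q(2) .
qed

section \<open>Quasi-trees as the case of equality between two numbers of components\<close>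

section \<open>Spanning quasi-trees and components\<close>

lemma components_Int_component:
  assumes K: "K \<in> components X" and B: "B \<subseteq> X"
  shows "components (B \<inter> K) = {C \<in> components B. C \<subseteq> K}"
proof (intro set_eqI iffI)
  fix C assume C: "C \<in> components (B \<inter> K)"
  then have C': "C \<subseteq> B \<inter> K" "connected C" "C \<noteq> {}"
    using in_components_subset in_components_connected in_components_nonempty by blast+
  have mx: "D = C" if "D \<noteq> {}" "C \<subseteq> D" "D \<subseteq> B \<inter> K" "connected D" for D
    using C that unfolding in_components_maximal by blast
  have "C \<in> components B"
    unfolding in_components_maximal
  proof (intro conjI allI impI)
    fix D assume D: "D \<noteq> {} \<and> C \<subseteq> D \<and> D \<subseteq> B \<and> connected D"
    then have "K \<inter> D \<noteq> {}" "D \<subseteq> X" using C'(1,3) B by blast+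
    then have "D \<subseteq> K" using components_maximal[OF K, of D] D by blast
    then show "D = C" using mx[of D] D by blast
  qed (use C' in auto)
  then show "C \<in> {C \<in> components B. C \<subseteq> K}" using C' by blast
next
  fix C assume "C \<in> {C \<in> components B. C \<subseteq> K}"
  then show "C \<in> components (B \<inter> K)"
    using components_intermediate_subset[of C B "B \<inter> K"] in_components_subset[of C B] by auto
qed

text \<open>A surjection from a finite set has one-point fibres exactly if both sides have equal
  size. For the map from boundary components to components of the graph, this turns a condition on
  each component into a single equation.\<close>

lemma card_fibres:
  assumes fin: "finite \<C>" and im: "\<phi> ` \<C> = \<K>"
  shows "card \<K> \<le> card \<C>" "(\<forall>K\<in>\<K>. card {C \<in> \<C>. \<phi> C = K} = 1) \<longleftrightarrow> card \<C> = card \<K>"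
proof -
  show "card \<K> \<le> card \<C>" using fin im card_image_le by blast
  show "(\<forall>K\<in>\<K>. card {C \<in> \<C>. \<phi> C = K} = 1) \<longleftrightarrow> card \<C> = card \<K>"
  proof
    assume 1: "\<forall>K\<in>\<K>. card {C \<in> \<C>. \<phi> C = K} = 1"
    have "inj_on \<phi> \<C>"
    proof (rule inj_onI)
      fix C D assume CD: "C \<in> \<C>" "D \<in> \<C>" "\<phi> C = \<phi> D"
      then obtain X where "{C' \<in> \<C>. \<phi> C' = \<phi> C} = {X}"
        using 1 im by (metis card_1_singletonE image_eqI)
      then show "C = D" using CD by (metis (mono_tags, lifting) mem_Collect_eq singletonD)
    qed
    then show "card \<C> = card \<K>" using im card_image by metis
  next
    assume "card \<C> = card \<K>"
    then have inj: "inj_on \<phi> \<C>" using im fin by (metis eq_card_imp_inj_on)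
    show "\<forall>K\<in>\<K>. card {C \<in> \<C>. \<phi> C = K} = 1"
    proof
      fix K assume "K \<in> \<K>"
      then obtain C where C: "C \<in> \<C>" "\<phi> C = K" using im by blast
      then have "{C \<in> \<C>. \<phi> C = K} = {C}" using inj by (auto dest: inj_onD)
      then show "card {C \<in> \<C>. \<phi> C = K} = 1" by simp
    qed
  qed
qed

lemma space_pieces:
  assumes "ribbon_graph G"
  shows "v \<in> Verts G \<Longrightarrow> connected v \<and> v \<noteq> {} \<and> compact v \<and> v \<subseteq> space_of G"
    and "e \<in> Edges G \<Longrightarrow> connected (edge_disc G e) \<and> edge_disc G e \<noteq> {} \<and> compact (edge_disc G e) \<and> edge_disc G e \<subseteq> space_of G"
  using disc_topology[OF ribbonD(3)[OF assms]] disc_topology[OF ribbonD(4)[OF assms]]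
  unfolding space_of_def by blast+

text \<open>A component contains a vertex, since every edge has an end on one. Open ends cannot
  exhaust the circle around that vertex: if they did, one of them would lie on it, but the endpoints
  of its end belong to no open end.\<close>

lemma boundary_meets_component:
  assumes G: "ribbon_graph G" and A: "A \<subseteq> Edges G" and K: "K \<in> components (space_of G)"
  shows "boundary (spanning_subgraph G A) \<inter> K \<noteq> {}"
proof -
  have sub: "N \<subseteq> K" if "connected N" "N \<subseteq> space_of G" "N \<inter> K \<noteq> {}" for N
    using components_maximal[OF K that(1,2)] that(3) by blast
  obtain v where v: "v \<in> Verts G" "v \<subseteq> K"
  proof -
    obtain x where x: "x \<in> K" using in_components_nonempty[OF K] by blast
    then have "x \<in> space_of G" using in_components_subset[OF K] by blast
    then consider v where "v \<in> Verts G" "x \<in> v" | e where "e \<in> Edges G" "x \<in> edge_disc G e"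
      unfolding space_of_def by blast
    then show ?thesis
    proof cases
      case 1
      then show ?thesis using that space_pieces(1)[OF G 1(1)] sub[of v] x by blast
    next
      case 2
      have eK: "edge_disc G e \<subseteq> K" using space_pieces(2)[OF G 2(1)] sub[of "edge_disc G e"] x 2(2) by blast
      obtain S S' where "ends G e = {S, S'}" using ends_obtain[OF G 2(1)] by metis
      then have S: "S \<in> ends G e" by simp
      obtain y where y: "y \<in> S" using line_segment_topology(4)[OF ribbonD(8)[OF G 2(1) S]] by blast
      then have "y \<in> \<Union>(Verts G)" "y \<in> K" using Union_ends[of G e] S eK by blast+
      then obtain v where "v \<in> Verts G" "y \<in> v" by blast
      then show ?thesis using that space_pieces(1)[OF G, of v] sub[of v] \<open>y \<in> K\<close> by blast
    qed
  qed
  have bv: "disc_boundary v \<subseteq> v" "disc_boundary v \<noteq> {}"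
    using disc_topology[OF ribbonD(3)[OF G v(1)]] loop_topology(4) by blast+
  have "\<exists>x\<in>disc_boundary v. x \<notin> (\<Union>e\<in>A. open_ends G e)"
  proof (rule ccontr)
    assume none: "\<not> (\<exists>x\<in>disc_boundary v. x \<notin> (\<Union>e\<in>A. open_ends G e))"
    then obtain x e S where x: "x \<in> disc_boundary v" "e \<in> A" "S \<in> ends G e" "x \<in> S"
      using bv(2) unfolding open_ends_def by blast
    have e: "e \<in> Edges G" using x A by blast
    have seg: "line_segment S" using ribbonD(8)[OF G e x(3)] .
    obtain w where w: "w \<in> Verts G" "S \<subseteq> disc_boundary w" using ribbonD(9)[OF G e x(3)] by blast
    have "w = v"
      using ribbonD(5)[OF G w(1) v(1), of x] w(2) x bv(1) disc_topology(6)[OF ribbonD(3)[OF G w(1)]] by blast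
    obtain y where y: "y \<in> endpoints S"
      using line_segment_topology(7)[OF seg] by (metis card.empty ex_in_conv zero_neq_numeral)
    then have yS: "y \<in> S" using line_segment_topology(5)[OF seg] by blast
    then obtain e' where "e' \<in> A" "y \<in> open_ends G e'" using none w(2) \<open>w = v\<close> by blast
    then show False using open_ends_disjoint(1)[OF G e _ x(3) yS, of e'] A y by blast
  qed
  then obtain x where "x \<in> disc_boundary v" "x \<notin> (\<Union>e\<in>A. open_ends G e)" by blast
  then have "x \<in> boundary (spanning_subgraph G A)"
    unfolding boundary_def using v(1) by auto
  then show ?thesis using \<open>x \<in> disc_boundary v\<close> bv(1) v(2) by blast
qed

text \<open>Discs are connected, so each lies inside \<open>K\<close> or misses it. Restriction
  therefore never separates an edge from its vertices, and ends and boundary can be computed in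
  either graph.\<close>

lemma restrict_to_component:
  assumes G: "ribbon_graph G" and A: "A \<subseteq> Edges G" and K: "K \<in> components (space_of G)"
  shows "ribbon_graph (restrict_to (spanning_subgraph G A) K)"
    and "boundary (restrict_to (spanning_subgraph G A) K) = boundary (spanning_subgraph G A) \<inter> K"
proof -
  let ?R = "restrict_to (spanning_subgraph G A) K"
  have simps: "Verts ?R = {v \<in> Verts G. v \<subseteq> K}" "Edges ?R = {e \<in> A. edge_disc G e \<subseteq> K}" "edge_disc ?R = edge_disc G"
    by (simp_all add: restrict_to_def)
  have sub: "N \<subseteq> K" if "connected N" "N \<subseteq> space_of G" "N \<inter> K \<noteq> {}" for N
    using components_maximal[OF K that(1,2)] that(3) by blast
  have vK: "v \<subseteq> K" if "v \<in> Verts G" "x \<in> v" "x \<in> K" for v x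
    using sub[of v] space_pieces(1)[OF G that(1)] that by blast
  have eK: "edge_disc G e \<subseteq> K" if "e \<in> Edges G" "x \<in> edge_disc G e" "x \<in> K" for e x
    using sub[of "edge_disc G e"] space_pieces(2)[OF G that(1)] that by blast
  have "\<Union>{v \<in> Verts G. v \<subseteq> K} \<inter> edge_disc G e = \<Union>(Verts G) \<inter> edge_disc G e" if "edge_disc G e \<subseteq> K" for e
    using that vK by blast
  then have ends: "ends ?R e = ends G e" if "edge_disc G e \<subseteq> K" for e
    using that unfolding ends_def simps by simp
  then have oe: "open_ends ?R e = open_ends G e" if "edge_disc G e \<subseteq> K" for e
    using that unfolding open_ends_def by simp
  have bdv: "disc_boundary v \<subseteq> v" if "v \<in> Verts G" for v
    using disc_topology(6)[OF ribbonD(3)[OF G that]] .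
  have bde: "disc_boundary (edge_disc G e) \<subseteq> edge_disc G e" if "e \<in> Edges G" for e
    using disc_topology(6)[OF ribbonD(4)[OF G that]] .
  show "ribbon_graph ?R"
    unfolding ribbon_graph_def simps
  proof (intro conjI ballI)
    show "finite {v \<in> Verts G. v \<subseteq> K}" "finite {e \<in> A. edge_disc G e \<subseteq> K}"
      using ribbonD(1,2)[OF G] A finite_subset[of A] by auto
    show "disc v" if "v \<in> {v \<in> Verts G. v \<subseteq> K}" for v using that ribbonD(3)[OF G] by simp
    show "disc (edge_disc G e)" if "e \<in> {e \<in> A. edge_disc G e \<subseteq> K}" for e
      using that A ribbonD(4)[OF G, of e] by auto
    have "pairwise disjnt (Verts G)" using G unfolding ribbon_graph_def by simp
    then show "pairwise disjnt {v \<in> Verts G. v \<subseteq> K}"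
      by (rule pairwise_subset) blast
    show "disjoint_family_on (edge_disc G) {e \<in> A. edge_disc G e \<subseteq> K}"
    proof (rule disjoint_family_on_mono)
      show "disjoint_family_on (edge_disc G) (Edges G)"
        using G unfolding ribbon_graph_def by simp
    qed (use A in blast)
    fix e assume "e \<in> {e \<in> A. edge_disc G e \<subseteq> K}"
    then have e: "e \<in> A" "e \<in> Edges G" "edge_disc G e \<subseteq> K" using A by auto
    show "card (ends ?R e) = 2" using ends[OF e(3)] ribbonD(7)[OF G e(2)] by simp
    fix S assume "S \<in> ends ?R e"
    then have S: "S \<in> ends G e" using ends[OF e(3)] by simp
    show seg: "line_segment S" using ribbonD(8)[OF G e(2) S] .
    then obtain x where x: "x \<in> S" using line_segment_topology(4) by blast
    have xK: "x \<in> edge_disc G e" "x \<in> K" using S x Union_ends[of G e] e(3) by blast+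
    obtain v where v: "v \<in> Verts G" "S \<subseteq> disc_boundary v" using ribbonD(9)[OF G e(2) S] by blast
    show "\<exists>!v. v \<in> {v \<in> Verts G. v \<subseteq> K} \<and> S \<subseteq> disc_boundary v"
    proof (rule ex1I[of _ v])
      show "v \<in> {v \<in> Verts G. v \<subseteq> K} \<and> S \<subseteq> disc_boundary v"
        using v vK[OF v(1) _ xK(2)] bdv[OF v(1)] x by blast
      show "w = v" if "w \<in> {v \<in> Verts G. v \<subseteq> K} \<and> S \<subseteq> disc_boundary w" for w
        using ribbonD(5)[OF G, of w v x] that v bdv[of w] bdv[of v] x by blast
    qed
    show "\<exists>!e'. e' \<in> {e \<in> A. edge_disc G e \<subseteq> K} \<and> S \<subseteq> disc_boundary (edge_disc G e')"
    proof (rule ex1I[of _ e])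
      show "e \<in> {e \<in> A. edge_disc G e \<subseteq> K} \<and> S \<subseteq> disc_boundary (edge_disc G e)"
        using e ribbonD(10)[OF G e(2) S] by blast
      show "e' = e" if "e' \<in> {e \<in> A. edge_disc G e \<subseteq> K} \<and> S \<subseteq> disc_boundary (edge_disc G e')" for e'
        using ribbonD(6)[OF G, of e' e x] that e A bde[of e'] x xK by blast
    qed
  qed
  show "boundary ?R = boundary (spanning_subgraph G A) \<inter> K"
  proof (rule set_eqI)
    fix x
    have 1: "x \<in> disc_boundary v \<and> v \<subseteq> K \<longleftrightarrow> x \<in> disc_boundary v \<and> x \<in> K" if "v \<in> Verts G" for v
      using bdv[OF that] vK[OF that] by blast
    have 2: "x \<in> disc_boundary (edge_disc G e) \<and> edge_disc G e \<subseteq> K \<longleftrightarrow> x \<in> disc_boundary (edge_disc G e) \<and> x \<in> K" if "e \<in> A" for e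
      using bde[of e] eK[of e] that A by blast
    have "edge_disc G e \<subseteq> K" if "e \<in> A" "x \<in> open_ends G e" "x \<in> K" for e
      using that A eK[of e x] open_ends_subset[of G e] Union_ends[of G e] by blast
    then have 3: "(\<exists>e\<in>A. edge_disc G e \<subseteq> K \<and> x \<in> open_ends ?R e) \<longleftrightarrow> (\<exists>e\<in>A. x \<in> open_ends G e)" if "x \<in> K"
      using that oe by blast
    have L: "x \<in> boundary ?R \<longleftrightarrow> ((\<exists>v\<in>Verts G. v \<subseteq> K \<and> x \<in> disc_boundary v) \<or> (\<exists>e\<in>A. edge_disc G e \<subseteq> K \<and> x \<in> disc_boundary (edge_disc G e)))
        \<and> \<not> (\<exists>e\<in>A. edge_disc G e \<subseteq> K \<and> x \<in> open_ends ?R e)"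
      unfolding boundary_def simps by blast
    have R: "x \<in> boundary (spanning_subgraph G A) \<inter> K \<longleftrightarrow> ((\<exists>v\<in>Verts G. x \<in> K \<and> x \<in> disc_boundary v) \<or> (\<exists>e\<in>A. x \<in> K \<and> x \<in> disc_boundary (edge_disc G e)))
        \<and> \<not> (\<exists>e\<in>A. x \<in> open_ends G e)"
      unfolding boundary_def by auto
    show "x \<in> boundary ?R \<longleftrightarrow> x \<in> boundary (spanning_subgraph G A) \<inter> K"
      unfolding L R using 1 2 3 by blast
  qed
qed

text \<open>Each boundary component lies in one component of the graph, and each component of the
  graph contains at least one. The inequality is the lower bound on which the parity argument
  rests.\<close>

lemma spanning_quasi_tree_iff:
  assumes G: "ribbon_graph G" and A: "A \<subseteq> Edges G"
  shows "card (components (space_of G)) \<le> card (components (boundary (spanning_subgraph G A)))"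
    and "spanning_quasi_tree G A \<longleftrightarrow>
      card (components (boundary (spanning_subgraph G A))) = card (components (space_of G))"
proof -
  let ?B = "boundary (spanning_subgraph G A)" and ?X = "space_of G"
  have BX: "?B \<subseteq> ?X"
  proof
    fix x assume "x \<in> ?B"
    then consider v where "v \<in> Verts G" "x \<in> disc_boundary v"
      | e where "e \<in> Edges G" "x \<in> disc_boundary (edge_disc G e)"
      unfolding boundary_def using A by auto
    then show "x \<in> ?X"
    proof cases
      case 1
      then show ?thesis
        using disc_topology(6)[OF ribbonD(3)[OF G 1(1)]] unfolding space_of_def by blast
    next
      case 2
      then show ?thesis
        using disc_topology(6)[OF ribbonD(4)[OF G 2(1)]] unfolding space_of_def by blast
    qed
  qed
  have "\<exists>K\<in>components ?X. C \<subseteq> K" if C: "C \<in> components ?B" for C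
  proof -
    have "C \<subseteq> ?X" "C \<noteq> {}" "connected C"
      using C BX in_components_subset in_components_nonempty in_components_connected by blast+
    then show ?thesis using exists_component_superset[of C ?X] by blast
  qed
  then obtain \<phi> where \<phi>: "\<And>C. C \<in> components ?B \<Longrightarrow> \<phi> C \<in> components ?X \<and> C \<subseteq> \<phi> C"
    by metis
  have \<phi>_iff: "\<phi> C = K \<longleftrightarrow> C \<subseteq> K" if "C \<in> components ?B" "K \<in> components ?X" for C K
    using \<phi>[OF that(1)] that(2) in_components_nonempty[OF that(1)] components_nonoverlap[of K ?X "\<phi> C"] by blast
  \<comment> \<open>The fibre over \<open>K\<close> consists of the boundary components of the
    subgraph restricted to \<open>K\<close>.\<close>
  have fib: "{C \<in> components ?B. \<phi> C = K} = components (?B \<inter> K)" if "K \<in> components ?X" for K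
    unfolding components_Int_component[OF that BX] using \<phi>_iff that by blast
  have im: "\<phi> ` components ?B = components ?X"
  proof (intro set_eqI iffI)
    fix K assume K: "K \<in> components ?X"
    then have "components (?B \<inter> K) \<noteq> {}"
      using boundary_meets_component[OF G A K] by simp
    then show "K \<in> \<phi> ` components ?B" using fib[OF K] by blast
  qed (use \<phi> in blast)
  note fin = card_components_boundary(1)[OF G A]
  show "card (components ?X) \<le> card (components ?B)"
    by (rule card_fibres(1)[OF fin im])
  have "spanning_quasi_tree G A \<longleftrightarrow> (\<forall>K\<in>components ?X. card {C \<in> components ?B. \<phi> C = K} = 1)"
    unfolding spanning_quasi_tree_def quasi_tree_def
    using A restrict_to_component[OF G A] fib by auto
  then show "spanning_quasi_tree G A \<longleftrightarrow> card (components ?B) = card (components ?X)"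
    unfolding card_fibres(2)[OF fin im] .
qed

section \<open>The number of components after a connected set is added\<close>

lemma finite_components_Union:
  assumes "finite \<F>" "\<And>F. F \<in> \<F> \<Longrightarrow> connected F" "{} \<notin> \<F>"
  shows "finite (components (\<Union>\<F>))"
proof -
  have "\<exists>K\<in>components (\<Union>\<F>). F \<subseteq> K" if F: "F \<in> \<F>" for F
  proof -
    have "F \<noteq> {}" using F assms(3) by metis
    then show ?thesis using exists_component_superset[of F "\<Union>\<F>"] F assms(2) by blast
  qed
  then obtain \<phi> where \<phi>: "\<And>F. F \<in> \<F> \<Longrightarrow> \<phi> F \<in> components (\<Union>\<F>) \<and> F \<subseteq> \<phi> F"
    by metis
  have "components (\<Union>\<F>) \<subseteq> \<phi> ` \<F>"
  proof
    fix K assume K: "K \<in> components (\<Union>\<F>)"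
    then obtain x where "x \<in> K" using in_components_nonempty by blast
    then obtain F where F: "F \<in> \<F>" "x \<in> F" using in_components_subset[OF K] by blast
    then have "\<phi> F = K"
      using \<phi>[OF F(1)] components_nonoverlap[OF K, of "\<phi> F"] \<open>x \<in> K\<close> by blast
    then show "K \<in> \<phi> ` \<F>" using F(1) by blast
  qed
  then show ?thesis using assms(1) finite_surj by blast
qed

text \<open>\<open>D\<close> merges with all components that it meets into a single one, which
  accounts for the successor; the others are untouched.\<close>

lemma card_components_Un_connected:
  assumes M: "finite (components M)" "closed M" and D: "connected D" "closed D" "D \<noteq> {}"
  shows "card (components (M \<union> D)) = Suc (card {K \<in> components M. K \<inter> D = {}})"
proof -
  let ?L = "{K \<in> components M. K \<inter> D = {}}" and ?N = "D \<union> \<Union>{K \<in> components M. K \<inter> D \<noteq> {}}"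
  have "connected (\<Union>(insert D ((\<union>) D ` {K \<in> components M. K \<inter> D \<noteq> {}})))"
  proof (rule connected_Union)
    show "connected s" if "s \<in> insert D ((\<union>) D ` {K \<in> components M. K \<inter> D \<noteq> {}})" for s
      using that D(1) in_components_connected by (auto intro!: connected_Un)
    show "\<Inter> (insert D ((\<union>) D ` {K \<in> components M. K \<inter> D \<noteq> {}})) \<noteq> {}"
      using D(3) by auto
  qed
  moreover have "\<Union>(insert D ((\<union>) D ` {K \<in> components M. K \<inter> D \<noteq> {}})) = ?N" by blast
  ultimately have N: "connected ?N" by simp
  have clK: "closed K" if "K \<in> components M" for K
    using closed_components[OF M(2) that] .
  have clN: "closed ?N"
    using D(2) clK M(1) by (intro closed_Un closed_Union) auto
  have dis: "K \<inter> ?N = {}" if "K \<in> ?L" for K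
    using that components_nonoverlap[of K M] by blast
  have "\<Union>(insert ?N ?L) = M \<union> D"
  proof -
    have "M = \<Union>?L \<union> \<Union>{K \<in> components M. K \<inter> D \<noteq> {}}"
      using Union_components[of M] by blast
    then show ?thesis by blast
  qed
  moreover have "components (\<Union>(insert ?N ?L)) = insert ?N ?L"
  proof (rule components_Union_disjoint)
    show "finite (insert ?N ?L)" using M(1) by simp
    have "pairwise disjnt ?L"
      unfolding pairwise_def disjnt_def using components_nonoverlap[of _ M] by blast
    then show "pairwise disjnt (insert ?N ?L)"
      using dis unfolding pairwise_insert disjnt_def by blast
    show "closed Q" if "Q \<in> insert ?N ?L" for Q using that clN clK by blast
    show "connected Q" if "Q \<in> insert ?N ?L" for Q using that N in_components_connected by blast
    show "{} \<notin> insert ?N ?L" using D(3) in_components_nonempty by blast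
  qed
  moreover have "?N \<notin> ?L" using D(3) by blast
  ultimately show ?thesis using M(1) by simp
qed

section \<open>The five boundary counts on common flags\<close>

section \<open>Counting boundary components around a slide\<close>

lemma matching_UN:
  assumes "\<And>i. i \<in> I \<Longrightarrow> matching (V i) (M i)"
    and "\<And>i j. i \<in> I \<Longrightarrow> j \<in> I \<Longrightarrow> i \<noteq> j \<Longrightarrow> V i \<inter> V j = {}"
  shows "matching (\<Union>i\<in>I. V i) (\<Union>i\<in>I. M i)"
proof (rule matchingI)
  fix u w assume "(u, w) \<in> (\<Union>i\<in>I. M i)"
  then obtain i where i: "i \<in> I" "(u, w) \<in> M i" by blast
  then show "u \<in> (\<Union>i\<in>I. V i) \<and> u \<noteq> w \<and> (w, u) \<in> (\<Union>i\<in>I. M i)"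
    using matchingD(1)[OF assms(1)[OF i(1)] i(2)] by blast
next
  fix u assume "u \<in> (\<Union>i\<in>I. V i)"
  then obtain i where i: "i \<in> I" "u \<in> V i" by blast
  then show "\<exists>w. (u, w) \<in> (\<Union>i\<in>I. M i)"
    using matchingD(2)[OF assms(1)[OF i(1)] i(2)] by blast
next
  fix u w w' assume "(u, w) \<in> (\<Union>i\<in>I. M i)" "(u, w') \<in> (\<Union>i\<in>I. M i)"
  then obtain i j where ij: "i \<in> I" "j \<in> I" "(u, w) \<in> M i" "(u, w') \<in> M j" by blast
  have "u \<in> V i" "u \<in> V j"
    using matchingD(1)[OF assms(1)[OF ij(1)] ij(3)] matchingD(1)[OF assms(1)[OF ij(2)] ij(4)] by auto
  then have "i = j" using assms(2)[OF ij(1,2)] by blast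
  then show "w = w'" using matchingD(3)[OF assms(1)[OF ij(1)] ij(3)] ij(4) by blast
qed

text \<open>On four points one pair fixes the other. Thus a single side of an edge, which is all
  that a slide records, determines the whole link.\<close>

lemma matching_four:
  assumes L: "matching {u, w, z, z'} L" and "distinct [u, w, z, z']" and uz: "(u, z) \<in> L"
  shows "L = upair u z \<union> upair w z'"
proof -
  have zu: "(z, u) \<in> L" using matchingD(1)[OF L uz] by blast
  obtain v where v: "(w, v) \<in> L" using matchingD(2)[OF L, of w] by blast
  have "v \<noteq> w" "v \<in> {u, w, z, z'}" using matchingD(1)[OF L v] by auto
  moreover have "v \<noteq> u" "v \<noteq> z"
    using matchingD(4)[OF L v] uz zu assms(2) by auto
  ultimately have wz: "(w, z') \<in> L" using v by blast
  then have zw: "(z', w) \<in> L" using matchingD(1)[OF L wz] by blast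
  have "e \<in> upair u z \<union> upair w z'" if "e \<in> L" for e
  proof -
    obtain a b where e: "e = (a, b)" by fastforce
    then have "a \<in> {u, w, z, z'}" using matchingD(1)[OF L] that by blast
    then show ?thesis
      using that e matchingD(3)[OF L uz, of b] matchingD(3)[OF L zu, of b]
        matchingD(3)[OF L wz, of b] matchingD(3)[OF L zw, of b] unfolding upair_def by blast
  qed
  then show ?thesis using uz zu wz zw unfolding upair_def by blast
qed

lemma flags_subset:
  assumes "ribbon_graph G" "e \<in> Edges G"
  shows "flags G e \<subseteq> \<Union>(Verts G) \<inter> edge_disc G e"
proof -
  have "endpoints S \<subseteq> S" if "S \<in> ends G e" for S
    using line_segment_topology(5)[OF ribbonD(8)[OF assms that]] .
  then show ?thesis using Union_ends[of G e] unfolding flags_def by blast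
qed

lemma flags_disjoint:
  assumes "ribbon_graph G" "e \<in> Edges G" "e' \<in> Edges G" "e \<noteq> e'"
  shows "flags G e \<inter> flags G e' = {}"
  using flags_subset[OF assms(1,2)] flags_subset[OF assms(1,3)] ribbonD(6)[OF assms(1-3)] assms(4) by blast

lemma flags_two_ends:
  assumes "ribbon_graph G" "e \<in> Edges G" "ends G e = {S, S'}" "endpoints S = {u, w}" "endpoints S' = {z, z'}"
  shows "flags G e = {u, w, z, z'}" "distinct [u, w, z, z']" "S \<noteq> S'" "S \<inter> S' = {}"
proof -
  show "S \<noteq> S'" using ribbonD(7)[OF assms(1,2)] assms(3) by auto
  then show d: "S \<inter> S' = {}" using ends_disjoint[OF assms(1,2,2), of S S'] assms(3) by auto
  have seg: "line_segment S" "line_segment S'" using ribbonD(8)[OF assms(1,2)] assms(3) by auto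
  have "u \<noteq> w" "z \<noteq> z'"
    using line_segment_topology(7)[OF seg(1)] line_segment_topology(7)[OF seg(2)] assms(4,5) by auto
  moreover have "{u, w} \<inter> {z, z'} = {}"
    using line_segment_topology(5)[OF seg(1)] line_segment_topology(5)[OF seg(2)] assms(4,5) d by blast
  ultimately show "distinct [u, w, z, z']" by auto
  show "flags G e = {u, w, z, z'}" unfolding flags_def assms(3) by (auto simp: assms(4,5))
qed

lemma link_not_in:
  assumes "ribbon_graph G" "e \<in> Edges G" "ends G e = {S, S'}" "endpoints S = {u, w}" "endpoints S' = {z, z'}" "e \<notin> A"
  shows "link G A e = upair u w \<union> upair z z'"
  using flags_two_ends(2)[OF assms(1-5)] assms(3-6) unfolding link_def by (simp add: pairs_in_pair)

lemma link_joined: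
  assumes "ribbon_graph G" "e \<in> Edges G" "joined_along_edge G e u w" "u \<in> flags G e" "w \<in> flags G e" "u \<noteq> w" "e \<in> A"
  shows "(u, w) \<in> link G A e"
proof -
  obtain C where C: "C \<in> sides G e" "u \<in> C" "w \<in> C"
    using assms(3) unfolding joined_along_edge_def sides_def by blast
  have "endpoints C = C \<inter> flags G e"
    using edge_sides[OF assms(1,2)] C(1) by (metis insert_iff empty_iff)
  then have "(u, w) \<in> pairs_in (endpoints C)" using C assms(4-6) by (simp add: pairs_in_def)
  then show ?thesis using C(1) assms(7) unfolding link_def by auto
qed

text \<open>Two alternatives are offered because a slide records the side of \<open>a\<close> at the
  trailing flag. Before the slide this flag faces away from \<open>b\<close>, which gives the second
  alternative; after the slide it faces \<open>p'\<close>, which gives the first.\<close>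

lemma link_in:
  assumes G: "ribbon_graph G" "e \<in> Edges G" and e: "ends G e = {S, S'}" "endpoints S = {u, w}" "endpoints S' = {z, z'}"
    and j: "joined_along_edge G e u z \<or> joined_along_edge G e w z'" and A: "e \<in> A"
  shows "link G A e = upair u z \<union> upair w z'"
proof -
  note fl = flags_two_ends[OF G e]
  have mt: "matching {u, w, z, z'} (link G A e)" using matching_link[OF G] fl(1) by simp
  from j show ?thesis
  proof
    assume "joined_along_edge G e u z"
    then have "(u, z) \<in> link G A e" using link_joined[OF G] fl(1,2) A by simp
    then show ?thesis using matching_four[OF mt fl(2)] by blast
  next
    assume "joined_along_edge G e w z'"
    then have "(w, z') \<in> link G A e" using link_joined[OF G] fl(1,2) A by simp
    moreover have "{u, w, z, z'} = {w, u, z', z}" by blast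
    ultimately have "link G A e = upair w z' \<union> upair u z"
      using matching_four[of w u z' z] mt fl(2) by auto
    then show ?thesis by blast
  qed
qed

lemma link_cong: "(e \<in> A \<longleftrightarrow> e \<in> A') \<Longrightarrow> link G A e = link G A' e"
  unfolding link_def by simp

lemma upair_commute: "upair u w = upair w u"
  unfolding upair_def by blast

text \<open>\<open>S\<close> is here the end of \<open>a\<close> that stays in place. The vertex
  boundaries are cut there and at the ends of all other edges, while the sliding end is ignored;
  this part is common to both graphs.\<close>

definition base_arcs :: "('e, 'p::t2_space) ribbon \<Rightarrow> 'e \<Rightarrow> 'p set \<Rightarrow> 'p set" where
  "base_arcs G a S = (\<Union>v\<in>Verts G. disc_boundary v) -
     ((\<Union>e\<in>Edges G - {a}. open_ends G e) \<union> (S - endpoints S))"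

definition base_flags :: "('e, 'p::t2_space) ribbon \<Rightarrow> 'e \<Rightarrow> 'p set \<Rightarrow> 'p set" where
  "base_flags G a S = (\<Union>e\<in>Edges G - {a}. flags G e) \<union> endpoints S"

text \<open>\<open>N\<close> is reserved for the closing up of the six terminals; all else depends
  on \<open>X\<close> but neither on the position of the sliding end nor on whether \<open>a\<close>
  and \<open>b\<close> are present.\<close>

definition base_count :: "('e, 'p::t2_space) ribbon \<Rightarrow> 'e \<Rightarrow> 'e \<Rightarrow> 'p set \<Rightarrow> 'e set \<Rightarrow> ('p \<times> 'p) set \<Rightarrow> nat" where
  "base_count G a b S X N = closed_strands (base_arcs G a S) (base_flags G a S) +
     nclasses (base_flags G a S) (facing (base_arcs G a S) (base_flags G a S) \<union>
       (\<Union>e\<in>Edges G - {a, b}. link G X e) \<union> N)"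

definition boundary_count :: "('e, 'p::t2_space) ribbon \<Rightarrow> 'e set \<Rightarrow> nat" where
  "boundary_count G A = card (components (boundary (spanning_subgraph G A)))"

text \<open>All five boundary counts are expressed on the flags that remain when the sliding end of a
  is forgotten: an end next to p acts on the strands of the rest as if it were located at T.\<close>

lemma slide_counts:
  assumes G: "ribbon_graph G" and ab: "a \<in> Edges G" "b \<in> Edges G" "a \<noteq> b"
    and a: "ends G a = {S, S'}" "endpoints S = {q, r}" "endpoints S' = {z, z'}"
    and b: "ends G b = {T, T'}" "endpoints T = {p, t}" "endpoints T' = {p', t'}"
    and qp: "joined_at_vertex G q p" and pp: "joined_along_edge G b p p'"
    and az: "joined_along_edge G a q z \<or> joined_along_edge G a r z'"
    and X: "X \<subseteq> Edges G - {a, b}"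
  shows "finite (base_flags G a S')"
    and "matching (base_flags G a S') (facing (base_arcs G a S') (base_flags G a S'))"
    and "matching (base_flags G a S' - {p, t, p', t', z, z'}) (\<Union>e\<in>Edges G - {a, b}. link G X e)"
    and "{p, t, p', t', z, z'} \<subseteq> base_flags G a S'" "distinct [p, t, p', t', z, z']"
    and "boundary_count G X = base_count G a b S' X (upair z z' \<union> upair p t \<union> upair p' t')"
    and "boundary_count G (insert b X) = base_count G a b S' X (upair z z' \<union> upair p p' \<union> upair t t')"
    and "boundary_count G (insert a X) = base_count G a b S' X (upair p z' \<union> upair t z \<union> upair p' t')"
    and "boundary_count G (insert a (insert b X)) = base_count G a b S' X (upair p z' \<union> upair p' z \<union> upair t t')"
proof -
  let ?P = "base_flags G a S'" and ?U = "base_arcs G a S'"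
  let ?M = "facing ?U ?P" and ?B = "\<Union>e\<in>Edges G - {a, b}. link G X e"
  note fa = flags_two_ends[OF G ab(1) a] and fb = flags_two_ends[OF G ab(2) b]
  have Sa: "S \<in> ends G a" "S' \<in> ends G a" unfolding a(1) by simp_all
  note segS = ribbonD(8)[OF G ab(1) Sa(1)] and segS' = ribbonD(8)[OF G ab(1) Sa(2)]
  have fab: "flags G a \<inter> flags G b = {}" by (rule flags_disjoint[OF G ab])
  show dist: "distinct [p, t, p', t', z, z']"
    using fa(1,2) fb(1,2) fab by auto
  have P_eq: "?P = (\<Union>e\<in>Edges G - {a, b}. flags G e) \<union> {p, t, p', t', z, z'}"
    unfolding base_flags_def a(3) using fb(1) ab by blast
  then show sub: "{p, t, p', t', z, z'} \<subseteq> ?P" by blast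
  have qrP: "q \<notin> ?P" "r \<notin> ?P" "q \<noteq> r"
  proof -
    have "{q, r} \<inter> (\<Union>e\<in>Edges G - {a}. flags G e) = {}"
      using flags_disjoint[OF G ab(1)] fa(1) by blast
    then show "q \<notin> ?P" "r \<notin> ?P" "q \<noteq> r" unfolding base_flags_def a(3) using fa(2) by auto
  qed
  have all: "all_flags G = ?P \<union> {q, r}"
    unfolding all_flags_def base_flags_def a(3) using fa(1) ab(1) by blast
  have six: "{p, t, p', t', z, z'} \<inter> flags G e = {}" if "e \<in> Edges G - {a, b}" for e
    using flags_disjoint[OF G, of e a] flags_disjoint[OF G, of e b] that ab fa(1) fb(1) by blast
  have restP: "?P - {p, t, p', t', z, z'} = (\<Union>e\<in>Edges G - {a, b}. flags G e)"
    unfolding P_eq using six by blast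
  show matB: "matching (?P - {p, t, p', t', z, z'}) ?B"
    unfolding restP by (rule matching_UN) (use matching_link[OF G] flags_disjoint[OF G] in auto)
  \<comment> \<open>Every end except the sliding one.\<close>
  define \<S> where "\<S> = (\<Union>e\<in>Edges G - {a}. ends G e) \<union> {S'}"
  have "\<S> \<subseteq> (\<Union>e\<in>Edges G. ends G e)" unfolding \<S>_def using Sa(2) ab(1) by blast
  then obtain \<Q> where Q: "strands \<Q> (\<Union>S\<in>\<S>. endpoints S)"
    "\<Union>\<Q> = (\<Union>v\<in>Verts G. disc_boundary v) - (\<Union>S\<in>\<S>. S - endpoints S)"
    using vertex_strands[OF G] by blast
  have "(\<Union>S\<in>\<S>. endpoints S) = ?P"
    unfolding \<S>_def base_flags_def flags_def by blast
  then have QP: "strands \<Q> ?P" using Q(1) by simp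
  have "(\<Union>S\<in>\<S>. S - endpoints S) = (\<Union>e\<in>Edges G - {a}. open_ends G e) \<union> (S' - endpoints S')"
    unfolding \<S>_def open_ends_def by blast
  then have QU: "\<Union>\<Q> = ?U" using Q(2) unfolding base_arcs_def by simp
  show finP: "finite ?P" using strandsD(4)[OF QP] .
  show matM: "matching ?P ?M" using matching_facing[OF QP] unfolding QU .
  have Sx: "x \<notin> S'" "x \<notin> (\<Union>e\<in>Edges G - {a}. open_ends G e)" if "x \<in> S" for x
  proof -
    show "x \<notin> S'" using fa(4) that by blast
    show "x \<notin> (\<Union>e\<in>Edges G - {a}. open_ends G e)"
      using open_ends_disjoint(2)[OF G ab(1) _ Sa(1) that] by blast
  qed
  obtain v where "v \<in> Verts G" "S \<subseteq> disc_boundary v" using ribbonD(9)[OF G ab(1) Sa(1)] by blast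
  then have SU: "S \<subseteq> \<Union>\<Q>" unfolding QU base_arcs_def using Sx by blast
  have SP: "S \<inter> ?P = {}"
  proof -
    have "x \<notin> flags G e" if "x \<in> S" "e \<in> Edges G - {a}" for x e
    proof -
      have "x \<in> edge_disc G a" using that(1) Union_ends[of G a] Sa(1) by blast
      then show ?thesis using flags_subset[OF G, of e] ribbonD(6)[OF G ab(1), of e x] that(2) by blast
    qed
    moreover have "endpoints S' \<subseteq> S'" using line_segment_topology(5)[OF segS'] .
    ultimately show ?thesis unfolding base_flags_def using Sx(1) by blast
  qed
  have va: "vertex_arcs G = ?U - (S - endpoints S)"
  proof -
    have "(\<Union>e\<in>Edges G. open_ends G e) = (\<Union>e\<in>Edges G - {a}. open_ends G e) \<union> open_ends G a"
      using ab(1) by blast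
    moreover have "open_ends G a = (S' - endpoints S') \<union> (S - endpoints S)"
      unfolding open_ends_def a(1) by blast
    ultimately show ?thesis unfolding vertex_arcs_def base_arcs_def by blast
  qed
  \<comment> \<open>The sliding end is now put back: it faces p, so it cuts the strand from p to its
    partner y.\<close>
  obtain v C where C: "v \<in> Verts G" "C \<in> components (disc_boundary v - (\<Union>e\<in>Edges G. open_ends G e))" "q \<in> C" "p \<in> C"
    using qp unfolding joined_at_vertex_def by blast
  have "connected C" using in_components_connected[OF C(2)] .
  moreover have "C \<subseteq> \<Union>\<Q> - (S - endpoints S)"
    using in_components_subset[OF C(2)] C(1) unfolding QU va[symmetric] vertex_arcs_def by blast
  moreover have "p \<in> ?P" using sub by blast
  ultimately obtain \<Q>' y where y: "\<Union>\<Q>' = \<Union>\<Q> - (S - endpoints S)" "(p, y) \<in> facing (\<Union>\<Q>) ?P"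
    "facing (\<Union>\<Q>') (?P \<union> {q, r}) = facing (\<Union>\<Q>) ?P - upair p y \<union> upair p q \<union> upair r y"
    "closed_strands (\<Union>\<Q>') (?P \<union> {q, r}) = closed_strands (\<Union>\<Q>) ?P"
    using facing_cut[OF QP segS SU SP a(2)] C(3,4) by metis
  have py: "(p, y) \<in> ?M" using y(2) unfolding QU .
  let ?M' = "?M - upair p y \<union> upair p q \<union> upair r y"
  have M': "facing (vertex_arcs G) (all_flags G) = ?M'"
    "closed_strands (vertex_arcs G) (all_flags G) = closed_strands ?U ?P"
    using y(3,4) unfolding y(1) unfolding QU va all by simp_all
  have count: "boundary_count G A = closed_strands ?U ?P + nclasses (?P \<union> {q, r}) (?M' \<union> ?B \<union> (link G A a \<union> link G A b))"
    if A: "A \<subseteq> Edges G" "A - {a, b} = X" for A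
  proof -
    have "link G A e = link G X e" if "e \<in> Edges G - {a, b}" for e
      by (rule link_cong) (use A(2) that in blast)
    then have "(\<Union>e\<in>Edges G. link G A e) = ?B \<union> (link G A a \<union> link G A b)"
      using ab(1,2) by blast
    then show ?thesis
      unfolding boundary_count_def card_components_boundary(2)[OF G A(1)] M'
      unfolding all by (simp only: Un_assoc)
  qed
  have XE: "X \<subseteq> Edges G" "insert b X \<subseteq> Edges G" "insert a X \<subseteq> Edges G" "insert a (insert b X) \<subseteq> Edges G"
    "X - {a, b} = X" "insert b X - {a, b} = X" "insert a X - {a, b} = X" "insert a (insert b X) - {a, b} = X"
    and notX: "a \<notin> X" "b \<notin> X"
    using X ab by auto
  have la: "link G A a = upair q r \<union> upair z z'" if "a \<notin> A" for A
    using link_not_in[OF G ab(1) a that] .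
  have la': "link G A a = upair q z \<union> upair r z'" if "a \<in> A" for A
    using link_in[OF G ab(1) a az that] .
  have lb: "link G A b = upair p t \<union> upair p' t'" if "b \<notin> A" for A
    using link_not_in[OF G ab(2) b that] .
  have lb': "link G A b = upair p p' \<union> upair t t'" if "b \<in> A" for A
    using link_in[OF G ab(2) b _ that] pp by blast
  have BP: "?B \<subseteq> ?P \<times> ?P" "?B \<subseteq> (?P - {p, t, p', t'}) \<times> (?P - {p, t, p', t'})"
    using matching_subset[OF matB] by blast+
  have prP: "upair u w \<subseteq> ?P \<times> ?P" if "u \<in> {p, t, p', t', z, z'}" "w \<in> {p, t, p', t', z, z'}" for u w
    using that sub unfolding upair_def by blast
  note same = slide_contract_same[OF matM py qrP refl]
  have same': "nclasses (?P \<union> {q, r}) (?M' \<union> ?B \<union> (upair q r \<union> N1 \<union> N2)) = nclasses ?P (?M \<union> ?B \<union> (N1 \<union> N2))"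
    if "N1 \<union> N2 \<subseteq> ?P \<times> ?P" for N1 N2
  proof -
    have "?M' \<union> ?B \<union> (upair q r \<union> N1 \<union> N2) = ?M' \<union> (?B \<union> (N1 \<union> N2)) \<union> upair q r" by blast
    then show ?thesis using same[of "?B \<union> (N1 \<union> N2)"] BP(1) that by (simp add: Un_assoc)
  qed
  have e1: "link G X a \<union> link G X b = upair q r \<union> upair z z' \<union> (upair p t \<union> upair p' t')"
    using la[OF notX(1)] lb[OF notX(2)] by simp
  have "upair z z' \<union> (upair p t \<union> upair p' t') \<subseteq> ?P \<times> ?P"
    using prP by simp
  then show "boundary_count G X = base_count G a b S' X (upair z z' \<union> upair p t \<union> upair p' t')"
    unfolding base_count_def count[OF XE(1,5)] e1 by (subst same') (simp_all only: Un_assoc)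
  have e2: "link G (insert b X) a \<union> link G (insert b X) b = upair q r \<union> upair z z' \<union> (upair p p' \<union> upair t t')"
    using la[of "insert b X"] lb'[of "insert b X"] notX ab(3) by simp
  have "upair z z' \<union> (upair p p' \<union> upair t t') \<subseteq> ?P \<times> ?P"
    using prP by simp
  then show "boundary_count G (insert b X) = base_count G a b S' X (upair z z' \<union> upair p p' \<union> upair t t')"
    unfolding base_count_def count[OF XE(2,6)] e2 by (subst same') (simp_all only: Un_assoc)
  have five: "{t, p', t', z, z'} \<subseteq> ?P" using sub by blast
  have "link G (insert a X) a \<union> link G (insert a X) b = upair q z \<union> upair r z' \<union> upair p t \<union> upair p' t'"
    using la'[of "insert a X"] lb[of "insert a X"] notX ab(3) by auto
  then show "boundary_count G (insert a X) = base_count G a b S' X (upair p z' \<union> upair t z \<union> upair p' t')"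
    unfolding base_count_def count[OF XE(3,7)]
    using slide_contract_a[OF matM py qrP refl BP(2) dist five] by simp
  have "link G (insert a (insert b X)) a \<union> link G (insert a (insert b X)) b = upair q z \<union> upair r z' \<union> upair p p' \<union> upair t t'"
    using la'[of "insert a (insert b X)"] lb'[of "insert a (insert b X)"] by auto
  then show "boundary_count G (insert a (insert b X)) = base_count G a b S' X (upair p z' \<union> upair p' z \<union> upair t t')"
    unfolding base_count_def count[OF XE(4,8)]
    using slide_contract_ab[OF matM py qrP refl BP(2) dist five] by simp
qed

section \<open>Transport along the homeomorphism of the slide, and comparison of the two
  graphs\<close>

lemma homeomorphism_subset_image:
  assumes "homeomorphism X Y f g" "Z \<subseteq> X"
  shows "homeomorphism Z (f ` Z) f g"
  using homeomorphism_of_subsets[OF assms(1,2) _ refl] homeomorphism_image1[OF assms(1)] assms(2) by blast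

text \<open>All data of an edge that enter the counts are topological, so it suffices that the
  homeomorphism covers the vertices and the disc of that edge. This applies to every edge but
  \<open>a\<close>.\<close>

lemma edge_transport:
  assumes G: "ribbon_graph G" "e \<in> Edges G"
    and hom: "homeomorphism X Y f g" and sub: "\<Union>(Verts G) \<subseteq> X" "edge_disc G e \<subseteq> X"
    and V: "Verts H = (`) f ` Verts G" and e: "edge_disc H e = f ` edge_disc G e"
  shows "ends H e = (`) f ` ends G e"
    and "\<And>S. S \<in> ends G e \<Longrightarrow> endpoints (f ` S) = f ` endpoints S"
    and "flags H e = f ` flags G e" "open_ends H e = f ` open_ends G e"
    and "sides H e = (`) f ` sides G e" "link H A e = map_prod f f ` link G A e"
proof -
  have inj: "inj_on f X" using hom unfolding homeomorphism_def by (metis inj_on_inverseI)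
  note hs = homeomorphism_subset_image[OF hom]
  have "\<Union>(Verts H) \<inter> edge_disc H e = f ` (\<Union>(Verts G) \<inter> edge_disc G e)"
    unfolding V e using inj_on_image_Int[OF inj sub] by (simp add: image_Union)
  moreover have "\<Union>(Verts G) \<inter> edge_disc G e \<subseteq> X" using sub by blast
  ultimately show ends: "ends H e = (`) f ` ends G e"
    unfolding ends_def using components_homeomorphism_image[OF hs] by simp
  have endsX: "S \<subseteq> X" if "S \<in> ends G e" for S
    using that Union_ends[of G e] sub(2) by blast
  show ep: "endpoints (f ` S) = f ` endpoints S" if "S \<in> ends G e" for S
    using endpoints_homeomorphism_image(2)[OF hs[OF endsX[OF that]] ribbonD(8)[OF G that]] .
  show "flags H e = f ` flags G e" unfolding flags_def ends using ep by auto
  have "f ` S - endpoints (f ` S) = f ` (S - endpoints S)" if S: "S \<in> ends G e" for S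
    unfolding ep[OF S] using inj endsX[OF S] line_segment_topology(5)[OF ribbonD(8)[OF G S]]
    by (simp add: inj_on_image_set_diff[where C = X] subset_iff)
  then show oe: "open_ends H e = f ` open_ends G e" unfolding open_ends_def ends by auto
  have bd: "disc_boundary (edge_disc H e) = f ` disc_boundary (edge_disc G e)"
    unfolding e using disc_homeomorphism_image(2)[OF hs[OF sub(2)] ribbonD(4)[OF G]] .
  have bX: "disc_boundary (edge_disc G e) \<subseteq> X" using disc_topology(6)[OF ribbonD(4)[OF G]] sub(2) by blast
  have oX: "open_ends G e \<subseteq> X" using open_ends_subset[of G e] endsX by blast
  have "disc_boundary (edge_disc H e) - open_ends H e = f ` (disc_boundary (edge_disc G e) - open_ends G e)"
    unfolding bd oe using inj_on_image_set_diff[OF inj _ oX, of "disc_boundary (edge_disc G e)"] bX by blast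
  then show sides: "sides H e = (`) f ` sides G e"
  proof -
    have "disc_boundary (edge_disc G e) - open_ends G e \<subseteq> X" using bX by blast
    then show ?thesis
      unfolding sides_def \<open>disc_boundary (edge_disc H e) - open_ends H e = _\<close>
      using components_homeomorphism_image[OF hs] by simp
  qed
  have pairs: "pairs_in (f ` Z) = map_prod f f ` pairs_in Z" if "Z \<subseteq> X" for Z
  proof (intro set_eqI iffI)
    fix e assume "e \<in> pairs_in (f ` Z)"
    then obtain u w where "e = (f u, f w)" "u \<in> Z" "w \<in> Z" "f u \<noteq> f w"
      unfolding pairs_in_def by blast
    then have "e = map_prod f f (u, w)" "(u, w) \<in> pairs_in Z"
      unfolding pairs_in_def by auto
    then show "e \<in> map_prod f f ` pairs_in Z" by blast
  next
    fix e assume "e \<in> map_prod f f ` pairs_in Z"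
    then obtain u w where e: "e = (f u, f w)" "u \<in> Z" "w \<in> Z" "u \<noteq> w"
      unfolding pairs_in_def by auto
    then have "f u \<noteq> f w" using inj_onD[OF inj, of u w] that by blast
    then show "e \<in> pairs_in (f ` Z)" using e unfolding pairs_in_def by blast
  qed
  let ?m = "\<lambda>G. if e \<in> A then sides G e else ends G e"
  have m: "pairs_in (endpoints (f ` M)) = map_prod f f ` pairs_in (endpoints M)" if "M \<in> ?m G" for M
  proof -
    note lp = link_pieces(1,2)[OF G that]
    have MX: "M \<subseteq> X" using lp(2) sub(2) by blast
    have "endpoints (f ` M) = f ` endpoints M"
      using endpoints_homeomorphism_image(2)[OF hs[OF MX] lp(1)] .
    then show ?thesis using pairs line_segment_topology(5)[OF lp(1)] MX by auto
  qed
  have "?m H = (`) f ` ?m G" using ends sides by simp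
  then have "link H A e = (\<Union>M\<in>?m G. pairs_in (endpoints (f ` M)))"
    unfolding link_def by simp
  also have "\<dots> = map_prod f f ` link G A e"
    unfolding link_def image_UN using m by (rule SUP_cong[OF refl])
  finally show "link H A e = map_prod f f ` link G A e" .
qed


lemma meets_component_iff:
  assumes "K \<in> components X" "connected N" "N \<subseteq> X" "Z \<subseteq> N" "Z \<noteq> {}"
  shows "K \<inter> Z \<noteq> {} \<longleftrightarrow> N \<subseteq> K"
proof
  assume "K \<inter> Z \<noteq> {}"
  then have "K \<inter> N \<noteq> {}" using assms(4) by blast
  then show "N \<subseteq> K" using components_maximal[OF assms(1-3)] by blast
qed (use assms(4,5) in blast)

lemma space_insert_edge:
  assumes "a \<in> Edges G"
  shows "space_of G = space_of (spanning_subgraph G (Edges G - {a})) \<union> edge_disc G a"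
  unfolding space_of_def using assms by auto

text \<open>The disc of \<open>a\<close> meets the rest in its two ends only. Hence \<open>a\<close>
  influences the number of components only through the components of the rest that its ends
  touch.\<close>

lemma card_components_space:
  assumes G: "ribbon_graph G" and a: "a \<in> Edges G"
  defines "M \<equiv> space_of (spanning_subgraph G (Edges G - {a}))"
  shows "card (components (space_of G)) = Suc (card {K \<in> components M. K \<inter> \<Union>(ends G a) = {}})"
proof -
  let ?F = "Verts G \<union> edge_disc G ` (Edges G - {a})"
  have M: "M = \<Union>?F" unfolding M_def space_of_def by auto
  have F: "connected Z \<and> Z \<noteq> {} \<and> compact Z" if "Z \<in> ?F" for Z
    using that space_pieces[OF G] by blast
  have finF: "finite ?F" using ribbonD(1,2)[OF G] by simp
  have "finite (components M)" unfolding M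
    by (rule finite_components_Union[OF finF]) (use F in blast)+
  moreover have "closed M" unfolding M
    using finF F by (intro closed_Union) (auto intro: compact_imp_closed)
  moreover have "connected (edge_disc G a)" "closed (edge_disc G a)" "edge_disc G a \<noteq> {}"
    using space_pieces(2)[OF G a] compact_imp_closed by blast+
  ultimately have "card (components (M \<union> edge_disc G a)) = Suc (card {K \<in> components M. K \<inter> edge_disc G a = {}})"
    by (rule card_components_Un_connected)
  moreover have iff: "K \<inter> edge_disc G a = {} \<longleftrightarrow> K \<inter> \<Union>(ends G a) = {}" if "K \<in> components M" for K
  proof -
    have "K \<subseteq> M" using in_components_subset[OF that] .
    moreover have "M \<inter> edge_disc G a = \<Union>(ends G a)"
    proof -
      have "edge_disc G e \<inter> edge_disc G a = {}" if "e \<in> Edges G - {a}" for e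
        using ribbonD(6)[OF G, of e a] that a by blast
      then show ?thesis unfolding Union_ends M by blast
    qed
    ultimately show ?thesis by blast
  qed
  then have "{K \<in> components M. K \<inter> edge_disc G a = {}} = {K \<in> components M. K \<inter> \<Union>(ends G a) = {}}"
    by blast
  ultimately show ?thesis
    using space_insert_edge[OF a] unfolding M_def by simp
qed

text \<open>\<open>slide_counts\<close> is applied to both graphs, to \<open>H\<close> with the ends
  of \<open>b\<close> exchanged, since there the sliding end lies beside \<open>f p'\<close>. Pulled
  back along \<open>f\<close>, the counts of \<open>H\<close> live on the flags of \<open>G\<close>,
  and the pairings differ only for sets that contain \<open>a\<close> but not
  \<open>b\<close>.\<close>

lemma handle_slide_quasi_trees:
  fixes G :: "('e, 'p::t2_space) ribbon" and H :: "('e, 'q::t2_space) ribbon"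
  assumes G: "ribbon_graph G" and ab: "a \<in> Edges G" "b \<in> Edges G" "a \<noteq> b"
    and slide: "handle_slide G a b H" and A: "A \<subseteq> Edges G"
  shows "spanning_quasi_tree H A \<longleftrightarrow>
    spanning_quasi_tree G A \<noteq> (a \<in> A \<and> b \<notin> A \<and> spanning_quasi_tree G (insert b (A - {a})))"
proof -
  let ?E = "Edges G - {a}"
  define X0 where "X0 = space_of (spanning_subgraph G ?E)"
  have H: "ribbon_graph H" and EH: "Edges H = Edges G"
    using slide unfolding handle_slide_def by simp_all
  obtain f g S S' T T' S2 q r p p' r2 x where
    hom: "homeomorphism X0 (space_of (spanning_subgraph H ?E)) f g"
    and V: "(`) f ` Verts G = Verts H" and ed0: "\<forall>e\<in>?E. f ` edge_disc G e = edge_disc H e"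
    and ea: "ends G a = {S, S'}" and eb: "ends G b = {T, T'}" and eHa: "ends H a = {S2, f ` S'}"
    and qr: "endpoints S = {q, r}" and p: "p \<in> endpoints T" and qp: "joined_at_vertex G q p"
    and p': "p' \<in> endpoints T'" and pp: "joined_along_edge G b p p'"
    and r2: "r2 \<in> endpoints S2" and pr2: "joined_at_vertex H (f p') r2"
    and x: "x \<in> endpoints S'" and rx: "joined_along_edge G a r x" and rx2: "joined_along_edge H a r2 (f x)"
    using slide[unfolded handle_slide_def EH, folded X0_def]
    by (elim exE conjE) (rule that; assumption)
  have ed: "f ` edge_disc G e = edge_disc H e" if "e \<in> ?E" for e
    using ed0 that by blast
  have other: "\<exists>w. endpoints Z = {u, w}" if Z: "line_segment Z" "u \<in> endpoints Z" for Z :: "'z::t2_space set" and u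
  proof -
    obtain c d where "endpoints Z = {c, d}" "c \<noteq> d"
      using line_segment_topology(7)[OF Z(1)] by (auto simp: card_2_iff)
    then show ?thesis using Z(2) by (cases "u = c") (auto simp: insert_commute)
  qed
  have Sa: "S \<in> ends G a" "S' \<in> ends G a" unfolding ea by simp_all
  have Tb: "T \<in> ends G b" "T' \<in> ends G b" unfolding eb by simp_all
  have aH: "a \<in> Edges H" "b \<in> Edges H" using ab EH by auto
  have S2a: "S2 \<in> ends H a" unfolding eHa by simp
  obtain t t' x' q2 where t: "endpoints T = {p, t}" "endpoints T' = {p', t'}" "endpoints S' = {x, x'}"
    "endpoints S2 = {r2, q2}"
    using other[OF ribbonD(8)[OF G ab(2) Tb(1)] p] other[OF ribbonD(8)[OF G ab(2) Tb(2)] p']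
      other[OF ribbonD(8)[OF G ab(1) Sa(2)] x] other[OF ribbonD(8)[OF H aH(1) S2a] r2] by blast
  have VX: "v \<subseteq> X0" if "v \<in> Verts G" for v
    using that unfolding X0_def space_of_def by auto
  then have VX': "\<Union>(Verts G) \<subseteq> X0" by blast
  have eX: "edge_disc G e \<subseteq> X0" if "e \<in> ?E" for e
    using that unfolding X0_def space_of_def by auto
  have inj: "inj_on f X0" using hom unfolding homeomorphism_def by (metis inj_on_inverseI)
  note tr = edge_transport[OF G _ hom VX' eX V[symmetric] ed[symmetric]]
  have bE: "b \<in> ?E" using ab by blast
  have S'X: "S' \<subseteq> X0" using Union_ends[of G a] Sa(2) VX' by blast
  have segS': "line_segment S'" using ribbonD(8)[OF G ab(1) Sa(2)] .
  have epS': "endpoints (f ` S') = {f x, f x'}"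
    using endpoints_homeomorphism_image(2)[OF homeomorphism_subset_image[OF hom S'X] segS'] t(3) by simp
  have ebH: "ends H b = {f ` T', f ` T}"
    using tr(1)[OF ab(2) bE bE] eb by auto
  have epT: "endpoints (f ` T') = {f p', f t'}" "endpoints (f ` T) = {f p, f t}"
    using tr(2)[OF ab(2) bE bE Tb(1)] tr(2)[OF ab(2) bE bE Tb(2)] t by auto
  have ppH: "joined_along_edge H b (f p') (f p)"
  proof -
    obtain C where C: "C \<in> sides G b" "p \<in> C" "p' \<in> C"
      using pp unfolding joined_along_edge_def sides_def by blast
    have "f ` C \<in> sides H b" unfolding tr(5)[OF ab(2) bE bE] using C(1) by (rule imageI)
    moreover have "f p' \<in> f ` C" "f p \<in> f ` C" using C(2,3) by simp_all
    ultimately show ?thesis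
      unfolding joined_along_edge_def sides_def[symmetric] by (intro bexI[of _ "f ` C"] conjI)
  qed
  have qpH: "joined_at_vertex H r2 (f p')"
    using pr2 unfolding joined_at_vertex_def by blast
  \<comment> \<open>Before the slide q faces p and r is joined to x, so x' plays the part of z and x
    that of z' in \<open>slide_counts\<close>.\<close>
  have eaG: "ends G a = {S, S'}" "endpoints S = {q, r}" "endpoints S' = {x', x}"
    using ea qr t(3) by auto
  let ?X = "A - {a, b}"
  have XE: "?X \<subseteq> Edges G - {a, b}" "?X \<subseteq> Edges H - {a, b}" using A EH by auto
  note sG = slide_counts[OF G ab eaG eb t(1,2) qp pp disjI2[OF rx] XE(1)]
  \<comment> \<open>After the slide r2 plays the part of q, so x becomes z and x' becomes z', while
    p and p' change places.\<close>
  note sH = slide_counts[OF H aH ab(3) eHa t(4) epS' ebH epT qpH ppH disjI1[OF rx2] XE(2)]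
  let ?P = "base_flags G a S'" and ?U = "base_arcs G a S'"
  let ?B = "\<Union>e\<in>Edges G - {a, b}. link G ?X e"
  have bdX: "disc_boundary v \<subseteq> X0" if "v \<in> Verts G" for v
    using disc_topology(6)[OF ribbonD(3)[OF G that]] VX[OF that] by blast
  have bdH: "disc_boundary (f ` v) = f ` disc_boundary v" if "v \<in> Verts G" for v
    using disc_homeomorphism_image(2)[OF homeomorphism_subset_image[OF hom VX[OF that]] ribbonD(3)[OF G that]] .
  have P_im: "base_flags H a (f ` S') = f ` ?P"
    unfolding base_flags_def EH epS' t(3) using tr(3) by (auto simp: image_UN)
  have U_im: "base_arcs H a (f ` S') = f ` ?U"
  proof -
    let ?V = "\<Union>v\<in>Verts G. disc_boundary v" and ?O = "(\<Union>e\<in>?E. open_ends G e) \<union> (S' - endpoints S')"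
    have OX: "?O \<subseteq> X0" "?V \<subseteq> X0"
    proof -
      have "open_ends G e \<subseteq> X0" for e using open_ends_subset[of G e] Union_ends[of G e] VX' by blast
      then show "?O \<subseteq> X0" using S'X by blast
      show "?V \<subseteq> X0" using bdX by blast
    qed
    have "f ` (S' - endpoints S') = f ` S' - endpoints (f ` S')"
      using inj_on_image_set_diff[OF inj, of S' "endpoints S'"] S'X line_segment_topology(5)[OF segS'] epS' t(3) by auto
    moreover have "f ` (\<Union>e\<in>?E. open_ends G e) = (\<Union>e\<in>?E. open_ends H e)"
      unfolding image_UN using tr(4) by auto
    moreover have "f ` ?V = (\<Union>v\<in>Verts H. disc_boundary v)"
      unfolding image_UN V[symmetric] using bdH by auto
    moreover have "f ` (?V - ?O) = f ` ?V - f ` ?O"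
      by (rule inj_on_image_set_diff[OF inj]) (use OX in blast)+
    ultimately show ?thesis unfolding base_arcs_def EH by (simp add: image_Un)
  qed
  have UX: "?U \<subseteq> X0" using bdX unfolding base_arcs_def by blast
  \<comment> \<open>Facing pairs lie on a common component of the arcs, and every flag is in such a
    pair.\<close>
  have PU: "?P \<subseteq> ?U"
  proof -
    have "facing ?U ?P \<subseteq> ?U \<times> ?U"
      unfolding facing_def using in_components_subset by blast
    then show ?thesis using matchingD(2)[OF sG(2)] by blast
  qed
  note hU = homeomorphism_subset_image[OF hom UX]
  have B_im: "(\<Union>e\<in>Edges H - {a, b}. link H ?X e) = map_prod f f ` ?B"
    unfolding EH image_UN using tr(6) by (intro SUP_cong refl) auto
  have count_im: "base_count H a b (f ` S') ?X (map_prod f f ` N) = base_count G a b S' ?X N" if N: "N \<subseteq> ?P \<times> ?P" for N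
  proof -
    have "facing ?U ?P \<union> ?B \<union> N \<subseteq> ?P \<times> ?P"
      using matching_subset[OF sG(2)] matching_subset[OF sG(3)] N by blast
    moreover have "inj_on f ?P" using inj PU UX by (meson inj_on_subset order_trans)
    ultimately have "nclasses (f ` ?P) (map_prod f f ` (facing ?U ?P \<union> ?B \<union> N)) = nclasses ?P (facing ?U ?P \<union> ?B \<union> N)"
      by (intro nclasses_inj_image)
    then show ?thesis
      unfolding base_count_def P_im U_im B_im facing_homeomorphism_image[OF hU PU] by (simp add: image_Un)
  qed
  have pr_im: "upair (f u) (f w) = map_prod f f ` upair u w" for u w
    unfolding upair_def by simp
  have count3: "base_count H a b (f ` S') ?X (upair (f u) (f w) \<union> upair (f u') (f w') \<union> upair (f u'') (f w''))
      = base_count G a b S' ?X (upair u w \<union> upair u' w' \<union> upair u'' w'')"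
    if "{u, w, u', w', u'', w''} \<subseteq> {p, t, p', t', x', x}" for u w u' w' u'' w''
  proof -
    have "{u, w, u', w', u'', w''} \<subseteq> ?P" using that sG(4) by blast
    then have "upair u w \<union> upair u' w' \<union> upair u'' w'' \<subseteq> ?P \<times> ?P" unfolding upair_def by simp
    then show ?thesis unfolding pr_im image_Un[symmetric] by (rule count_im)
  qed
  let ?c = "base_count G a b S' ?X"
  define k where "k = card (components (space_of G))"
  have kH: "card (components (space_of H)) = k"
  proof -
    define M where "M = space_of (spanning_subgraph H ?E)"
    have cM: "components M = (`) f ` components X0"
      unfolding M_def by (rule components_homeomorphism_image[OF hom])
    obtain v where v: "v \<in> Verts G" "q \<in> disc_boundary v" "p \<in> disc_boundary v"
      using qp in_components_subset unfolding joined_at_vertex_def by blast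
    obtain w where w: "w \<in> Verts H" "f p' \<in> disc_boundary w" "r2 \<in> disc_boundary w"
      using pr2 in_components_subset unfolding joined_at_vertex_def by blast
    obtain v' where v': "v' \<in> Verts G" "w = f ` v'" using w(1) V by blast
    have vb: "q \<in> v" "p \<in> v" using v disc_topology(6)[OF ribbonD(3)[OF G v(1)]] by auto
    have wb: "f p' \<in> f ` v'" "r2 \<in> f ` v'" using w disc_topology(6)[OF ribbonD(3)[OF H w(1)]] v'(2) by auto
    have fl: "p \<in> edge_disc G b" "p' \<in> edge_disc G b"
      using flags_subset[OF G ab(2)] flags_two_ends(1)[OF G ab(2) eb t(1,2)] by auto
    then have "p' \<in> X0" using eX[OF bE] by blast
    then have p'v: "p' \<in> v'" using wb(1) inj_on_image_mem_iff[OF inj _ VX[OF v'(1)]] by blast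
    \<comment> \<open>The vertex at the old position, the disc of \<open>b\<close> and the vertex at
      the new position form a connected set. So a component of the rest touches the sliding end
      before the slide exactly if its image does so afterwards.\<close>
    define N where "N = v \<union> edge_disc G b \<union> v'"
    have cN: "connected N" unfolding N_def
      using space_pieces(1)[OF G v(1)] space_pieces(1)[OF G v'(1)] space_pieces(2)[OF G ab(2)] vb(2) fl p'v
      by (intro connected_Un) blast+
    have NX: "N \<subseteq> X0" unfolding N_def using VX[OF v(1)] VX[OF v'(1)] eX[OF bE] by blast
    have qS: "q \<in> S" using line_segment_topology(5)[OF ribbonD(8)[OF G ab(1) Sa(1)]] qr by blast
    have r2S: "r2 \<in> S2" using line_segment_topology(5)[OF ribbonD(8)[OF H aH(1) S2a]] r2 by blast
    have SX: "S \<subseteq> X0" using Union_ends[of G a] Sa(1) VX' by blast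
    have S2M: "S2 \<subseteq> M"
      using Union_ends[of H a] S2a unfolding M_def space_of_def by auto
    have fX: "f ` X0 = M" using homeomorphism_image1[OF hom] unfolding M_def .
    have iff: "f ` K \<inter> \<Union>(ends H a) = {} \<longleftrightarrow> K \<inter> \<Union>(ends G a) = {}" if K: "K \<in> components X0" for K
    proof -
      have KX: "K \<subseteq> X0" using in_components_subset[OF K] .
      have fK: "f ` K \<in> components M" using K cM by blast
      have "K \<inter> S \<noteq> {} \<longleftrightarrow> S \<subseteq> K"
        using meets_component_iff[OF K _ SX order_refl]
          line_segment_topology(2,4)[OF ribbonD(8)[OF G ab(1) Sa(1)]] by metis
      moreover have "K \<inter> {q} \<noteq> {} \<longleftrightarrow> N \<subseteq> K"
        by (rule meets_component_iff[OF K cN NX]) (use vb(1) in \<open>auto simp: N_def\<close>)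
      ultimately have 1: "K \<inter> S \<noteq> {} \<longleftrightarrow> N \<subseteq> K" using qS by blast
      have "connected (f ` N)"
        using connected_continuous_image[OF continuous_on_subset[OF homeomorphism_cont1[OF hom] NX] cN] .
      moreover have "f ` N \<subseteq> M" using NX fX by blast
      ultimately have "f ` K \<inter> {r2} \<noteq> {} \<longleftrightarrow> f ` N \<subseteq> f ` K"
        by (rule meets_component_iff[OF fK]) (use wb(2) in \<open>auto simp: N_def\<close>)
      moreover have "f ` K \<inter> S2 \<noteq> {} \<longleftrightarrow> S2 \<subseteq> f ` K"
        using meets_component_iff[OF fK _ S2M order_refl]
          line_segment_topology(2,4)[OF ribbonD(8)[OF H aH(1) S2a]] by metis
      moreover have "f ` N \<subseteq> f ` K \<longleftrightarrow> N \<subseteq> K"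
        using inj_on_image_subset_iff[OF inj NX KX] .
      ultimately have 2: "f ` K \<inter> S2 \<noteq> {} \<longleftrightarrow> N \<subseteq> K" using r2S by blast
      have 3: "f ` K \<inter> f ` S' = {} \<longleftrightarrow> K \<inter> S' = {}"
        unfolding inj_on_image_Int[OF inj KX S'X, symmetric] by simp
      have "f ` K \<inter> \<Union>(ends H a) = {} \<longleftrightarrow> f ` K \<inter> S2 = {} \<and> f ` K \<inter> f ` S' = {}"
        unfolding eHa by auto
      moreover have "K \<inter> \<Union>(ends G a) = {} \<longleftrightarrow> K \<inter> S = {} \<and> K \<inter> S' = {}"
        unfolding ea by auto
      ultimately show ?thesis using 1 2 3 by argo
    qed
    have "{K \<in> components M. K \<inter> \<Union>(ends H a) = {}} = (`) f ` {K \<in> components X0. K \<inter> \<Union>(ends G a) = {}}"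
      unfolding cM Compr_image_eq
      by (intro arg_cong[where f = "image ((`) f)"] Collect_cong conj_cong refl iff)
    moreover have "inj_on ((`) f) {K \<in> components X0. K \<inter> \<Union>(ends G a) = {}}"
    proof (rule inj_onI)
      fix C D assume CD: "C \<in> {K \<in> components X0. K \<inter> \<Union>(ends G a) = {}}"
        "D \<in> {K \<in> components X0. K \<inter> \<Union>(ends G a) = {}}" "f ` C = f ` D"
      then have "C \<subseteq> X0" "D \<subseteq> X0"
        using in_components_subset[of C X0] in_components_subset[of D X0] by simp_all
      then show "C = D"
        using inj_on_image_eq_iff[OF inj, of C D] CD(3) by simp
    qed
    ultimately show ?thesis
      unfolding k_def card_components_space[OF G ab(1)] card_components_space[OF H aH(1)] EH
        M_def[symmetric] X0_def[symmetric] by (simp add: card_image)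
  qed
  have G_iff: "spanning_quasi_tree G Y \<longleftrightarrow> boundary_count G Y = k" and G_le: "k \<le> boundary_count G Y"
    if "Y \<subseteq> Edges G" for Y
    using spanning_quasi_tree_iff[OF G that] unfolding boundary_count_def k_def by auto
  have H_iff: "spanning_quasi_tree H Y \<longleftrightarrow> boundary_count H Y = k" and H_le: "k \<le> boundary_count H Y"
    if "Y \<subseteq> Edges G" for Y
    using spanning_quasi_tree_iff[OF H, of Y] that kH unfolding boundary_count_def EH by auto
  have sub: "?X \<subseteq> Edges G" "insert b ?X \<subseteq> Edges G" "insert a ?X \<subseteq> Edges G" "insert a (insert b ?X) \<subseteq> Edges G"
    using A ab by auto
  have c0: "boundary_count G ?X = ?c (upair x x' \<union> upair p t \<union> upair p' t')"
    using sG(6) upair_commute[of x x'] by simp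
  have cb: "boundary_count G (insert b ?X) = ?c (upair x x' \<union> upair p p' \<union> upair t t')"
    using sG(7) upair_commute[of x x'] by simp
  note ca = sG(8) and cab = sG(9)
  have c0H: "boundary_count H ?X = boundary_count G ?X"
    unfolding sH(6) c0 by (subst count3) (auto simp: Un_ac)
  have cbH: "boundary_count H (insert b ?X) = boundary_count G (insert b ?X)"
    unfolding sH(7) cb by (subst count3) (auto simp: upair_commute)
  have caH: "boundary_count H (insert a ?X) = ?c (upair p' x' \<union> upair t' x \<union> upair p t)"
    unfolding sH(8) by (subst count3) auto
  \<comment> \<open>With \<open>b\<close> present, a side of \<open>b\<close> joins p and p', so an
    end beside p and an end beside p' interrupt the same boundary strand; both graphs give the same
    pairing of terminals.\<close>
  have cabH: "boundary_count H (insert a (insert b ?X)) = boundary_count G (insert a (insert b ?X))"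
    unfolding sH(9) cab by (subst count3) (auto simp: upair_commute Un_ac)
  have c_eq: "?c = (\<lambda>N. closed_strands ?U ?P + nclasses ?P (facing ?U ?P \<union> ?B \<union> N))"
    unfolding base_count_def by (rule refl)
  have par: "?c (upair p' x' \<union> upair t' x \<union> upair p t) = k \<longleftrightarrow>
    (?c (upair p x \<union> upair t x' \<union> upair p' t') = k) \<noteq> (?c (upair x x' \<union> upair p p' \<union> upair t t') = k)"
  proof (rule slide_parity[OF sG(1,2) sG(4,3) _ _ c_eq])
    show "distinct [p, t, p', t', x, x']" using sG(5) by auto
    show "{p, t, p', t', x', x} = {p, t, p', t', x, x'}" by blast
    show "k \<le> ?c (upair x x' \<union> upair p t \<union> upair p' t')" using G_le[OF sub(1)] c0 by simp
    show "k \<le> ?c (upair x x' \<union> upair p p' \<union> upair t t')" using G_le[OF sub(2)] cb by simp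
    show "k \<le> ?c (upair p x \<union> upair t x' \<union> upair p' t')" using G_le[OF sub(3)] ca by simp
    \<comment> \<open>This bound comes from \<open>H\<close>, and it is here that both graphs must
      have the same number of components.\<close>
    show "k \<le> ?c (upair p' x' \<union> upair t' x \<union> upair p t)" using H_le[OF sub(3)] caH by simp
    show "k \<le> ?c (upair p x \<union> upair p' x' \<union> upair t t')" using G_le[OF sub(4)] cab by simp
  qed
  \<comment> \<open>The four cases are the possible intersections of \<open>A\<close> with {a, b};
    parity enters only in the third.\<close>
  consider "A = ?X" "a \<notin> A" | "A = insert b ?X" "a \<notin> A" | "A = insert a ?X" "a \<in> A" "b \<notin> A"
    | "A = insert a (insert b ?X)" "b \<in> A"
    by blast
  then show ?thesis
  proof cases
    case 1
    then show ?thesis using G_iff[OF sub(1)] H_iff[OF sub(1)] c0H by metis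
  next
    case 2
    then show ?thesis using G_iff[OF sub(2)] H_iff[OF sub(2)] cbH by metis
  next
    case 3
    have "insert b (A - {a}) = insert b ?X" using 3(3) by blast
    moreover have "boundary_count H A = k \<longleftrightarrow> (boundary_count G A = k) \<noteq> (boundary_count G (insert b ?X) = k)"
      using par caH ca cb 3(1) by metis
    ultimately show ?thesis
      using G_iff[OF A] H_iff[OF A] G_iff[OF sub(2)] 3(2,3) by simp
  next
    case 4
    then show ?thesis using G_iff[OF sub(4)] H_iff[OF sub(4)] cabH by metis
  qed
qed

theorem theorem2p5:
  fixes G :: "('e, 'p::t2_space) ribbon"
    and G_ab :: "('e, 'q::t2_space) ribbon"
    and a b :: 'e
  assumes "ribbon_graph G"
    and "a \<in> Edges G" and "b \<in> Edges G" and "a \<noteq> b"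
    and "neighbouring_ends G a b"
    and "handle_slide G a b G_ab"
  shows "delta_matroid G_ab = slide_system (delta_matroid G) a b"
proof -
  have E: "Edges G_ab = Edges G"
    using assms(6) unfolding handle_slide_def by (elim conjE)
  let ?F = "{A. spanning_quasi_tree G A}"
  let ?S = "{X \<union> {a} | X. X \<union> {b} \<in> ?F \<and> X \<subseteq> Edges G - {a, b}}"
  have sub: "A \<subseteq> Edges G" if "spanning_quasi_tree G A" for A
    using that unfolding spanning_quasi_tree_def by blast
  \<comment> \<open>The set \<open>X\<close> can only be A - {a}, which turns membership into the
    condition of \<open>handle_slide_quasi_trees\<close>.\<close>
  have mem: "A \<in> ?S \<longleftrightarrow> a \<in> A \<and> b \<notin> A \<and> spanning_quasi_tree G (insert b (A - {a}))" for A
  proof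
    assume "A \<in> ?S"
    then obtain X where X: "A = X \<union> {a}" "spanning_quasi_tree G (X \<union> {b})" "X \<subseteq> Edges G - {a, b}"
      by blast
    then have "insert b (A - {a}) = X \<union> {b}" by blast
    then show "a \<in> A \<and> b \<notin> A \<and> spanning_quasi_tree G (insert b (A - {a}))"
      using X assms(4) by auto
  next
    assume A: "a \<in> A \<and> b \<notin> A \<and> spanning_quasi_tree G (insert b (A - {a}))"
    then have "A = (A - {a}) \<union> {a}" "(A - {a}) \<union> {b} \<in> ?F" "A - {a} \<subseteq> Edges G - {a, b}"
      using sub[of "insert b (A - {a})"] by auto
    then show "A \<in> ?S" by blast
  qed
  have "spanning_quasi_tree G_ab A \<longleftrightarrow> A \<in> sym_diff ?F ?S" for A
  proof (cases "A \<subseteq> Edges G")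
    case True
    then show ?thesis
      using handle_slide_quasi_trees[OF assms(1-4,6) True] mem[of A] by blast
  next
    \<comment> \<open>Sets with elements that are not edges belong to neither side.\<close>
    case False
    then have "\<not> spanning_quasi_tree G_ab A" "A \<notin> ?F"
      using sub E unfolding spanning_quasi_tree_def by auto
    moreover have "A \<notin> ?S" using False assms(2) by blast
    ultimately show ?thesis by blast
  qed
  then have "{A. spanning_quasi_tree G_ab A} = sym_diff ?F ?S" by blast
  then show ?thesis
    unfolding delta_matroid_def slide_system_def E by simp
qed

end
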